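(* Suppose $\mathfrak{a}_* < \kappa = \mathfrak{s}$, $J_* \subseteq [\omega]^{\aleph_0}$ is dense, and $\mathrm{Pr}(\kappa, \mathfrak{a}_* )$ holds. Then there is a saturated MAD family $\mathcal{A} \subseteq J_*$.
   Context: $[\omega]^{\aleph_0}$ is the set of infinite subsets of $\omega$. For $A,B\subseteq\omega$, $A \subseteq^* B$ means that $A \setminus B$ is finite; we then say that $B$ almost contains $A$. Two subsets of $\omega$ are almost disjoint if their intersection is finite. A family $\mathcal{A} \subseteq [\omega]^{\aleph_0}$ is AD if it is infinite and any two distinct members are almost disjoint. It is MAD if it is AD and $\subseteq$-maximal among AD families $\subseteq [\omega]^{\aleph_0}$. For $\mathcal{A} \subseteq [\omega]^{\aleph_0}$, $\mathrm{id}_{\mathcal{A}}$ is the ideal of subsets of $\omega$ generated by $\mathcal{A}$ together with the finite subsets of $\omega$, and $\mathrm{id}^+_{\mathcal{A}} = [\omega]^{\aleph_0} \setminus \mathrm{id}_{\mathcal{A}}$. A MAD family $\mathcal{A}$ is saturated if every $B \in \mathrm{id}^+_{\mathcal{A}}$ almost contains some member of $\mathcal{A}$. $J \subseteq [\omega]^{\aleph_0}$ is dense if for every $B \in [\omega]^{\aleph_0}$ there is $A \in J$ with $A \subseteq B$. $\mathfrak{s}$ is the splitting number: the minimal cardinality of a family $\mathcal{S} \subseteq [\omega]^{\aleph_0}$ such that there is no $B \in [\omega]^{\aleph_0}$ satisfying, for every $C \in \mathcal{S}$, $B \subseteq^* C$ or $B \subseteq^* \omega \setminus C$. $\mathfrak{a}_*$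 is the minimal cardinal $\kappa$ such that there is a sequence $\langle A_\alpha : \alpha < \kappa + \omega\rangle$ (ordinal sum) of pairwise almost disjoint infinite subsets of $\omega$ for which there is no infinite $B \subseteq \omega$ that is almost disjoint to $A_\alpha$ for every $\alpha < \kappa$ while $B \cap A_{\kappa+n}$ is infinite for infinitely many $n<\omega$. For a set of ordinals $E$, $\mathrm{acc}(E) = \{\delta \in E : \delta = \sup(E \cap \delta)\}$ is the set of its accumulation points; $\mathrm{otp}$ denotes order type. For cardinals $\kappa \ge \theta \ge \aleph_0$, $\mathrm{Pr}(\kappa,\theta)$ (which abbreviates $\mathrm{Pr}(\kappa,\theta,\aleph_0,\aleph_0)$) means that there is a pair $(E, \bar{\mathcal{P}})$ such that: (a) $\bar{\mathcal{P}} = \langle \mathcal{P}_\alpha : \alpha \in E\rangle$; (b) $E$ is a club of $\kappa$, and for every $\gamma \in E$, $|\gamma|$ divides $\gamma$ (as ordinals, i.e. $\gamma=|\gamma|\cdot\xi$ for some ordinal $\xi$); (c) if $u \in \mathcal{P}_\alpha$ then $u$ is a countable subset of $\alpha$ with no last member; (d) $\bar{\mathcal{P}}$ is $\subseteq$-increasing, and $|\mathcal{P}_\alpha| < \kappa$ for every $\alpha \in E$; (e) if $w \subseteq \kappa$ is bounded, $\mathrm{otp}(w) = \theta$ and $\sup(w) \in \mathrm{acc}(E)$, then there are $u, j$ such that $|u \cap w| \ge \aleph_0$, $j \in \mathrm{acc}(E)$, $u \in \mathcal{P}_j$, and $|w \cap j| < \theta$, i.e. $j < \sup(w)$; (f)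 if $i \in \{0\} \cup E$, $j = \min(E \setminus (i+1))$, $w \subseteq [i,j)$ and $\mathrm{otp}(w) = \theta$, then there is a set $u \in \mathcal{P}_j$ with $u \subseteq (i,j)$ and $|u \cap w| \ge \aleph_0$. *)

theory Defs
  imports Main "HOL-Library.Countable_Set"
begin

unbundle cardinal_syntax

section \<open>Families of infinite subsets of \<open>\<omega>\<close>\<close>

definition infsets :: "nat set set" where
  "infsets = {A. infinite A}"

definition almost_subset :: "nat set \<Rightarrow> nat set \<Rightarrow> bool"  (infix \<open>\<subseteq>*\<close> 50) where
  "A \<subseteq>* B \<longleftrightarrow> finite (A - B)"

definition almost_disjoint :: "nat set \<Rightarrow> nat set \<Rightarrow> bool" where
  "almost_disjoint A B \<longleftrightarrow> finite (A \<inter> B)"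

definition AD :: "nat set set \<Rightarrow> bool" where
  "AD \<A> \<longleftrightarrow> \<A> \<subseteq> infsets \<and> infinite \<A> \<and> pairwise almost_disjoint \<A>"

definition MAD :: "nat set set \<Rightarrow> bool" where
  "MAD \<A> \<longleftrightarrow> AD \<A> \<and> (\<forall>\<B>. AD \<B> \<and> \<A> \<subseteq> \<B> \<longrightarrow> \<B> = \<A>)"

text \<open>Ideals are not required to be proper.\<close>

definition set_ideal :: "nat set set \<Rightarrow> bool" where
  "set_ideal I \<longleftrightarrow>
     {} \<in> I \<and> (\<forall>A\<in>I. \<forall>B. B \<subseteq> A \<longrightarrow> B \<in> I) \<and> (\<forall>A\<in>I. \<forall>B\<in>I. A \<union> B \<in> I)"

definition id_ideal :: "nat set set \<Rightarrow> nat set set" where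
  "id_ideal \<A> = \<Inter>{I. set_ideal I \<and> \<A> \<subseteq> I \<and> {F. finite F} \<subseteq> I}"

definition id_pos :: "nat set set \<Rightarrow> nat set set" where
  "id_pos \<A> = infsets - id_ideal \<A>"

definition saturated_MAD :: "nat set set \<Rightarrow> bool" where
  "saturated_MAD \<A> \<longleftrightarrow> MAD \<A> \<and> (\<forall>B\<in>id_pos \<A>. \<exists>A\<in>\<A>. A \<subseteq>* B)"

definition dense_family :: "nat set set \<Rightarrow> bool" where
  "dense_family J \<longleftrightarrow> J \<subseteq> infsets \<and> (\<forall>B\<in>infsets. \<exists>A\<in>J. A \<subseteq> B)"

section \<open>The cardinal invariants\<close>

text \<open>
  Ordinals are well-order relations up to \<open>=o\<close>, and cardinals are relations satisfying
  \<open>Card_order\<close>.  The invariants are therefore predicates, which determine the cardinal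
  up to \<open>=o\<close>.
\<close>

definition splitting_family :: "nat set set \<Rightarrow> bool" where
  "splitting_family \<S> \<longleftrightarrow> \<S> \<subseteq> infsets \<and>
     \<not> (\<exists>B\<in>infsets. \<forall>C\<in>\<S>. B \<subseteq>* C \<or> B \<subseteq>* - C)"

definition is_splitting_number :: "'k rel \<Rightarrow> bool" where
  "is_splitting_number \<kappa> \<longleftrightarrow> Card_order \<kappa> \<and>
     (\<exists>\<S>. splitting_family \<S> \<and> |\<S>| =o \<kappa>) \<and>
     (\<forall>\<S>. splitting_family \<S> \<longrightarrow> \<kappa> \<le>o |\<S>| )"

text \<open>
  The index set \<open>\<kappa> + \<omega>\<close> is the disjoint sum \<open>Field \<kappa> <+> UNIV\<close>: \<open>Inl \<alpha>\<close> is the index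
  \<open>\<alpha> < \<kappa>\<close>, and \<open>Inr n\<close> is the index \<open>\<kappa> + n\<close>.
\<close>

definition a_star_sequence :: "'k rel \<Rightarrow> ('k + nat \<Rightarrow> nat set) \<Rightarrow> bool" where
  "a_star_sequence \<kappa> A \<longleftrightarrow>
     (\<forall>x \<in> Field \<kappa> <+> (UNIV :: nat set). infinite (A x)) \<and>
     pairwise (\<lambda>x y. almost_disjoint (A x) (A y)) (Field \<kappa> <+> UNIV) \<and>
     \<not> (\<exists>B. infinite B \<and> (\<forall>\<alpha>\<in>Field \<kappa>. almost_disjoint B (A (Inl \<alpha>))) \<and>
            infinite {n. infinite (B \<inter> A (Inr n))})"

text \<open>
  Minimality may be tested on the underlying type of \<open>\<kappa>\<close> alone: every cardinal below \<open>\<kappa>\<close>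
  is isomorphic to one on a subset of \<open>Field \<kappa>\<close>.
\<close>

definition is_a_star :: "'k rel \<Rightarrow> bool" where
  "is_a_star \<kappa> \<longleftrightarrow> Card_order \<kappa> \<and> (\<exists>A. a_star_sequence \<kappa> A) \<and>
     (\<forall>\<mu> :: 'k rel. Card_order \<mu> \<and> (\<exists>A. a_star_sequence \<mu> A) \<longrightarrow> \<kappa> \<le>o \<mu>)"

section \<open>The principle \<open>Pr(\<kappa>,\<theta>)\<close>\<close>

text \<open>
  The ordinals below \<open>\<kappa>\<close> are the elements of \<open>Field \<kappa>\<close>; the ordinal \<open>\<gamma> < \<kappa>\<close>, as a set, is
  \<open>underS \<kappa> \<gamma>\<close>, and \<open>\<gamma> + 1\<close> is \<open>under \<kappa> \<gamma>\<close>.  For a bounded \<open>A\<close>, \<open>wo_rel.supr \<kappa> A\<close> is the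
  least upper bound of \<open>A\<close> (and \<open>0\<close> for \<open>A = {}\<close>).
\<close>

definition acc :: "'k rel \<Rightarrow> 'k set \<Rightarrow> 'k set" where
  "acc \<kappa> E = {\<delta>\<in>E. \<delta> = wo_rel.supr \<kappa> (E \<inter> underS \<kappa> \<delta>)}"

definition bounded_in :: "'k rel \<Rightarrow> 'k set \<Rightarrow> bool" where
  "bounded_in \<kappa> A \<longleftrightarrow> A \<subseteq> Field \<kappa> \<and> Above \<kappa> A \<noteq> {}"

definition club :: "'k rel \<Rightarrow> 'k set \<Rightarrow> bool" where
  "club \<kappa> E \<longleftrightarrow> E \<subseteq> Field \<kappa> \<and> (\<forall>\<alpha>\<in>Field \<kappa>. \<exists>\<beta>\<in>E. (\<alpha>, \<beta>) \<in> \<kappa>) \<and>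
     (\<forall>A\<subseteq>E. A \<noteq> {} \<and> bounded_in \<kappa> A \<longrightarrow> wo_rel.supr \<kappa> A \<in> E)"

text \<open>The ordinal product \<open>r \<cdot> s\<close>, i.e. \<open>s\<close> copies of \<open>r\<close>: the second coordinate is dominant.\<close>

definition ord_product :: "'a rel \<Rightarrow> 'b rel \<Rightarrow> ('a \<times> 'b) rel" where
  "ord_product r s =
     {((x, y), (x', y')). x \<in> Field r \<and> x' \<in> Field r \<and> y \<in> Field s \<and> y' \<in> Field s \<and>
        ((y \<noteq> y' \<and> (y, y') \<in> s) \<or> (y = y' \<and> (x, x') \<in> r))}"

text \<open>If \<open>\<gamma> > 0\<close>, the quotient \<open>\<xi>\<close> satisfies \<open>\<xi> \<le> \<gamma>\<close>, so it can be sought on the type of \<open>\<kappa>\<close>.\<close>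

definition card_divides :: "'k rel \<Rightarrow> 'k \<Rightarrow> bool" where
  "card_divides \<kappa> \<gamma> \<longleftrightarrow>
     (\<exists>\<xi> :: 'k rel. Well_order \<xi> \<and>
        Restr \<kappa> (underS \<kappa> \<gamma>) =o ord_product |underS \<kappa> \<gamma>| \<xi>)"

definition Pr_witness ::
  "'k rel \<Rightarrow> 't rel \<Rightarrow> 'k set \<Rightarrow> ('k \<Rightarrow> 'k set set) \<Rightarrow> bool" where
  "Pr_witness \<kappa> \<theta> E P \<longleftrightarrow>
     club \<kappa> E \<and> (\<forall>\<gamma>\<in>E. card_divides \<kappa> \<gamma>) \<and>
     (\<forall>\<alpha>\<in>E. \<forall>u\<in>P \<alpha>. countable u \<and> u \<subseteq> underS \<kappa> \<alpha> \<and>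
        (\<forall>x\<in>u. \<exists>y\<in>u. y \<noteq> x \<and> (x, y) \<in> \<kappa>)) \<and>
     (\<forall>\<alpha>\<in>E. \<forall>\<beta>\<in>E. (\<alpha>, \<beta>) \<in> \<kappa> \<longrightarrow> P \<alpha> \<subseteq> P \<beta>) \<and>
     (\<forall>\<alpha>\<in>E. |P \<alpha>| <o \<kappa>) \<and>
     (\<forall>w. bounded_in \<kappa> w \<and> Restr \<kappa> w =o \<theta> \<and> wo_rel.supr \<kappa> w \<in> acc \<kappa> E \<longrightarrow>
        (\<exists>u j. infinite (u \<inter> w) \<and> j \<in> acc \<kappa> E \<and> u \<in> P j \<and> |w \<inter> underS \<kappa> j| <o \<theta>)) \<and>
     (\<forall>i \<in> insert (wo_rel.minim \<kappa> (Field \<kappa>)) E. \<forall>j w.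
        j = wo_rel.minim \<kappa> (E - under \<kappa> i) \<and>
        w \<subseteq> above \<kappa> i \<inter> underS \<kappa> j \<and> Restr \<kappa> w =o \<theta> \<longrightarrow>
        (\<exists>u\<in>P j. u \<subseteq> aboveS \<kappa> i \<inter> underS \<kappa> j \<and> infinite (u \<inter> w)))"

definition Pr :: "'k rel \<Rightarrow> 't rel \<Rightarrow> bool" where
  "Pr \<kappa> \<theta> \<longleftrightarrow> Card_order \<kappa> \<and> Card_order \<theta> \<and> \<theta> \<le>o \<kappa> \<and> natLeq \<le>o \<theta> \<and>
     (\<exists>E P. Pr_witness \<kappa> \<theta> E P)"

end

theory Submission
  imports Defs
begin

text \<open>
  The family is built by a recursion of length continuum over all \<open>B \<subseteq> \<omega>\<close>: if \<open>B\<close> is positive for the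
  ideal of the family built so far, a member of \<open>J\<close> below \<open>B\<close> is added which is almost disjoint from
  all earlier members.  Saturation, and with it maximality, is then immediate.  The whole difficulty
  is that a new member must always exist, in other words that fewer than continuum many sets never
  become a maximal family below a positive set.

  To ensure this, each member carries a node, which is a pair of a level \<open>e < \<kappa>\<close> and a set \<open>N\<close> of levels
  below \<open>e\<close>.  Every level \<open>k\<close> carries a set \<open>C k\<close>, which may depend on the branch \<open>N\<close> below \<open>k\<close>, and a member
  at \<open>(e, N)\<close> is almost contained in \<open>C k\<close> or in its complement, according as \<open>k \<in> N\<close> or not, for all
  \<open>k < e\<close>.  Members on incomparable nodes are almost disjoint for this reason alone, and if the node
  of a member lies on a branch, then the member itself is one of the sets \<open>C k\<close> of that branch.
  There are two more kinds of sets \<open>C k\<close>.  Base sets come from a family of size \<open>\<kappa>\<close> such that any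
  countably many infinite sets are split by one set of the family (\<open>simultaneous_splitting_family\<close>);
  hence a positive set cannot follow a branch through all levels modulo the ideal: at some first level it
  is split into two positive pieces (\<open>first_split\<close>).  Iterating this gives a Cantor scheme, whose continuum many
  branches carry positive sets on incomparable nodes (\<open>cantor_scheme\<close>).  Graph sets make branches thin.
  Given countably many earlier levels \<open>u\<close>, the parts of \<open>\<omega>\<close> discarded at the levels in \<open>u\<close> are regarded as columns,
  and for every function of a scale there is the set of points of the columns that lie below the function.
  A positive set that is split by none of these sets loses members of the family at only
  finitely many of the levels in \<open>u\<close> (\<open>scale_graph_splits\<close>, \<open>treated_exits\<close>).  By the guessing principle
  \<open>Pr(\<kappa>, a\<^sub>*)\<close>, fewer than \<open>\<kappa>\<close> many sets \<open>u\<close> per stage meet every set of \<open>a\<^sub>*\<close> many levels in an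
  infinite set (\<open>Pr_hits\<close>).  So a positive set on a branch meets fewer than \<open>a\<^sub>*\<close> many members
  that have left the branch (\<open>checkpoint_exits\<close>).  The definition of \<open>a\<^sub>*\<close> is exactly what is needed to shrink
  the positive set to an infinite set almost disjoint from those (\<open>a_star_escape\<close>).

  What remains are members whose node agrees with the branch long enough.  Such a member decides all the sets at which the
  Cantor scheme splits (\<open>decided_elsewhere\<close>), so it can meet the set of only one branch of the scheme; there are continuum many
  branches and fewer members, so some branch is free of them (\<open>escape\<close>).  The same
  counting, applied to a Cantor scheme below the resulting infinite set, finds a node which is
  not an initial segment of an old one (\<open>free_node\<close>).  Therefore the sets \<open>C k\<close> seen by old members do not change,
  and the recursion goes through (\<open>extend_family\<close>, \<open>good_chain\<close>).
\<close>

section \<open>Almost inclusion and the ideal of an almost disjoint family\<close>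

text \<open>
  Membership in the ideal generated by \<open>\<A>\<close> and the finite sets, in the explicit form in which it is
  used; see \<open>id_ideal_covered\<close>.  A set is called positive if it is not covered.
\<close>

definition covered :: "nat set set \<Rightarrow> nat set \<Rightarrow> bool" where
  "covered \<A> B \<longleftrightarrow> (\<exists>W\<subseteq>\<A>. finite W \<and> B \<subseteq>* \<Union>W)"

lemma almost_subset_trans: "A \<subseteq>* B \<Longrightarrow> B \<subseteq>* C \<Longrightarrow> A \<subseteq>* C"
  unfolding almost_subset_def by (rule finite_subset[of _ "(A - B) \<union> (B - C)"]) auto

lemma subset_almost_subset: "A \<subseteq> B \<Longrightarrow> A \<subseteq>* B"
  unfolding almost_subset_def by (simp add: Diff_eq_empty_iff[THEN iffD2])

lemma subset_almost_subset_trans: "A \<subseteq> B \<Longrightarrow> B \<subseteq>* C \<Longrightarrow> A \<subseteq>* C"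
  by (blast intro: almost_subset_trans subset_almost_subset)

lemma almost_subset_disjoint:
  "A \<subseteq>* B \<Longrightarrow> finite (B \<inter> C) \<Longrightarrow> finite (A \<inter> C)"
  unfolding almost_subset_def by (rule finite_subset[of _ "(A - B) \<union> (B \<inter> C)"]) auto

lemma covered_mono: "B' \<subseteq>* B \<Longrightarrow> covered \<A> B \<Longrightarrow> covered \<A> B'"
  unfolding covered_def by (blast intro: almost_subset_trans)

lemma covered_subset: "B' \<subseteq> B \<Longrightarrow> covered \<A> B \<Longrightarrow> covered \<A> B'"
  by (blast intro: covered_mono subset_almost_subset)

lemma covered_mono_family: "\<A> \<subseteq> \<B> \<Longrightarrow> covered \<A> B \<Longrightarrow> covered \<B> B"
  unfolding covered_def by blast

lemma covered_finite: "finite B \<Longrightarrow> covered \<A> B"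
  unfolding covered_def almost_subset_def by (intro exI[of _ "{}"]) auto

lemma covered_Union: "W \<subseteq> \<A> \<Longrightarrow> finite W \<Longrightarrow> covered \<A> (\<Union>W)"
  unfolding covered_def almost_subset_def by (intro exI[of _ W]) auto

lemma covered_Un: "covered \<A> B \<Longrightarrow> covered \<A> C \<Longrightarrow> covered \<A> (B \<union> C)"
proof -
  assume "covered \<A> B" "covered \<A> C"
  then obtain V W where "V \<subseteq> \<A>" "finite V" "B \<subseteq>* \<Union>V" "W \<subseteq> \<A>" "finite W" "C \<subseteq>* \<Union>W"
    unfolding covered_def by blast
  moreover from this have "B \<union> C \<subseteq>* \<Union>(V \<union> W)"
    unfolding almost_subset_def
    by (intro finite_subset[of "B \<union> C - \<Union>(V \<union> W)" "(B - \<Union>V) \<union> (C - \<Union>W)"]) auto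
  ultimately show ?thesis unfolding covered_def by (intro exI[of _ "V \<union> W"]) auto
qed

lemma covered_split: "covered \<A> (B - C) \<Longrightarrow> covered \<A> (B \<inter> C) \<Longrightarrow> covered \<A> B"
  using covered_Un[of \<A> "B - C" "B \<inter> C"] by (simp add: Un_Diff_Int)

lemma id_ideal_covered: "id_ideal \<A> = {B. covered \<A> B}"
proof
  have "set_ideal {B. covered \<A> B}"
    unfolding set_ideal_def by (auto intro: covered_finite covered_subset covered_Un)
  moreover have "\<A> \<subseteq> {B. covered \<A> B}"
    using covered_Union[of "{A}" \<A> for A] by auto
  moreover have "{F. finite F} \<subseteq> {B. covered \<A> B}"
    by (auto intro: covered_finite)
  ultimately show "id_ideal \<A> \<subseteq> {B. covered \<A> B}" unfolding id_ideal_def by blast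
next
  show "{B. covered \<A> B} \<subseteq> id_ideal \<A>"
    unfolding id_ideal_def
  proof (intro subsetI InterI, clarify)
    fix B I assume "covered \<A> B" and I: "set_ideal I" "\<A> \<subseteq> I" "{F. finite F} \<subseteq> I"
    then obtain W where W: "W \<subseteq> \<A>" "finite W" "finite (B - \<Union>W)"
      unfolding covered_def almost_subset_def by blast
    have "\<Union>W \<in> I"
      using W(2,1) by (induction W) (use I in \<open>auto simp: set_ideal_def\<close>)
    moreover have "B - \<Union>W \<in> I" using W I by blast
    ultimately have "\<Union>W \<union> (B - \<Union>W) \<in> I" using I(1) unfolding set_ideal_def by blast
    moreover have "B \<subseteq> \<Union>W \<union> (B - \<Union>W)" by blast
    ultimately show "B \<in> I" using I(1) unfolding set_ideal_def by blast
  qed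
qed

lemma covered_empty_iff: "covered {} B \<longleftrightarrow> finite B"
  unfolding covered_def almost_subset_def by auto

lemma finite_Int_Union_of_finite:
  "finite W \<Longrightarrow> (\<And>A. A \<in> W \<Longrightarrow> finite (X \<inter> A)) \<Longrightarrow> finite (X \<inter> \<Union>W)"
  by (induction W rule: finite_induct) (auto simp: Int_Un_distrib)

text \<open>
  Almost everything of \<open>X\<close> lies in finitely many members, so one of them takes an infinite part.
\<close>

lemma covered_meets:
  assumes "covered \<A> B" "X \<subseteq> B" "infinite X"
  shows "\<exists>A\<in>\<A>. infinite (A \<inter> X)"
proof (rule ccontr)
  assume *: "\<not> ?thesis"
  obtain W where W: "W \<subseteq> \<A>" "finite W" "finite (B - \<Union>W)"
    using assms(1) unfolding covered_def almost_subset_def by blast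
  have "finite (X \<inter> \<Union>W)"
    using * W by (intro finite_Int_Union_of_finite) (auto simp: Int_commute)
  moreover have "finite (X - \<Union>W)" using W(3) assms(2) by (meson Diff_mono finite_subset subset_refl)
  ultimately show False using assms(3) by (metis Un_Diff_Int finite_UnI)
qed

text \<open>
  A member outside a finite cover of \<open>B\<close> is almost disjoint from each set of the cover, hence from \<open>B\<close>.
  This gives the usual way to recognize positive sets: they meet infinitely many members, or they
  contain an infinite set almost disjoint from all members.
\<close>

lemma covered_meets_finitely:
  assumes ad: "pairwise almost_disjoint \<A>" and "covered \<A> B"
  shows "finite {A\<in>\<A>. infinite (A \<inter> B)}"
proof -
  obtain W where W: "W \<subseteq> \<A>" "finite W" "finite (B - \<Union>W)"
    using assms(2) unfolding covered_def almost_subset_def by blast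
  have "A \<in> W" if "A \<in> \<A>" "infinite (A \<inter> B)" for A
  proof (rule ccontr)
    assume "A \<notin> W"
    have "finite (A \<inter> \<Union>W)"
    proof (rule finite_Int_Union_of_finite[OF W(2)])
      fix A' assume "A' \<in> W"
      then have "A' \<in> \<A>" "A \<noteq> A'" using W(1) \<open>A \<notin> W\<close> by auto
      then show "finite (A \<inter> A')"
        using ad that(1) unfolding pairwise_def almost_disjoint_def by simp
    qed
    then have "finite ((A \<inter> \<Union>W) \<union> (B - \<Union>W))" using W(3) by blast
    moreover have "A \<inter> B \<subseteq> (A \<inter> \<Union>W) \<union> (B - \<Union>W)" by blast
    ultimately show False using that(2) finite_subset by blast
  qed
  then show ?thesis using W(2) by (auto intro: rev_finite_subset[of W])
qed

lemma not_covered_if_meets_infinitely: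
  "pairwise almost_disjoint \<A> \<Longrightarrow> infinite {A\<in>\<A>. infinite (A \<inter> B)} \<Longrightarrow> \<not> covered \<A> B"
  using covered_meets_finitely by blast

lemma not_covered_if_almost_disjoint:
  "infinite X \<Longrightarrow> X \<subseteq> B \<Longrightarrow> (\<And>A. A \<in> \<A> \<Longrightarrow> finite (A \<inter> X)) \<Longrightarrow> \<not> covered \<A> B"
  using covered_meets by blast

lemma infinite_choice_increasing:
  fixes X :: "nat \<Rightarrow> nat set"
  assumes "\<And>n. infinite (X n)"
  shows "\<exists>y. strict_mono y \<and> (\<forall>n. y n \<in> X n)"
proof -
  have "\<exists>y. \<forall>n. (y n \<in> X n) \<and> y n < y (Suc n)"
  proof (rule dependent_nat_choice)
    show "\<exists>x. x \<in> X 0" using assms[of 0] by (metis finite.emptyI ex_in_conv)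
    show "\<exists>y. y \<in> X (Suc n) \<and> x < y" for x n
      using assms[of "Suc n"] by (metis infinite_nat_iff_unbounded)
  qed
  then show ?thesis by (auto simp: strict_mono_Suc_iff)
qed

lemma pseudo_intersection:
  fixes X :: "nat \<Rightarrow> nat set"
  assumes "\<And>n. infinite (X n)" "\<And>n. X (Suc n) \<subseteq> X n"
  shows "\<exists>Y. infinite Y \<and> Y \<subseteq> X 0 \<and> (\<forall>n. Y \<subseteq>* X n)"
proof -
  obtain y where y: "strict_mono y" "\<And>n. y n \<in> X n"
    using infinite_choice_increasing[of X, OF assms(1)] by blast
  have dec: "X n \<subseteq> X m" if "m \<le> n" for m n
    using lift_Suc_antimono_le[of X, OF assms(2) that] .
  have "range y \<subseteq>* X n" for n
    unfolding almost_subset_def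
  proof (rule finite_subset)
    show "range y - X n \<subseteq> y ` {..<n}"
      using y(2) dec by (auto simp: subset_eq) (meson imageI lessThan_iff not_le)
  qed simp
  moreover have "infinite (range y)"
    using y(1) by (simp add: finite_image_iff strict_mono_imp_inj_on)
  moreover have "range y \<subseteq> X 0" using y(2) dec by (auto simp: subset_eq)
  ultimately show ?thesis by blast
qed

text \<open>
  If some infinite pseudo-intersection is almost disjoint from all members, it is itself positive.
  Otherwise each pseudo-intersection meets a member; removing the members found so far
  keeps the sequence positive, so infinitely many members are found one after another, and the
  union of suitable tails of their pseudo-intersections meets all of them.
\<close>

lemma positive_pseudo_intersection:
  fixes B :: "nat \<Rightarrow> nat set"
  assumes ad: "pairwise almost_disjoint \<A>"
    and pos: "\<And>n. \<not> covered \<A> (B n)" and dec: "\<And>n. B (Suc n) \<subseteq> B n"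
  shows "\<exists>Y. \<not> covered \<A> Y \<and> Y \<subseteq> B 0 \<and> (\<forall>n. Y \<subseteq>* B n)"
proof (cases "\<exists>X. infinite X \<and> X \<subseteq> B 0 \<and> (\<forall>n. X \<subseteq>* B n) \<and> (\<forall>A\<in>\<A>. finite (A \<inter> X))")
  case True
  then show ?thesis using not_covered_if_almost_disjoint by blast
next
  case no_ad: False
  have dec': "B n \<subseteq> B m" if "m \<le> n" for m n
    using lift_Suc_antimono_le[of B, OF dec that] .
  have step: "\<exists>A X. A \<in> \<A> - F \<and> infinite (A \<inter> X) \<and> (\<forall>n. X \<subseteq>* B n)"
    if F: "finite F" "F \<subseteq> \<A>" for F
  proof -
    have "\<exists>X. infinite X \<and> X \<subseteq> B 0 - \<Union>F \<and> (\<forall>n. X \<subseteq>* B n - \<Union>F)"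
    proof (rule pseudo_intersection)
      show "infinite (B n - \<Union>F)" for n
        using pos[of n] F unfolding covered_def almost_subset_def by blast
    qed (use dec in blast)
    then obtain X where X: "infinite X" "X \<subseteq> B 0 - \<Union>F" "\<And>n. X \<subseteq>* B n - \<Union>F" by blast
    have X': "X \<subseteq>* B n" for n using X(3)[of n] by (blast intro: almost_subset_trans subset_almost_subset)
    then obtain A where "A \<in> \<A>" "infinite (A \<inter> X)"
      using no_ad X(1,2) by blast
    moreover have "A \<notin> F" using X(2) \<open>infinite (A \<inter> X)\<close>
      by (metis Diff_disjoint Int_commute Sup_upper disjoint_iff finite.emptyI inf_mono subsetD subset_empty ex_in_conv)
    ultimately show ?thesis using X' by blast
  qed
  have "\<exists>F :: nat \<Rightarrow> nat set set. \<forall>n. (finite (F n) \<and> F n \<subseteq> \<A>) \<and>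
     (\<exists>A X. A \<notin> F n \<and> F (Suc n) = insert A (F n) \<and> infinite (A \<inter> X) \<and> (\<forall>k. X \<subseteq>* B k))"
  proof (rule dependent_nat_choice)
    show "\<exists>x. finite x \<and> x \<subseteq> \<A>" by blast
    fix F and n :: nat assume "finite F \<and> F \<subseteq> \<A>"
    then obtain A X where "A \<in> \<A> - F" "infinite (A \<inter> X)" "\<forall>n. X \<subseteq>* B n"
      using step by blast
    then have "finite (insert A F)" "insert A F \<subseteq> \<A>"
        "A \<notin> F \<and> insert A F = insert A F \<and> infinite (A \<inter> X) \<and> (\<forall>k. X \<subseteq>* B k)"
      using \<open>finite F \<and> F \<subseteq> \<A>\<close> by auto
    then show "\<exists>G. (finite G \<and> G \<subseteq> \<A>) \<and>
       (\<exists>A X. A \<notin> F \<and> G = insert A F \<and> infinite (A \<inter> X) \<and> (\<forall>k. X \<subseteq>* B k))"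
      by (intro exI[of _ "insert A F"] conjI) (assumption | rule exI)+
  qed
  then obtain F :: "nat \<Rightarrow> nat set set" where F: "\<forall>n. (finite (F n) \<and> F n \<subseteq> \<A>) \<and>
     (\<exists>A X. A \<notin> F n \<and> F (Suc n) = insert A (F n) \<and> infinite (A \<inter> X) \<and> (\<forall>k. X \<subseteq>* B k))"
    by (rule exE)
  then have F2: "F n \<subseteq> \<A>" for n by simp
  have "\<forall>n. \<exists>A X. A \<notin> F n \<and> F (Suc n) = insert A (F n) \<and> infinite (A \<inter> X) \<and> (\<forall>k. X \<subseteq>* B k)"
    using F by simp
  then obtain A X
    where AX: "\<And>n. A n \<notin> F n" "\<And>n. F (Suc n) = insert (A n) (F n)"
      "\<And>n. infinite (A n \<inter> X n)" "\<And>n k. X n \<subseteq>* B k" by metis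
  have inc: "F m \<subseteq> F n" if "m \<le> n" for m n
    by (rule lift_Suc_mono_le[of F, OF _ that]) (simp add: AX(2) subset_insertI)
  have Ain: "A m \<in> F n" if "m < n" for m n
    using inc[of "Suc m" n] that AX(2)[of m] by auto
  have inj: "inj A"
  proof (rule linorder_injI)
    show "A m \<noteq> A n" if "m < n" for m n using Ain[OF that] AX(1)[of n] by metis
  qed
  \<comment> \<open>Cutting \<open>X n\<close> down to \<open>B n\<close> costs only finitely many points and makes the union almost contained in every \<open>B k\<close>.\<close>
  define Y where "Y = (\<Union>n. X n \<inter> B n)"
  have "Y \<subseteq>* B n" for n
    unfolding almost_subset_def
  proof (rule finite_subset)
    show "Y - B n \<subseteq> (\<Union>m<n. X m - B n)"
      using dec' unfolding Y_def by (auto simp: subset_eq) (meson lessThan_iff not_le)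
    show "finite (\<Union>m<n. X m - B n)" using AX(4) unfolding almost_subset_def by blast
  qed
  moreover have "Y \<subseteq> B 0" using dec' unfolding Y_def by (auto simp: subset_eq)
  moreover have "\<not> covered \<A> Y"
  proof (rule not_covered_if_meets_infinitely[OF ad])
    have "infinite (A n \<inter> Y)" for n
    proof
      assume "finite (A n \<inter> Y)"
      then have "finite ((A n \<inter> Y) \<union> (X n - B n))" using AX(4)[of n n] unfolding almost_subset_def by simp
      moreover have "A n \<inter> X n \<subseteq> (A n \<inter> Y) \<union> (X n - B n)" unfolding Y_def by blast
      ultimately show False using AX(3)[of n] finite_subset by blast
    qed
    moreover have "A n \<in> \<A>" for n using Ain[of n "Suc n"] F2 by blast
    ultimately have "range A \<subseteq> {A \<in> \<A>. infinite (A \<inter> Y)}" by blast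
    then show "infinite {A \<in> \<A>. infinite (A \<inter> Y)}"
      using inj finite_imageD finite_subset infinite_UNIV_nat by blast
  qed
  ultimately show ?thesis by blast
qed

section \<open>Escaping fewer than \<open>a\<^sub>*\<close> many sets\<close>

text \<open>
  If \<open>B\<close> meets only finitely many sets of \<open>\<E>\<close>, these are removed.  Otherwise infinitely many of them play
  the role of the last \<open>\<omega>\<close> sets in the definition of \<open>a\<^sub>*\<close>, and the remaining ones, fewer than
  \<open>a\<^sub>*\<close> many, that of the first sets.  As this is no counterexample sequence, there is a set \<open>C\<close> almost disjoint from the
  first kind that meets infinitely many sets of the second kind.  One point from each of these
  intersections, outside the finitely many earlier sets, yields a set almost disjoint from both kinds.
\<close>

lemma a_star_escape:
  fixes \<theta> :: "'t rel"
  assumes astar: "is_a_star \<theta>"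
    and ad: "pairwise almost_disjoint \<E>" and small: "|\<E>| <o \<theta>"
    and pos: "\<not> covered \<E> B"
  shows "\<exists>X\<subseteq>B. infinite X \<and> (\<forall>A\<in>\<E>. finite (A \<inter> X))"
proof -
  define \<H> where "\<H> = {A\<in>\<E>. infinite (A \<inter> B)}"
  show ?thesis
  proof (cases "finite \<H>")
    case True
    then have "infinite (B - \<Union>\<H>)" using pos unfolding covered_def almost_subset_def \<H>_def by auto
    moreover have "finite (A \<inter> (B - \<Union>\<H>))" if "A \<in> \<E>" for A
    proof (cases "A \<in> \<H>")
      case True
      then have "A \<inter> (B - \<Union>\<H>) = {}" by blast
      then show ?thesis by simp
    next
      case False
      then have "finite (A \<inter> B)" using that unfolding \<H>_def by blast
      then show ?thesis by (rule rev_finite_subset) blast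
    qed
    ultimately show ?thesis by (intro exI[of _ "B - \<Union>\<H>"]) blast
  next
    case False
    then obtain c :: "nat \<Rightarrow> nat set" where c: "inj c" "range c \<subseteq> \<H>"
      using infinite_countable_subset by blast
    define R where "R = \<H> - range c"
    have "|R| \<le>o |\<E>|" by (rule card_of_mono1) (auto simp: R_def \<H>_def)
    then have R\<theta>: "|R| <o \<theta>" using small ordLeq_ordLess_trans by blast
    then have "|R| <o |Field \<theta>|"
      using card_of_Field_ordIso astar ordIso_symmetric ordLess_ordIso_trans
      unfolding is_a_star_def by blast
    then obtain g where g: "inj_on g R" "g ` R \<subseteq> Field \<theta>"
      using ordLess_imp_ordLeq card_of_ordLeq[of R "Field \<theta>"] by blast
    define \<mu> where "\<mu> = |g ` R|"
    have \<mu>: "Card_order \<mu>" "Field \<mu> = g ` R" unfolding \<mu>_def by (rule card_of_Card_order, rule Field_card_of)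
    have "\<mu> <o \<theta>" unfolding \<mu>_def using R\<theta> card_of_image ordLeq_ordLess_trans by blast
    define S where "S = (\<lambda>x. case x of Inl \<alpha> \<Rightarrow> inv_into R g \<alpha> \<inter> B | Inr n \<Rightarrow> c n \<inter> B)"
    have "\<not> a_star_sequence \<mu> S"
    proof
      assume "a_star_sequence \<mu> S"
      then have "\<theta> \<le>o \<mu>" using astar \<mu>(1) unfolding is_a_star_def by blast
      then show False using \<open>\<mu> <o \<theta>\<close> not_ordLess_ordLeq by blast
    qed
    define lab where "lab = (\<lambda>x. case x of Inl \<alpha> \<Rightarrow> inv_into R g \<alpha> | Inr n \<Rightarrow> c n)"
    have S_lab: "S x = lab x \<inter> B" for x by (simp add: S_def lab_def split: sum.split)
    have lab_in: "lab x \<in> \<H>" if "x \<in> Field \<mu> <+> (UNIV :: nat set)" for x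
      using that c(2) g by (auto simp: lab_def \<mu>(2) R_def)
    have lab_inj: "lab x \<noteq> lab y"
      if "x \<in> Field \<mu> <+> (UNIV :: nat set)" "y \<in> Field \<mu> <+> (UNIV :: nat set)" "x \<noteq> y" for x y
      using that c g by (auto simp: lab_def \<mu>(2) R_def inj_def)
    have "infinite (S x)" if "x \<in> Field \<mu> <+> (UNIV :: nat set)" for x
      using lab_in[OF that] by (simp add: S_lab \<H>_def)
    moreover have "pairwise (\<lambda>x y. almost_disjoint (S x) (S y)) (Field \<mu> <+> UNIV)"
    proof (rule pairwiseI)
      fix x y assume xy: "x \<in> Field \<mu> <+> (UNIV :: nat set)" "y \<in> Field \<mu> <+> (UNIV :: nat set)" "x \<noteq> y"
      then have "almost_disjoint (lab x) (lab y)"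
        using lab_in lab_inj ad unfolding \<H>_def pairwise_def by blast
      then show "almost_disjoint (S x) (S y)"
        unfolding almost_disjoint_def S_lab by (rule rev_finite_subset) blast
    qed
    ultimately obtain C where C: "infinite C" "\<And>\<alpha>. \<alpha> \<in> Field \<mu> \<Longrightarrow> almost_disjoint C (S (Inl \<alpha>))"
        "infinite {n. infinite (C \<inter> S (Inr n))}"
      using \<open>\<not> a_star_sequence \<mu> S\<close> unfolding a_star_sequence_def by blast
    have C1: "finite (A \<inter> (C \<inter> B))" if "A \<in> R" for A
    proof -
      have "g A \<in> Field \<mu>" using that \<mu>(2) by blast
      then have "finite (C \<inter> S (Inl (g A)))" using C(2) unfolding almost_disjoint_def by blast
      moreover have "S (Inl (g A)) = A \<inter> B" using that g(1) by (simp add: S_def)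
      ultimately show ?thesis by (simp add: Int_ac)
    qed
    define q where "q = enumerate {n. infinite (C \<inter> S (Inr n))}"
    have q: "strict_mono q" "\<And>i. infinite (C \<inter> B \<inter> c (q i))"
      using C(3) enumerate_in_set[OF C(3)] strict_mono_enumerate[OF C(3)]
      by (auto simp: q_def S_def Int_ac)
    have "infinite (C \<inter> B \<inter> c (q i) - \<Union>(c ` {..<q i}))" for i
    proof
      assume "finite (C \<inter> B \<inter> c (q i) - \<Union>(c ` {..<q i}))"
      moreover have "finite (c (q i) \<inter> \<Union>(c ` {..<q i}))"
      proof (rule finite_Int_Union_of_finite)
        fix A assume "A \<in> c ` {..<q i}"
        then obtain m where "m < q i" "A = c m" by blast
        moreover from this have "c (q i) \<noteq> c m" using c(1) by (auto simp: inj_def)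
        ultimately show "finite (c (q i) \<inter> A)"
          using c(2) ad unfolding pairwise_def almost_disjoint_def \<H>_def by blast
      qed simp
      ultimately have "finite ((C \<inter> B \<inter> c (q i) - \<Union>(c ` {..<q i})) \<union> (c (q i) \<inter> \<Union>(c ` {..<q i})))" by blast
      moreover have "C \<inter> B \<inter> c (q i) \<subseteq> (C \<inter> B \<inter> c (q i) - \<Union>(c ` {..<q i})) \<union> (c (q i) \<inter> \<Union>(c ` {..<q i}))" by blast
      ultimately show False using q(2)[of i] finite_subset by blast
    qed
    then obtain x where x: "strict_mono x" "\<And>i. x i \<in> C \<inter> B \<inter> c (q i) - \<Union>(c ` {..<q i})"
      using infinite_choice_increasing[of "\<lambda>i. C \<inter> B \<inter> c (q i) - \<Union>(c ` {..<q i})"] by blast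
    have fin: "finite (c m \<inter> range x)" for m
    proof (rule finite_subset)
      show "c m \<inter> range x \<subseteq> x ` {..m}"
      proof clarify
        fix i assume "x i \<in> c m"
        then have "\<not> m < q i" using x(2)[of i] by blast
        moreover have "i \<le> q i" using q(1) strict_mono_imp_increasing by blast
        ultimately show "x i \<in> x ` {..m}" by auto
      qed
    qed simp
    have "finite (A \<inter> range x)" if "A \<in> \<E>" for A
    proof -
      consider "A \<in> range c" | "A \<in> R" | "finite (A \<inter> B)"
        using \<open>A \<in> \<E>\<close> unfolding R_def \<H>_def by blast
      then show ?thesis
      proof cases
        case 1 then show ?thesis using fin by blast
      next
        case 2 show ?thesis using x(2) by (intro finite_subset[OF _ C1[OF 2]]) blast
      next
        case 3 show ?thesis using x(2) by (intro finite_subset[OF _ 3]) blast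
      qed
    qed
    moreover have "infinite (range x)"
      using x(1) by (simp add: finite_image_iff strict_mono_imp_inj_on)
    ultimately show ?thesis using x(2) by (intro exI[of _ "range x"]) blast
  qed
qed

section \<open>Unsplit refinements and the cofinality of the splitting number\<close>

text \<open>
  Fewer than \<open>\<kappa>\<close> many sets do not form a splitting family, and this remains true inside an infinite set,
  which is a copy of \<open>\<omega>\<close> by its increasing enumeration.
\<close>

lemma unsplit_refinement:
  assumes "is_splitting_number \<kappa>" and small: "|F| <o \<kappa>" and X: "infinite X"
  shows "\<exists>Y\<subseteq>X. infinite Y \<and> (\<forall>C\<in>F. Y \<subseteq>* C \<or> Y \<subseteq>* - C)"
proof -
  define e where "e = enumerate X"
  have e: "inj e" "range e = X"
    using X bij_enumerate[OF X] unfolding e_def by (auto simp: bij_betw_def)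
  define F' where "F' = {D \<in> infsets. D \<in> (\<lambda>C. e -` C) ` F}"
  have "|F'| \<le>o |(\<lambda>C. e -` C) ` F|" by (rule card_of_mono1) (auto simp: F'_def)
  then have "|F'| <o \<kappa>"
    using card_of_image ordLeq_transitive ordLeq_ordLess_trans small by blast
  then have "\<not> splitting_family F'"
    using assms(1) not_ordLess_ordLeq unfolding is_splitting_number_def by blast
  then obtain B where B: "infinite B" "\<And>D. D \<in> F' \<Longrightarrow> B \<subseteq>* D \<or> B \<subseteq>* - D"
    unfolding splitting_family_def F'_def infsets_def by blast
  have "e ` B \<subseteq>* C \<or> e ` B \<subseteq>* - C" if "C \<in> F" for C
  proof -
    have "B \<subseteq>* e -` C \<or> B \<subseteq>* - (e -` C)"
    proof (cases "finite (e -` C)")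
      case True then show ?thesis by (simp add: almost_subset_def)
    next
      case False
      then have "e -` C \<in> F'" using that by (auto simp: F'_def infsets_def)
      then show ?thesis by (rule B(2))
    qed
    moreover have "e ` B - C = e ` (B - e -` C)" "e ` B - (- C) = e ` (B - (- (e -` C)))" by auto
    ultimately show ?thesis unfolding almost_subset_def by (metis finite_imageI)
  qed
  moreover have "e ` B \<subseteq> X" using e(2) by blast
  moreover have "infinite (e ` B)" using B(1) e(1) by (metis finite_imageD inj_on_subset subset_UNIV)
  ultimately show ?thesis by (intro exI[of _ "e ` B"]) blast
qed

lemma infinite_Field: "Card_order r \<Longrightarrow> natLeq \<le>o r \<Longrightarrow> infinite (Field r)"
  using ordLeq_ordIso_trans[OF _ ordIso_symmetric[OF card_of_Field_ordIso]] infinite_iff_natLeq_ordLeq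
  by blast

lemma card_of_under_less:
  assumes "Card_order r" "natLeq \<le>o r" "a \<in> Field r"
  shows "|under r a| <o r"
proof -
  have inf: "infinite (Field r)" using assms(1,2) by (rule infinite_Field)
  have "|underS r a| <o r" using assms by (simp add: card_of_underS)
  moreover have "|{a}| <o r"
    using finite_ordLess_infinite[of "|{a}|" r] inf assms(1) card_of_Well_order[of "{a}"]
    unfolding card_order_on_def Field_card_of by simp
  ultimately have "|underS r a \<union> {a}| <o r"
    using card_of_Un_ordLess_infinite_Field[OF inf assms(1)] by blast
  moreover have "under r a \<subseteq> underS r a \<union> {a}" by (auto simp: under_def underS_def)
  ultimately show ?thesis by (meson card_of_mono1 ordLeq_ordLess_trans)
qed

text \<open>
  Were \<open>\<kappa>\<close> a countable union of proper initial segments, a splitting family of size \<open>\<kappa>\<close> would be a union of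
  countably many families which do not split; successive unsplit refinements for these have a pseudo-intersection,
  and the whole family would not split it.
\<close>

lemma splitting_number_uncountable_cofinality:
  assumes \<kappa>: "is_splitting_number \<kappa>" "natLeq \<le>o \<kappa>" and A: "countable A" "A \<subseteq> Field \<kappa>"
  shows "\<exists>x\<in>Field \<kappa>. A \<subseteq> underS \<kappa> x"
proof (rule ccontr)
  assume unb: "\<not> ?thesis"
  have co: "Card_order \<kappa>" using \<kappa>(1) unfolding is_splitting_number_def by blast
  then have wo: "wo_rel \<kappa>" unfolding wo_rel_def card_order_on_def by blast
  obtain S where S: "splitting_family S" "|S| =o \<kappa>" using \<kappa>(1) unfolding is_splitting_number_def by blast
  have "|Field \<kappa>| =o |S|"
    using S(2) co card_of_Field_ordIso ordIso_symmetric ordIso_transitive by blast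
  then obtain f where f: "bij_betw f (Field \<kappa>) S" using card_of_ordIso by blast
  have above: "\<exists>a\<in>A. (x, a) \<in> \<kappa>" if x: "x \<in> Field \<kappa>" for x
  proof -
    obtain a where a: "a \<in> A" "a \<notin> underS \<kappa> x" using unb x by blast
    then have "a = x \<or> (x, a) \<in> \<kappa>" using wo_rel.TOTALS[OF wo] A(2) x unfolding underS_def by blast
    then show ?thesis using a(1) x wo_rel.REFL[OF wo] unfolding refl_on_def by blast
  qed
  have ne: "A \<noteq> {}"
  proof
    assume "A = {}"
    then have "Field \<kappa> = {}" using above by blast
    then have "S = {}" using f by (simp add: bij_betw_def)
    then show False using S(1) unfolding splitting_family_def infsets_def by (auto intro: infinite_UNIV_nat)
  qed
  define a where "a = from_nat_into A"
  have a: "range a = A" unfolding a_def using range_from_nat_into[OF ne A(1)] .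
  have "\<exists>X. \<forall>n. infinite (X n) \<and> (X (Suc n) \<subseteq> X n \<and> (\<forall>C\<in>f ` under \<kappa> (a n). X (Suc n) \<subseteq>* C \<or> X (Suc n) \<subseteq>* - C))"
  proof (rule dependent_nat_choice)
    show "\<exists>X :: nat set. infinite X" using infinite_UNIV_nat by blast
    fix X :: "nat set" and n assume X: "infinite X"
    have "a n \<in> Field \<kappa>" using a A(2) by blast
    then have "|f ` under \<kappa> (a n)| <o \<kappa>"
      using card_of_under_less[OF co \<kappa>(2)] card_of_image ordLeq_ordLess_trans by blast
    from unsplit_refinement[OF \<kappa>(1) this X]
    show "\<exists>Y. infinite Y \<and> (Y \<subseteq> X \<and> (\<forall>C\<in>f ` under \<kappa> (a n). Y \<subseteq>* C \<or> Y \<subseteq>* - C))" by blast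
  qed
  then obtain X where "\<forall>n. infinite (X n) \<and> (X (Suc n) \<subseteq> X n \<and>
      (\<forall>C\<in>f ` under \<kappa> (a n). X (Suc n) \<subseteq>* C \<or> X (Suc n) \<subseteq>* - C))"
    by (rule exE)
  then have X: "infinite (X n)" "X (Suc n) \<subseteq> X n"
     "C \<in> f ` under \<kappa> (a n) \<Longrightarrow> X (Suc n) \<subseteq>* C \<or> X (Suc n) \<subseteq>* - C" for n C by blast+
  obtain Y where Y: "infinite Y" "\<And>n. Y \<subseteq>* X n" using pseudo_intersection[of X, OF X(1,2)] by blast
  have "Y \<subseteq>* C \<or> Y \<subseteq>* - C" if C: "C \<in> S" for C
  proof -
    obtain x where x: "x \<in> Field \<kappa>" "f x = C" using f C unfolding bij_betw_def by blast
    obtain n where "(x, a n) \<in> \<kappa>" using above[OF x(1)] a by blast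
    then have "C \<in> f ` under \<kappa> (a n)" using x by (auto simp: under_def)
    from X(3)[OF this] show ?thesis using Y(2) almost_subset_trans by blast
  qed
  then show False using S(1) Y(1) unfolding splitting_family_def infsets_def by blast
qed

section \<open>Scales\<close>

definition dominated :: "(nat \<Rightarrow> nat) \<Rightarrow> (nat \<Rightarrow> nat) \<Rightarrow> bool" where
  "dominated f g \<longleftrightarrow> finite {n. g n < f n}"

lemma dominated_trans: "dominated f g \<Longrightarrow> dominated g h \<Longrightarrow> dominated f h"
  unfolding dominated_def
  by (rule finite_subset[of _ "{n. g n < f n} \<union> {n. h n < g n}"]) (auto intro: le_less_trans)

lemma dominated_le: "(\<And>n. f n \<le> g n) \<Longrightarrow> dominated f g"
  unfolding dominated_def by (simp add: leD)

lemma countable_dominated: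
  assumes "countable Q" shows "\<exists>g. \<forall>f\<in>Q. dominated f g"
proof (cases "Q = {}")
  case False
  define c where "c = from_nat_into Q"
  define g where "g = (\<lambda>n. \<Sum>i\<le>n. c i n)"
  have "dominated (c i) g" for i
    unfolding dominated_def
  proof (rule finite_subset)
    show "{n. g n < c i n} \<subseteq> {..<i}"
    proof
      fix n assume "n \<in> {n. g n < c i n}"
      then have "\<not> c i n \<le> g n" by simp
      moreover have "c i n \<le> g n" if "i \<le> n"
        unfolding g_def by (rule member_le_sum) (use that in auto)
      ultimately show "n \<in> {..<i}" by (meson lessThan_iff not_le)
    qed
  qed simp
  moreover have "range c = Q" unfolding c_def using range_from_nat_into[OF False assms] .
  ultimately show ?thesis by (intro exI[of _ g]) blast
qed simp

definition unbounded_family :: "(nat \<Rightarrow> nat) set \<Rightarrow> bool" where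
  "unbounded_family H \<longleftrightarrow> \<not> (\<exists>g. \<forall>f\<in>H. dominated f g)"

text \<open>
  After disjointification, the last \<open>\<omega>\<close> sets of a sequence witnessing \<open>a\<^sub>*\<close> are columns, and each of the other sets is
  finite in every column, so it is bounded by a function.  If one function
  dominated all these functions, the points above its graph would contradict the choice of the sequence.
\<close>

lemma a_star_unbounded_family:
  fixes \<theta> :: "'t rel"
  assumes "is_a_star \<theta>"
  shows "\<exists>H. unbounded_family H \<and> |H| \<le>o \<theta>"
proof -
  obtain A where A: "a_star_sequence \<theta> A" and co: "Card_order \<theta>"
    using assms unfolding is_a_star_def by blast
  define col where "col = (\<lambda>n. A (Inr n) - (\<Union>m<n. A (Inr m)))"
  have Ainf: "infinite (A x)" if "x \<in> Field \<theta> <+> (UNIV :: nat set)" for x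
    using A that unfolding a_star_sequence_def by blast
  have Aad: "finite (A x \<inter> A y)" if "x \<in> Field \<theta> <+> (UNIV :: nat set)" "y \<in> Field \<theta> <+> (UNIV :: nat set)" "x \<noteq> y" for x y
    using A that unfolding a_star_sequence_def pairwise_def almost_disjoint_def by blast
  have fin1: "finite (A (Inl \<alpha>) \<inter> col n)" if "\<alpha> \<in> Field \<theta>" for \<alpha> n
  proof (rule finite_subset)
    show "finite (A (Inl \<alpha>) \<inter> A (Inr n))" by (rule Aad) (use that in auto)
  qed (auto simp: col_def)
  have inf1: "infinite (col n)" for n
  proof
    assume "finite (col n)"
    moreover have "finite (\<Union>m<n. A (Inr n) \<inter> A (Inr m))" by (intro finite_UN_I Aad) auto
    ultimately have "finite (col n \<union> (\<Union>m<n. A (Inr n) \<inter> A (Inr m)))" by blast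
    moreover have "A (Inr n) \<subseteq> col n \<union> (\<Union>m<n. A (Inr n) \<inter> A (Inr m))" unfolding col_def by blast
    ultimately show False using Ainf[of "Inr n"] finite_subset by blast
  qed
  have "\<exists>b. \<forall>x\<in>A (Inl \<alpha>) \<inter> col n. x < b" if "\<alpha> \<in> Field \<theta>" for \<alpha> n
    using fin1[OF that, of n] finite_nat_set_iff_bounded by auto
  then obtain h where h: "\<And>\<alpha> n x. \<alpha> \<in> Field \<theta> \<Longrightarrow> x \<in> A (Inl \<alpha>) \<inter> col n \<Longrightarrow> x < h \<alpha> n" by metis
  have "\<not> (\<exists>g. \<forall>f\<in>h ` Field \<theta>. dominated f g)"
  proof
    assume "\<exists>g. \<forall>f\<in>h ` Field \<theta>. dominated f g"
    then obtain g where g: "\<And>\<alpha>. \<alpha> \<in> Field \<theta> \<Longrightarrow> finite {n. g n < h \<alpha> n}" unfolding dominated_def by blast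
    define B where "B = (\<Union>n. {x\<in>col n. g n \<le> x})"
    have up: "infinite {x\<in>col n. g n \<le> x}" for n
    proof
      assume "finite {x\<in>col n. g n \<le> x}"
      then have "finite ({x\<in>col n. g n \<le> x} \<union> {..<g n})" by simp
      moreover have "col n \<subseteq> {x\<in>col n. g n \<le> x} \<union> {..<g n}" by auto
      ultimately show False using inf1 finite_subset by blast
    qed
    have big: "infinite (B \<inter> A (Inr n))" for n
    proof
      assume "finite (B \<inter> A (Inr n))"
      moreover have "{x\<in>col n. g n \<le> x} \<subseteq> B \<inter> A (Inr n)" unfolding B_def col_def by blast
      ultimately show False using up finite_subset by blast
    qed
    have "almost_disjoint B (A (Inl \<alpha>))" if \<alpha>: "\<alpha> \<in> Field \<theta>" for \<alpha>
      unfolding almost_disjoint_def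
    proof (rule finite_subset)
      show "B \<inter> A (Inl \<alpha>) \<subseteq> (\<Union>n\<in>{n. g n < h \<alpha> n}. A (Inl \<alpha>) \<inter> col n)"
      proof
        fix x assume "x \<in> B \<inter> A (Inl \<alpha>)"
        then obtain n where n: "x \<in> col n" "g n \<le> x" "x \<in> A (Inl \<alpha>)" unfolding B_def by blast
        then have "g n < h \<alpha> n" using h[OF \<alpha>, of x n] by auto
        then show "x \<in> (\<Union>n\<in>{n. g n < h \<alpha> n}. A (Inl \<alpha>) \<inter> col n)" using n by blast
      qed
      show "finite (\<Union>n\<in>{n. g n < h \<alpha> n}. A (Inl \<alpha>) \<inter> col n)"
        using g[OF \<alpha>] fin1[OF \<alpha>] by blast
    qed
    moreover have "infinite B" using big[of 0] by (meson finite_Int)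
    moreover have "{n. infinite (B \<inter> A (Inr n))} = UNIV" using big by blast
    ultimately show False using A infinite_UNIV_nat unfolding a_star_sequence_def by metis
  qed
  moreover have "|h ` Field \<theta>| \<le>o \<theta>"
    using card_of_image card_of_Field_ordIso[OF co] ordLeq_ordIso_trans by blast
  ultimately show ?thesis unfolding unbounded_family_def by blast
qed

text \<open>
  The three properties used of a \<open>b\<close>-scale: monotone functions, countable directedness, and
  unboundedness on every infinite set of arguments.
\<close>

definition scale :: "(nat \<Rightarrow> nat) set \<Rightarrow> bool" where
  "scale F \<longleftrightarrow> (\<forall>f\<in>F. mono f) \<and>
     (\<forall>Q\<subseteq>F. countable Q \<longrightarrow> (\<exists>g\<in>F. \<forall>f\<in>Q. dominated f g)) \<and>
     (\<forall>Q g. infinite Q \<longrightarrow> (\<exists>f\<in>F. infinite {n\<in>Q. g n < f n}))"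

lemma scale_unbounded:
  "scale F \<Longrightarrow> infinite Q \<Longrightarrow> \<exists>f\<in>F. infinite {n\<in>Q. g n < f n}"
  unfolding scale_def by simp

text \<open>
  A bound on an infinite set \<open>Q\<close> of arguments extends to a bound everywhere: a monotone function at \<open>m\<close> is at
  most its value at the next element of \<open>Q\<close>.
\<close>

lemma mono_unbounded_everywhere:
  assumes mono: "\<And>f. f \<in> F \<Longrightarrow> mono f" and unb: "unbounded_family F" and Q: "infinite Q"
  shows "\<exists>f\<in>F. infinite {n\<in>Q. g n < f n}"
proof (rule ccontr)
  assume "\<not> ?thesis"
  then have fin: "\<And>f. f \<in> F \<Longrightarrow> finite {n\<in>Q. g n < f n}" by blast
  define nx where "nx = (\<lambda>m. LEAST n. n \<in> Q \<and> m \<le> n)"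
  have "\<exists>n. n \<in> Q \<and> m \<le> n" for m
    using Q unfolding infinite_nat_iff_unbounded_le by blast
  then have nx: "nx m \<in> Q \<and> m \<le> nx m" for m
    unfolding nx_def by (rule LeastI_ex)
  have "dominated f (g \<circ> nx)" if f: "f \<in> F" for f
    unfolding dominated_def
  proof (rule finite_subset)
    show "{m. (g \<circ> nx) m < f m} \<subseteq> (\<Union>n\<in>{n\<in>Q. g n < f n}. {..n})"
    proof
      fix m assume "m \<in> {m. (g \<circ> nx) m < f m}"
      then have "g (nx m) < f m" by simp
      also have "f m \<le> f (nx m)" using mono[OF f] nx by (simp add: monoD)
      finally show "m \<in> (\<Union>n\<in>{n\<in>Q. g n < f n}. {..n})" using nx by blast
    qed
    show "finite (\<Union>n\<in>{n\<in>Q. g n < f n}. {..n})" using fin[OF f] by blast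
  qed
  then show False using unb unfolding unbounded_family_def by blast
qed

text \<open>
  An unbounded family of least cardinality is replaced, along a well-ordering of that length, by functions
  that increase modulo finite sets: at each step only fewer functions than the least size of an unbounded family must be
  dominated.  A countable part of the resulting chain either has an upper bound in the chain or is cofinal in it; the latter is
  impossible, as countable families of functions are bounded.
\<close>

lemma scale_exists:
  fixes \<theta> :: "'t rel"
  assumes "is_a_star \<theta>"
  shows "\<exists>F. scale F \<and> |F| \<le>o \<theta>"
proof -
  obtain H where H: "unbounded_family H" "|H| \<le>o \<theta>" using a_star_unbounded_family[OF assms] by blast
  have "\<exists>r\<in>{|H| |H. unbounded_family H}. \<forall>r'\<in>{|H| |H. unbounded_family H}. r \<le>o r'"
    by (rule exists_minim_Card_order) (use H(1) card_of_Card_order in auto)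
  then obtain U where U: "unbounded_family U" "\<And>H. unbounded_family H \<Longrightarrow> |U| \<le>o |H|" by blast
  define r where "r = |U|"
  define R where "R = r - Id"
  have wo: "wo_rel r" unfolding r_def wo_rel_def by (rule card_of_Well_order)
  have FU: "Field r = U" unfolding r_def by (rule Field_card_of)
  have "\<exists>s. \<forall>x. mono (s x) \<and> (\<forall>n. x n \<le> s x n) \<and> (\<forall>y. (y, x) \<in> R \<longrightarrow> dominated (s y) (s x))"
  proof (rule dependent_wf_choice[where P = "\<lambda>s x t. mono t \<and> (\<forall>n. x n \<le> t n) \<and> (\<forall>y. (y, x) \<in> R \<longrightarrow> dominated (s y) t)"])
    show "wf R" unfolding R_def by (rule wo_rel.WF[OF wo])
    fix s :: "(nat \<Rightarrow> nat) \<Rightarrow> (nat \<Rightarrow> nat)" and x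
    have "\<exists>b. \<forall>y. (y, x) \<in> R \<longrightarrow> dominated (s y) b"
    proof (cases "x \<in> U")
      case True
      have "|s ` underS r x| \<le>o |underS r x|" by (rule card_of_image)
      moreover have "|underS r x| <o |U|"
        unfolding r_def by (rule card_of_underS[OF card_of_Card_order]) (simp add: True Field_card_of[of U])
      ultimately have "\<not> |U| \<le>o |s ` underS r x|"
        using not_ordLess_ordLeq ordLeq_ordLess_trans by blast
      then have "\<not> unbounded_family (s ` underS r x)" using U(2) by blast
      then show ?thesis unfolding unbounded_family_def underS_def R_def by blast
    next
      case False
      then have "(y, x) \<notin> R" for y using FU unfolding R_def Field_def by blast
      then show ?thesis by blast
    qed
    then obtain b where b: "\<And>y. (y, x) \<in> R \<Longrightarrow> dominated (s y) b" by blast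
    define t where "t = (\<lambda>n. \<Sum>i\<le>n. b i + x i)"
    have "b n + x n \<le> t n" for n unfolding t_def by (rule member_le_sum[where f = "\<lambda>i. b i + x i"]) auto
    then have "b n \<le> t n" "x n \<le> t n" for n by (metis add_leD1, metis add_leD2)
    moreover have "mono t" unfolding t_def by (intro monoI sum_mono2) auto
    ultimately show "\<exists>t. mono t \<and> (\<forall>n. x n \<le> t n) \<and> (\<forall>y. (y, x) \<in> R \<longrightarrow> dominated (s y) t)"
      using b dominated_trans dominated_le by (intro exI[of _ t]) blast
  qed auto
  then obtain s where
    "\<forall>x. mono (s x) \<and> (\<forall>n. x n \<le> s x n) \<and> (\<forall>y. (y, x) \<in> R \<longrightarrow> dominated (s y) (s x))"
    by (rule exE)
  then have s: "mono (s x)" "x n \<le> s x n" "(y, x) \<in> R \<Longrightarrow> dominated (s y) (s x)" for x y n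
    by simp_all
  have s_le: "dominated (s y) (s x)" if "(y, x) \<in> r" for x y
    using that s(3)[of y x] dominated_le[of "s x" "s x"] unfolding R_def by auto
  have unb: "unbounded_family (s ` U)"
    unfolding unbounded_family_def
  proof
    assume "\<exists>g. \<forall>f\<in>s ` U. dominated f g"
    then obtain g where "\<And>x. x \<in> U \<Longrightarrow> dominated (s x) g" by blast
    moreover have "dominated x (s x)" for x by (rule dominated_le) (rule s(2))
    ultimately have "\<forall>x\<in>U. dominated x g" using dominated_trans by blast
    then show False using U(1) unfolding unbounded_family_def by blast
  qed
  have "scale (s ` U)"
    unfolding scale_def
  proof (intro conjI allI impI)
    show "\<forall>f\<in>s ` U. mono f" using s(1) by blast
    fix Q assume "Q \<subseteq> s ` U" "countable Q"
    then obtain I where I: "I \<subseteq> U" "countable I" "Q = s ` I"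
      by (metis countable_subset_image)
    show "\<exists>g\<in>s ` U. \<forall>f\<in>Q. dominated f g"
    proof (cases "\<exists>x\<in>U. \<forall>i\<in>I. (i, x) \<in> r")
      case True
      then show ?thesis using s_le I(3) by blast
    next
      case False
      then have cof: "\<exists>i\<in>I. (x, i) \<in> r" if "x \<in> U" for x
        using that I(1) wo_rel.TOTALS[OF wo] FU by (metis subsetD)
      obtain g where g: "\<And>i. i \<in> I \<Longrightarrow> dominated (s i) g"
        using countable_dominated[of "s ` I"] I(2) by auto
      have "\<forall>f\<in>s ` U. dominated f g"
        using cof s_le g dominated_trans by blast
      then show ?thesis using unb unfolding unbounded_family_def by blast
    qed
  next
    fix Q and g :: "nat \<Rightarrow> nat" assume "infinite (Q :: nat set)"
    then show "\<exists>f\<in>s ` U. infinite {n\<in>Q. g n < f n}"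
      using mono_unbounded_everywhere[of "s ` U"] s(1) unb by blast
  qed
  moreover have "|s ` U| \<le>o \<theta>" using U(2)[OF H(1)] H(2) card_of_image ordLeq_transitive by blast
  ultimately show ?thesis by blast
qed

section \<open>Splitting countably many sets by one set\<close>

text \<open>
  The interval partition of \<open>\<omega>\<close> given by iterating \<open>f\<close>; adding \<open>n + 1\<close> makes the intervals nonempty.
\<close>

definition endpoint :: "(nat \<Rightarrow> nat) \<Rightarrow> nat \<Rightarrow> nat" where
  "endpoint f i = ((\<lambda>n. Suc (n + f n)) ^^ i) 0"

definition block_union :: "(nat \<Rightarrow> nat) \<Rightarrow> nat set \<Rightarrow> nat set" where
  "block_union f x = (\<Union>i\<in>x. {endpoint f i..<endpoint f (Suc i)})"

lemma endpoint_Suc: "endpoint f (Suc i) = Suc (endpoint f i + f (endpoint f i))"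
  by (simp add: endpoint_def)

lemma strict_mono_endpoint: "strict_mono (endpoint f)"
  by (simp add: strict_mono_Suc_iff endpoint_Suc)

lemma endpoint_block_unique:
  assumes "endpoint f i \<le> n" "n < endpoint f (Suc i)" "endpoint f j \<le> n" "n < endpoint f (Suc j)"
  shows "i = j"
proof (rule ccontr)
  assume "i \<noteq> j"
  then have "Suc i \<le> j \<or> Suc j \<le> i" by auto
  then have "endpoint f (Suc i) \<le> endpoint f j \<or> endpoint f (Suc j) \<le> endpoint f i"
    using strict_mono_endpoint[of f] by (auto simp: strict_mono_less_eq)
  then show False using assms by auto
qed

lemma block_union_iff:
  "endpoint f l \<le> n \<Longrightarrow> n < endpoint f (Suc l) \<Longrightarrow> n \<in> block_union f x \<longleftrightarrow> l \<in> x"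
  using endpoint_block_unique[of f l n] unfolding block_union_def UN_iff atLeastLessThan_iff by blast

lemma endpoint_block_exists: "\<exists>i. endpoint f i \<le> n \<and> n < endpoint f (Suc i)"
proof -
  have gt: "n < endpoint f (Suc n)"
    using strict_mono_imp_increasing[OF strict_mono_endpoint[of f], of "Suc n"] by simp
  define i where "i = (LEAST i. n < endpoint f (Suc i))"
  have "n < endpoint f (Suc i)" unfolding i_def using gt by (rule LeastI)
  moreover have "endpoint f i \<le> n"
  proof (cases i)
    case 0 then show ?thesis by (simp add: endpoint_def)
  next
    case (Suc j)
    then have "\<not> n < endpoint f (Suc j)" unfolding i_def using not_less_Least by (metis lessI)
    then show ?thesis using Suc by simp
  qed
  ultimately show ?thesis by blast
qed

text \<open>
  Let \<open>G m\<close> bound a search, from \<open>m\<close> upwards, for a point in each of \<open>a 0, \<dots>, a m\<close>.  A function \<open>f\<close> of the scale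
  exceeds \<open>G \<circ> G\<close> at infinitely many \<open>m\<close>.  Then either the interval of \<open>m\<close> or the following one contains such points.
  Two iterations of \<open>G\<close> are used since \<open>m\<close> may be anywhere in its interval.
\<close>

lemma blocks_meet_initially:
  fixes a :: "nat \<Rightarrow> nat set"
  assumes F: "scale F" and a: "\<And>j. infinite (a j)"
  shows "\<exists>f\<in>F. infinite {l. \<forall>j\<le>l. \<exists>x\<in>a j. endpoint f l \<le> x \<and> x < endpoint f (Suc l)}"
proof -
  have "\<exists>x\<in>a j. m \<le> x" for j m using a[of j] by (meson infinite_nat_iff_unbounded_le)
  then obtain nx where nx: "\<And>j m. nx j m \<in> a j" "\<And>j m. m \<le> nx j m" by metis
  define G where "G = (\<lambda>m. \<Sum>k\<le>m. \<Sum>j\<le>k. Suc (nx j k))"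
  have G_mono: "mono G" unfolding G_def by (intro monoI sum_mono2) auto
  have G: "nx j m < G m" if "j \<le> m" for j m
  proof -
    have "Suc (nx j m) \<le> (\<Sum>j\<le>m. Suc (nx j m))"
      by (rule member_le_sum[where f = "\<lambda>j. Suc (nx j m)"]) (use that in auto)
    also have "\<dots> \<le> G m" unfolding G_def
      by (rule member_le_sum[where f = "\<lambda>k. \<Sum>j\<le>k. Suc (nx j k)"]) auto
    finally show ?thesis by simp
  qed
  obtain f where f: "f \<in> F" "infinite {m\<in>UNIV. G (G m) < f m}"
    using scale_unbounded[OF F infinite_UNIV_nat, of "\<lambda>m. G (G m)"] by blast
  have f_mono: "mono f" using F f(1) unfolding scale_def by blast
  define Z where "Z = {l. \<forall>j\<le>l. \<exists>x\<in>a j. endpoint f l \<le> x \<and> x < endpoint f (Suc l)}"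
  have Zl: "l \<in> Z" if "endpoint f l \<le> m" "G m \<le> endpoint f (Suc l)" for l m
    unfolding Z_def
  proof (intro CollectI allI impI)
    fix j assume "j \<le> l"
    also have "l \<le> endpoint f l" using strict_mono_imp_increasing[OF strict_mono_endpoint] .
    also note that(1)
    finally have "nx j m < G m" by (rule G)
    then show "\<exists>x\<in>a j. endpoint f l \<le> x \<and> x < endpoint f (Suc l)"
      using nx(1)[of j m] nx(2)[of m j] that by (intro bexI[of _ "nx j m"]) auto
  qed
  have "\<exists>l\<ge>N. l \<in> Z" for N
  proof -
    obtain m where m: "endpoint f N \<le> m" "G (G m) < f m"
      using f(2) by (auto simp: infinite_nat_iff_unbounded_le)
    obtain i where i: "endpoint f i \<le> m" "m < endpoint f (Suc i)" using endpoint_block_exists by blast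
    have "N \<le> i"
    proof (rule ccontr)
      assume "\<not> N \<le> i"
      then have "endpoint f (Suc i) \<le> endpoint f N"
        using strict_mono_endpoint[of f] by (simp add: strict_mono_less_eq)
      then show False using m(1) i(2) by simp
    qed
    show ?thesis
    proof (cases "G m \<le> endpoint f (Suc i)")
      case True
      then show ?thesis using Zl i(1) \<open>N \<le> i\<close> by blast
    next
      case False
      then have "G (endpoint f (Suc i)) \<le> G (G m)" using G_mono by (simp add: monoD)
      also have "\<dots> \<le> f m" using m(2) by simp
      also have "\<dots> \<le> f (endpoint f (Suc i))" using f_mono i(2) by (simp add: monoD)
      also have "\<dots> \<le> endpoint f (Suc (Suc i))" by (subst endpoint_Suc[of f "Suc i"]) simp
      finally have "Suc i \<in> Z" by (intro Zl[of "Suc i" "endpoint f (Suc i)"]) auto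
      then show ?thesis using \<open>N \<le> i\<close> le_SucI by blast
    qed
  qed
  then have "infinite Z" by (auto simp: infinite_nat_iff_unbounded_le)
  then show ?thesis using f(1) unfolding Z_def by blast
qed

text \<open>
  A splitting family splits the infinite set of indices \<open>l\<close> such that the \<open>l\<close>-th interval meets \<open>a 0, \<dots>, a l\<close>.  The union of the intervals
  selected by the splitting set therefore contains infinitely many points of every \<open>a j\<close> and misses infinitely many.
\<close>

lemma block_splitting:
  fixes a :: "nat \<Rightarrow> nat set"
  assumes F: "scale F" and S: "splitting_family S" and a: "\<And>j. infinite (a j)"
  shows "\<exists>x\<in>S. \<exists>f\<in>F. \<forall>j. infinite (a j \<inter> block_union f x) \<and> infinite (a j - block_union f x)"
proof -
  obtain f where f: "f \<in> F"
    and Zinf: "infinite {l. \<forall>j\<le>l. \<exists>x\<in>a j. endpoint f l \<le> x \<and> x < endpoint f (Suc l)}"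
    using blocks_meet_initially[where a = a, OF F a] by blast
  define Z where "Z = {l. \<forall>j\<le>l. \<exists>x\<in>a j. endpoint f l \<le> x \<and> x < endpoint f (Suc l)}"
  obtain x where x: "x \<in> S" "\<not> Z \<subseteq>* x" "\<not> Z \<subseteq>* - x"
    using S Zinf unfolding splitting_family_def infsets_def Z_def by blast
  have hit: "infinite {n \<in> a j. \<exists>l\<in>V. endpoint f l \<le> n \<and> n < endpoint f (Suc l)}"
    if V: "V \<subseteq> Z" "infinite V" for V j
    unfolding infinite_nat_iff_unbounded_le
  proof
    fix N
    obtain l where l: "l \<in> V" "max j N \<le> l" using V(2) by (meson infinite_nat_iff_unbounded_le)
    then obtain n where n: "n \<in> a j" "endpoint f l \<le> n" "n < endpoint f (Suc l)"
      using V(1) unfolding Z_def by auto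
    have "N \<le> n" using l(2) n(2) strict_mono_imp_increasing[OF strict_mono_endpoint[of f], of l] by simp
    then show "\<exists>n\<ge>N. n \<in> {n \<in> a j. \<exists>l\<in>V. endpoint f l \<le> n \<and> n < endpoint f (Suc l)}"
      using n l(1) by blast
  qed
  have "infinite (a j \<inter> block_union f x)" for j
  proof
    assume fin: "finite (a j \<inter> block_union f x)"
    have "infinite (Z \<inter> x)" using x(3) unfolding almost_subset_def by (simp add: Diff_eq)
    then have "infinite {n \<in> a j. \<exists>l\<in>Z \<inter> x. endpoint f l \<le> n \<and> n < endpoint f (Suc l)}" using hit by blast
    moreover have "{n \<in> a j. \<exists>l\<in>Z \<inter> x. endpoint f l \<le> n \<and> n < endpoint f (Suc l)} \<subseteq> a j \<inter> block_union f x"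
      using block_union_iff by blast
    ultimately show False using fin finite_subset by blast
  qed
  moreover have "infinite (a j - block_union f x)" for j
  proof
    assume fin: "finite (a j - block_union f x)"
    have "infinite (Z - x)" using x(2) unfolding almost_subset_def .
    then have "infinite {n \<in> a j. \<exists>l\<in>Z - x. endpoint f l \<le> n \<and> n < endpoint f (Suc l)}" using hit by blast
    moreover have "{n \<in> a j. \<exists>l\<in>Z - x. endpoint f l \<le> n \<and> n < endpoint f (Suc l)} \<subseteq> a j - block_union f x"
      using block_union_iff by blast
    ultimately show False using fin finite_subset by blast
  qed
  ultimately show ?thesis using x(1) f by blast
qed

text \<open>
  Pairs of a splitting set and a function of the scale number only \<open>\<kappa>\<close>, since the scale is small.
\<close>

lemma simultaneous_splitting_family:
  fixes \<kappa> :: "'k rel" and \<theta> :: "'t rel"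
  assumes \<kappa>: "is_splitting_number \<kappa>" "natLeq \<le>o \<kappa>" and F: "scale F" "|F| \<le>o \<kappa>"
  shows "\<exists>y :: 'k \<Rightarrow> nat set. \<forall>a :: nat \<Rightarrow> nat set. (\<forall>j. infinite (a j)) \<longrightarrow>
    (\<exists>k\<in>Field \<kappa>. \<forall>j. infinite (a j \<inter> y k) \<and> infinite (a j - y k))"
proof -
  have co: "Card_order \<kappa>" using \<kappa>(1) unfolding is_splitting_number_def by blast
  obtain S where S: "splitting_family S" "|S| =o \<kappa>" using \<kappa>(1) unfolding is_splitting_number_def by blast
  have inf: "infinite (Field \<kappa>)" using co \<kappa>(2) by (rule infinite_Field)
  have "|S \<times> F| \<le>o \<kappa>"
    by (rule card_of_Times_ordLeq_infinite_Field[OF inf ordIso_imp_ordLeq[OF S(2)] F(2) co])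
  then have le: "|S \<times> F| \<le>o |Field \<kappa>|"
    using ordLeq_ordIso_trans[OF _ ordIso_symmetric[OF card_of_Field_ordIso[OF co]]] by blast
  have "S \<times> F \<noteq> {}"
    using block_splitting[OF F(1) S(1), where a = "\<lambda>_. UNIV"] infinite_UNIV_nat by blast
  then obtain g where g: "g ` Field \<kappa> = S \<times> F" using le card_of_ordLeq2[of "S \<times> F" "Field \<kappa>"] by auto
  show ?thesis
  proof (intro exI[of _ "\<lambda>k. block_union (snd (g k)) (fst (g k))"] allI impI)
    fix a :: "nat \<Rightarrow> nat set" assume "\<forall>j. infinite (a j)"
    then obtain x f where xf: "x \<in> S" "f \<in> F" "\<forall>j. infinite (a j \<inter> block_union f x) \<and> infinite (a j - block_union f x)"
      using block_splitting[OF F(1) S(1), where a = a] by blast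
    then have "(x, f) \<in> g ` Field \<kappa>" using g by simp
    then obtain k where "k \<in> Field \<kappa>" "g k = (x, f)" by auto
    then show "\<exists>k\<in>Field \<kappa>. \<forall>j. infinite (a j \<inter> block_union (snd (g k)) (fst (g k))) \<and>
        infinite (a j - block_union (snd (g k)) (fst (g k)))" using xf(3) by (intro bexI[of _ k]) simp_all
  qed
qed

section \<open>Cardinal orders and guessing of large sets of levels\<close>

lemma card_less_subset: "A \<subseteq> B \<Longrightarrow> |B| <o r \<Longrightarrow> |A| <o r"
  by (rule ordLeq_ordLess_trans[OF card_of_mono1])

lemma card_ge_superset: "A \<subseteq> B \<Longrightarrow> r \<le>o |A| \<Longrightarrow> r \<le>o |B|"
  by (rule ordLeq_transitive[OF _ card_of_mono1])

lemma card_less_image: "|A| <o r \<Longrightarrow> |f ` A| <o r"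
  by (rule ordLeq_ordLess_trans[OF card_of_image])

text \<open>
  Ordinals below a cardinal are the elements of the field of a cardinal order; \<open>\<preceq>\<close> and \<open>\<prec>\<close> abbreviate
  the order in the form in which the guessing principle is stated, with \<open>underS r y\<close> as the ordinal \<open>y\<close>.
\<close>

locale cardinal_order =
  fixes r :: "'k rel"
  assumes card: "Card_order r" and infinite_card: "natLeq \<le>o r"
begin

abbreviation K where "K \<equiv> Field r"

abbreviation le (infix \<open>\<preceq>\<close> 50) where "x \<preceq> y \<equiv> (x, y) \<in> r"

abbreviation lt (infix \<open>\<prec>\<close> 50) where "x \<prec> y \<equiv> x \<in> underS r y"

lemma wo: "wo_rel r"
  using card unfolding wo_rel_def card_order_on_def by blast

lemma well_order: "Well_order r"
  using wo unfolding wo_rel_def .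

lemma lt_def: "x \<prec> y \<longleftrightarrow> x \<noteq> y \<and> x \<preceq> y"
  by (auto simp: underS_def)

lemma le_refl: "x \<in> K \<Longrightarrow> x \<preceq> x"
  using wo_rel.REFL[OF wo] by (auto simp: refl_on_def)

lemma le_trans: "x \<preceq> y \<Longrightarrow> y \<preceq> z \<Longrightarrow> x \<preceq> z"
  using wo_rel.TRANS[OF wo] by (rule transD)

lemma le_antisym: "x \<preceq> y \<Longrightarrow> y \<preceq> x \<Longrightarrow> x = y"
  using wo_rel.ANTISYM[OF wo] by (rule antisymD)

lemma lt_imp_le: "x \<prec> y \<Longrightarrow> x \<preceq> y" by (simp add: lt_def)

lemma lt_irrefl: "\<not> x \<prec> x" by (simp add: lt_def)

lemma le_lt_trans: "x \<preceq> y \<Longrightarrow> y \<prec> z \<Longrightarrow> x \<prec> z"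
  using le_trans le_antisym unfolding lt_def by blast

lemma lt_le_trans: "x \<prec> y \<Longrightarrow> y \<preceq> z \<Longrightarrow> x \<prec> z"
  using le_trans le_antisym unfolding lt_def by blast

lemma lt_trans: "x \<prec> y \<Longrightarrow> y \<prec> z \<Longrightarrow> x \<prec> z"
  using lt_imp_le le_lt_trans by blast

lemma le_K: "x \<preceq> y \<Longrightarrow> x \<in> K" "x \<preceq> y \<Longrightarrow> y \<in> K"
  by (auto simp: Field_def)

lemma lt_K: "x \<prec> y \<Longrightarrow> x \<in> K" "x \<prec> y \<Longrightarrow> y \<in> K"
  using le_K lt_imp_le by blast+

lemma lt_or_le: "x \<in> K \<Longrightarrow> y \<in> K \<Longrightarrow> x \<prec> y \<or> y \<preceq> x"
  using wo_rel.TOTALS[OF wo] le_refl unfolding lt_def by blast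

lemma aboveS_iff: "y \<in> aboveS r x \<longleftrightarrow> x \<prec> y"
  by (auto simp: aboveS_def underS_def)

lemma le_not_lt: "x \<preceq> y \<Longrightarrow> \<not> y \<prec> x"
  using le_lt_trans lt_irrefl by blast

lemma le_iff_lt_or_eq: "x \<preceq> y \<Longrightarrow> x \<prec> y \<or> x = y"
  by (simp add: lt_def)

lemma least_exists: "A \<subseteq> K \<Longrightarrow> A \<noteq> {} \<Longrightarrow> \<exists>x\<in>A. \<forall>y\<in>A. x \<preceq> y"
  using wo_rel.minim_in[OF wo] wo_rel.minim_least[OF wo] by blast

lemma lt_induct: "(\<And>x. (\<And>y. y \<prec> x \<Longrightarrow> Q y) \<Longrightarrow> Q x) \<Longrightarrow> Q x"
  by (rule wo_rel.well_order_induct[OF wo]) (simp add: underS_def)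

lemma infinite_K: "infinite K"
  using card infinite_card by (rule infinite_Field)

lemma less_under: "x \<in> K \<Longrightarrow> |under r x| <o r"
  using card_of_under_less[OF card infinite_card] .

lemma less_underS: "x \<in> K \<Longrightarrow> |underS r x| <o r"
  using card_of_underS[OF card] .

lemma finite_less: "finite A \<Longrightarrow> |A| <o r"
  using finite_ordLess_infinite[OF card_of_Well_order well_order] infinite_K by (simp add: Field_card_of)

lemma Un_less: "|A| <o r \<Longrightarrow> |B| <o r \<Longrightarrow> |A \<union> B| <o r"
  using card_of_Un_ordLess_infinite_Field[OF infinite_K card] .

lemma Times_less_aux:
  assumes "|A| <o r" "|B| \<le>o |A|" shows "|A \<times> B| <o r"
proof (cases "finite A \<or> B = {}")
  case True
  then have "finite (A \<times> B)" using card_of_ordLeq_finite[OF assms(2)] by auto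
  then show ?thesis by (rule finite_less)
next
  case False
  then have "|A \<times> B| =o |A|" using card_of_Times_infinite[of A B] assms(2) by auto
  then show ?thesis using assms(1) ordIso_ordLess_trans by blast
qed

lemma Times_less:
  assumes A: "|A| <o r" and B: "|B| <o r" shows "|A \<times> B| <o r"
proof -
  consider "|B| \<le>o |A|" | "|A| \<le>o |B|" using ordLeq_total[OF card_of_Well_order card_of_Well_order] by blast
  then show ?thesis
  proof cases
    case 1 then show ?thesis by (rule Times_less_aux[OF A])
  next
    case 2
    then have "|B \<times> A| <o r" by (rule Times_less_aux[OF B])
    then show ?thesis by (rule ordIso_ordLess_trans[OF card_of_Times_commute[of A B]])
  qed
qed

lemma supr_upper:
  assumes "A \<subseteq> K" "b \<in> K" "\<And>x. x \<in> A \<Longrightarrow> x \<preceq> b"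
  shows "x \<in> A \<Longrightarrow> x \<preceq> wo_rel.supr r A" "wo_rel.supr r A \<preceq> b" "bounded_in r A"
proof -
  have ne: "b \<in> Above r A" using assms(2,3) unfolding Above_def by auto
  then show "bounded_in r A" using assms(1) unfolding bounded_in_def by auto
  have sub: "Above r A \<subseteq> K" unfolding Above_def by auto
  then have "wo_rel.minim r (Above r A) \<in> Above r A"
    using wo_rel.minim_in[OF wo] ne by blast
  then show "x \<in> A \<Longrightarrow> x \<preceq> wo_rel.supr r A"
    unfolding wo_rel.supr_def[OF wo] Above_def by blast
  show "wo_rel.supr r A \<preceq> b"
    unfolding wo_rel.supr_def[OF wo] using wo_rel.minim_least[OF wo sub ne] .
qed

text \<open>
  \<open>\<theta>\<close> embeds as an initial segment into the order of \<open>V\<close>, as this order has at least the cardinality of \<open>\<theta>\<close>.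
\<close>

lemma order_type_subset:
  assumes V: "V \<subseteq> K" and \<theta>: "\<theta> \<le>o |V|"
  shows "\<exists>V'\<subseteq>V. Restr r V' =o \<theta>"
proof -
  have wV: "well_order_on V (Restr r V)" using well_order_on_Restr[OF well_order V] .
  then have FV: "Field (Restr r V) = V" "Well_order (Restr r V)"
    using well_order_on_Well_order[OF wV] by auto
  have "\<theta> \<le>o Restr r V" by (rule ordLeq_transitive[OF \<theta> card_of_least[OF wV]])
  then consider "\<theta> <o Restr r V" | "\<theta> =o Restr r V" using ordLeq_iff_ordLess_or_ordIso by blast
  then show ?thesis
  proof cases
    case 1
    moreover have "Well_order \<theta>" using 1 unfolding ordLess_def by blast
    ultimately obtain a where a: "\<theta> =o Restr (Restr r V) (underS (Restr r V) a)"
      using ordLess_iff_ordIso_Restr[OF FV(2)] by blast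
    have sub: "underS (Restr r V) a \<subseteq> V" unfolding underS_def by auto
    then have "Restr (Restr r V) (underS (Restr r V) a) = Restr r (underS (Restr r V) a)" by blast
    then show ?thesis using a sub ordIso_symmetric by metis
  next
    case 2 then show ?thesis using ordIso_symmetric by blast
  qed
qed

lemma card_of_order_type:
  assumes "V \<subseteq> K" "Restr r V =o \<theta>" "Card_order \<theta>" shows "|V| =o \<theta>"
proof -
  have "Field (Restr r V) = V"
    using well_order_on_Well_order[OF well_order_on_Restr[OF well_order assms(1)]] by auto
  then have "|V| =o |Field \<theta>|" using card_of_cong[OF assms(2)] by simp
  then show ?thesis by (rule ordIso_transitive[OF _ card_of_Field_ordIso[OF assms(3)]])
qed

lemma club_sup:
  assumes "club r E" "A \<subseteq> E" "A \<noteq> {}" "b \<in> K" "\<And>x. x \<in> A \<Longrightarrow> x \<preceq> b"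
  shows "\<exists>s\<in>E. (\<forall>x\<in>A. x \<preceq> s) \<and> s \<preceq> b \<and> s = wo_rel.supr r A"
proof -
  have "A \<subseteq> K" using assms(1,2) unfolding club_def by blast
  note s = supr_upper[OF this assms(4,5)]
  have "wo_rel.supr r A \<in> E" using assms(1-3) s(3) unfolding club_def by blast
  then show ?thesis using s by blast
qed

text \<open>
  The two guessing clauses combined, for arbitrary sets of size at least \<open>\<theta>\<close>.  Let \<open>\<sigma>\<close> be least such that
  \<open>w\<close> has at least \<open>\<theta>\<close> many elements below \<open>\<sigma>\<close>.  Every subset of order type \<open>\<theta>\<close> then has supremum \<open>\<sigma>\<close>.  If \<open>\<sigma>\<close> is
  an accumulation point of \<open>E\<close>, the first clause applies.  Otherwise \<open>\<sigma>\<close> lies in a gap of \<open>E\<close>, and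
  the part of \<open>w\<close> in the gap still has size at least \<open>\<theta>\<close>, so that the second clause applies.
\<close>

lemma Pr_hits:
  fixes \<theta> :: "'t rel"
  assumes Pr: "Pr_witness r \<theta> E P" and \<theta>: "Card_order \<theta>" "natLeq \<le>o \<theta>"
    and g: "g \<in> E" and w: "w \<subseteq> underS r g" "\<theta> \<le>o |w|"
  shows "\<exists>j\<in>E. \<exists>u\<in>P j. infinite (u \<inter> w) \<and> j \<preceq> g \<and>
    ((\<forall>x. x \<prec> g \<longrightarrow> (\<exists>e\<in>E. x \<prec> e \<and> e \<prec> g)) \<longrightarrow> j \<prec> g)"
proof -
  interpret th: cardinal_order \<theta> using \<theta> by unfold_locales
  have club: "club r E" using Pr unfolding Pr_witness_def by blast
  have gap: "\<forall>i \<in> insert (wo_rel.minim r K) E. \<forall>j w.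
        j = wo_rel.minim r (E - under r i) \<and>
        w \<subseteq> above r i \<inter> underS r j \<and> Restr r w =o \<theta> \<longrightarrow>
        (\<exists>u\<in>P j. u \<subseteq> aboveS r i \<inter> underS r j \<and> infinite (u \<inter> w))"
    using Pr unfolding Pr_witness_def by (elim conjE)
  have EK: "E \<subseteq> K" using club unfolding club_def by blast
  have gK: "g \<in> K" using g EK by blast
  have wK: "w \<subseteq> K" using w(1) lt_K by blast
  \<comment> \<open>Below any smaller level, \<open>w\<close> has fewer than \<open>\<theta>\<close> elements, so order type \<open>\<theta>\<close> forces supremum \<open>\<sigma>\<close>.\<close>
  define \<sigma> where "\<sigma> = wo_rel.minim r {x\<in>K. \<theta> \<le>o |w \<inter> underS r x|}"
  have ne: "g \<in> {x\<in>K. \<theta> \<le>o |w \<inter> underS r x|}" using gK w by (simp add: Int_absorb2)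
  have \<sigma>: "\<sigma> \<in> K" "\<theta> \<le>o |w \<inter> underS r \<sigma>|"
    using wo_rel.minim_in[OF wo, of "{x\<in>K. \<theta> \<le>o |w \<inter> underS r x|}"] ne unfolding \<sigma>_def by blast+
  have \<sigma>g: "\<sigma> \<preceq> g"
    unfolding \<sigma>_def by (rule wo_rel.minim_least[OF wo _ ne]) blast
  have small: "|w \<inter> underS r x| <o \<theta>" if "x \<prec> \<sigma>" for x
  proof (rule ccontr)
    assume "\<not> |w \<inter> underS r x| <o \<theta>"
    then have "\<theta> \<le>o |w \<inter> underS r x|"
      using not_ordLess_iff_ordLeq[OF th.well_order card_of_Well_order] by blast
    then have "\<sigma> \<preceq> x" unfolding \<sigma>_def
      by (intro wo_rel.minim_least[OF wo]) (use lt_K(1)[OF that] in blast)+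
    then show False using that le_not_lt by blast
  qed
  define w1 where "w1 = w \<inter> underS r \<sigma>"
  have not_small: "\<not> |V| <o \<theta>" if "Restr r V =o \<theta>" "V \<subseteq> w1" for V
  proof -
    have "V \<subseteq> K" using that(2) wK unfolding w1_def by blast
    then have "|V| =o \<theta>" using card_of_order_type that(1) \<theta>(1) by blast
    then show ?thesis using not_ordLess_ordIso by blast
  qed
  have sup_V: "wo_rel.supr r V = \<sigma>" "bounded_in r V" if V: "Restr r V =o \<theta>" "V \<subseteq> w1" for V
  proof -
    have VK: "V \<subseteq> K" using that(2) wK unfolding w1_def by blast
    have bd: "\<And>x. x \<in> V \<Longrightarrow> x \<preceq> \<sigma>" using V(2) lt_imp_le unfolding w1_def by blast
    note s = supr_upper[OF VK \<sigma>(1) bd]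
    show "bounded_in r V" by (rule s(3))
    show "wo_rel.supr r V = \<sigma>"
    proof (rule ccontr)
      assume "wo_rel.supr r V \<noteq> \<sigma>"
      then have lt: "wo_rel.supr r V \<prec> \<sigma>" using s(2) unfolding lt_def by blast
      have "V \<subseteq> (w \<inter> underS r (wo_rel.supr r V)) \<union> {wo_rel.supr r V}"
      proof
        fix x assume "x \<in> V"
        then have "x \<in> w" "x \<prec> wo_rel.supr r V \<or> x = wo_rel.supr r V"
          using V(2) le_iff_lt_or_eq[OF s(1)] unfolding w1_def by auto
        then show "x \<in> (w \<inter> underS r (wo_rel.supr r V)) \<union> {wo_rel.supr r V}" by blast
      qed
      moreover have "|(w \<inter> underS r (wo_rel.supr r V)) \<union> {wo_rel.supr r V}| <o \<theta>"
        by (rule th.Un_less[OF small[OF lt] th.finite_less]) simp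
      ultimately show False using not_small[OF V] card_less_subset by blast
    qed
  qed
  show ?thesis
  proof (cases "\<sigma> \<in> acc r E")
    case True
    obtain V where V: "V \<subseteq> w1" "Restr r V =o \<theta>"
      using order_type_subset[of w1 \<theta>] wK \<sigma>(2) unfolding w1_def by blast
    have "\<exists>u j. infinite (u \<inter> V) \<and> j \<in> acc r E \<and> u \<in> P j \<and> |V \<inter> underS r j| <o \<theta>"
      using Pr True V sup_V[OF V(2,1)] unfolding Pr_witness_def by metis
    then obtain u j where uj: "infinite (u \<inter> V)" "j \<in> acc r E" "u \<in> P j" "|V \<inter> underS r j| <o \<theta>" by blast
    have jE: "j \<in> E" using uj(2) unfolding acc_def by blast
    have "j \<prec> \<sigma>"
    proof (rule ccontr)
      assume "\<not> j \<prec> \<sigma>"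
      then have "\<sigma> \<preceq> j" using lt_or_le jE EK \<sigma>(1) by blast
      then have "V \<inter> underS r j = V" using V(1) lt_le_trans unfolding w1_def by blast
      then show False using uj(4) not_small[OF V(2,1)] by simp
    qed
    moreover have "infinite (u \<inter> w)"
    proof
      assume "finite (u \<inter> w)"
      moreover have "u \<inter> V \<subseteq> u \<inter> w" using V(1) unfolding w1_def by blast
      ultimately show False using uj(1) finite_subset by blast
    qed
    ultimately show ?thesis using \<sigma>g jE uj(3) lt_le_trans[of j \<sigma> g] lt_imp_le by blast
  next
    case False
    define Q where "Q = E \<inter> underS r \<sigma>"
    define zero where "zero = wo_rel.minim r K"
    have K_ne: "K \<noteq> {}" using gK by blast
    have zero: "zero \<in> K" "\<And>x. x \<in> K \<Longrightarrow> zero \<preceq> x"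
      unfolding zero_def using wo_rel.minim_in[OF wo _ K_ne] wo_rel.minim_least[OF wo] by blast+
    have \<sigma>_ne: "underS r \<sigma> \<noteq> {}"
    proof
      assume "underS r \<sigma> = {}"
      then have "\<theta> \<le>o |{} :: 'k set|" using \<sigma>(2) by simp
      then show False using th.finite_less[of "{} :: 'k set"] not_ordLess_ordLeq by blast
    qed
    \<comment> \<open>The lower end of the gap of \<open>E\<close> around \<open>\<sigma>\<close>: either there is no element of \<open>E\<close> below \<open>\<sigma>\<close>, or a last one.\<close>
    have "\<exists>i\<in>insert zero E. i \<prec> \<sigma> \<and> (\<forall>e\<in>E. e \<prec> \<sigma> \<longrightarrow> e \<preceq> i)"
    proof (cases "Q = {}")
      case True
      obtain x where "x \<prec> \<sigma>" using \<sigma>_ne by blast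
      then have "zero \<prec> \<sigma>" using zero(2)[OF lt_K(1)] le_lt_trans by blast
      then show ?thesis using True unfolding Q_def by blast
    next
      case ne: False
      have "\<And>x. x \<in> Q \<Longrightarrow> x \<preceq> \<sigma>" unfolding Q_def using lt_imp_le by blast
      then obtain s where s: "s \<in> E" "\<forall>x\<in>Q. x \<preceq> s" "s \<preceq> \<sigma>" "s = wo_rel.supr r Q"
        using club_sup[OF club _ ne \<sigma>(1)] unfolding Q_def by blast
      have "s \<noteq> \<sigma>"
        using s(1,4) False unfolding acc_def Q_def by blast
      then have "s \<prec> \<sigma>" using s(3) unfolding lt_def by blast
      then show ?thesis using s(1,2) unfolding Q_def by blast
    qed
    then obtain i where i: "i \<in> insert zero E" "i \<prec> \<sigma>" "\<And>e. e \<in> E \<Longrightarrow> e \<prec> \<sigma> \<Longrightarrow> e \<preceq> i" by blast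
    define j where "j = wo_rel.minim r (E - under r i)"
    have above_i: "e \<in> E - under r i \<longleftrightarrow> e \<in> E \<and> i \<prec> e" for e
      using lt_or_le[of i e] EK lt_K(1)[OF i(2)] le_not_lt unfolding under_def by blast
    have ig: "i \<prec> g" using i(2) \<sigma>g lt_le_trans by blast
    then have gin: "g \<in> E - under r i" using g above_i by blast
    have subK: "E - under r i \<subseteq> K" using EK by blast
    have j: "j \<in> E" "i \<prec> j" "j \<preceq> g"
      using wo_rel.minim_in[OF wo subK] wo_rel.minim_least[OF wo subK gin] gin above_i
      unfolding j_def by blast+
    have j\<sigma>: "\<sigma> \<preceq> j"
      using lt_or_le[of j \<sigma>] i(3)[OF j(1)] j(2) le_not_lt \<sigma>(1) EK j(1) by blast
    define t where "t = w1 \<inter> above r i"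
    have "\<not> |t| <o \<theta>"
    proof
      assume "|t| <o \<theta>"
      then have "|(w \<inter> underS r i) \<union> t| <o \<theta>" using small[OF i(2)] th.Un_less by blast
      moreover have "w1 \<subseteq> (w \<inter> underS r i) \<union> t"
        using lt_or_le[of _ i] lt_K(1)[OF i(2)] wK unfolding t_def w1_def above_def by blast
      ultimately have "|w1| <o \<theta>" by (rule card_less_subset[rotated])
      then show False using \<sigma>(2) not_ordLess_ordLeq unfolding w1_def by blast
    qed
    then have "\<theta> \<le>o |t|" using not_ordLess_iff_ordLeq[OF th.well_order card_of_Well_order] by blast
    moreover have "t \<subseteq> K" using wK unfolding t_def w1_def by blast
    ultimately obtain V where V: "V \<subseteq> t" "Restr r V =o \<theta>" using order_type_subset[of t \<theta>] by blast
    have Vsub: "V \<subseteq> above r i \<inter> underS r j"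
      using V(1) j\<sigma> lt_le_trans unfolding t_def w1_def by blast
    have "\<exists>u\<in>P j. u \<subseteq> aboveS r i \<inter> underS r j \<and> infinite (u \<inter> V)"
      by (rule gap[rule_format, OF i(1)[unfolded zero_def]]) (intro conjI j_def Vsub V(2))
    then obtain u where u: "u \<in> P j" "infinite (u \<inter> V)" by blast
    have "infinite (u \<inter> w)"
    proof
      assume "finite (u \<inter> w)"
      moreover have "u \<inter> V \<subseteq> u \<inter> w" using V(1) unfolding t_def w1_def by blast
      ultimately show False using u(2) finite_subset by blast
    qed
    moreover have "j \<prec> g" if lim: "\<forall>x. x \<prec> g \<longrightarrow> (\<exists>e\<in>E. x \<prec> e \<and> e \<prec> g)"
    proof -
      obtain e where e: "e \<in> E" "i \<prec> e" "e \<prec> g" using lim ig by blast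
      then have "j \<preceq> e" unfolding j_def using wo_rel.minim_least[OF wo subK] above_i by blast
      then show ?thesis using e(3) le_lt_trans by blast
    qed
    ultimately show ?thesis using j u(1) by blast
  qed
qed

end

section \<open>Stages of levels\<close>

text \<open>
  Levels are grouped into stages \<open>[g, h g)\<close> that start at the points \<open>g \<in> G\<close>.  At the stage of \<open>g\<close> all tasks in
  \<open>T g\<close> have to be performed, so it must have at least as many levels as there are tasks.  The cardinal may be singular,
  so the lengths of the stages are not fixed in advance.
\<close>

locale stages = cardinal_order r for r :: "'k rel" +
  fixes E :: "'k set" and T :: "'k \<Rightarrow> 't set"
  assumes countable_bounded: "countable A \<Longrightarrow> A \<subseteq> Field r \<Longrightarrow> \<exists>x\<in>Field r. A \<subseteq> underS r x"
    and E_sub: "E \<subseteq> Field r"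
    and E_cofinal: "x \<in> Field r \<Longrightarrow> \<exists>e\<in>E. (x, e) \<in> r"
    and T_mono: "(x, y) \<in> r \<Longrightarrow> T x \<subseteq> T y"
    and T_less: "x \<in> Field r \<Longrightarrow> |T x| <o r"
    and T_nonempty: "x \<in> Field r \<Longrightarrow> T x \<noteq> {}"
begin

definition candidates :: "'k \<Rightarrow> 'k set" where
  "candidates g = {x\<in>E. g \<prec> x \<and> |T g| \<le>o |aboveS r g \<inter> underS r x|}"

definition h :: "'k \<Rightarrow> 'k" where "h g = wo_rel.minim r (candidates g)"

lemma candidates_sub: "candidates g \<subseteq> K"
  unfolding candidates_def using E_sub by blast

text \<open>
  The order above \<open>g\<close> has larger cardinality than \<open>T g\<close>, so a cardinal of the size of \<open>T g\<close> is one of its proper initial segments.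
\<close>

lemma candidates_ne:
  assumes g: "g \<in> K" shows "candidates g \<noteq> {}"
proof -
  have sub: "aboveS r g \<subseteq> K" unfolding aboveS_def Field_def by blast
  have wV: "well_order_on (aboveS r g) (Restr r (aboveS r g))"
    by (rule well_order_on_Restr[OF well_order sub])
  then have F: "Field (Restr r (aboveS r g)) = aboveS r g" "Well_order (Restr r (aboveS r g))"
    using well_order_on_Well_order by auto
  have big: "\<not> |aboveS r g| <o r"
  proof
    assume "|aboveS r g| <o r"
    then have "|under r g \<union> aboveS r g| <o r" using less_under[OF g] Un_less by blast
    moreover have "K \<subseteq> under r g \<union> aboveS r g"
      using lt_or_le[of g] g aboveS_iff unfolding under_def by blast
    ultimately have "|K| <o r" by (rule card_less_subset[rotated])
    then show False using card_of_Field_ordIso[OF card] not_ordLess_ordIso by blast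
  qed
  have "|T g| <o |aboveS r g|"
    using big T_less[OF g] not_ordLess_iff_ordLeq[OF well_order card_of_Well_order]
    by (blast intro: ordLess_ordLeq_trans)
  then have "|T g| <o Restr r (aboveS r g)" by (rule ordLess_ordLeq_trans[OF _ card_of_least[OF wV]])
  then obtain a where a: "a \<in> aboveS r g"
      "|T g| =o Restr (Restr r (aboveS r g)) (underS (Restr r (aboveS r g)) a)"
    using ordLess_iff_ordIso_Restr[OF F(2) card_of_Well_order] F(1) by metis
  have sub2: "underS (Restr r (aboveS r g)) a \<subseteq> aboveS r g \<inter> underS r a"
    unfolding underS_def by auto
  have "|T g| =o |underS (Restr r (aboveS r g)) a|"
  proof -
    have "Field (Restr (Restr r (aboveS r g)) (underS (Restr r (aboveS r g)) a))
        \<subseteq> underS (Restr r (aboveS r g)) a" by (rule Field_Restr_subset)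
    moreover have "underS (Restr r (aboveS r g)) a \<subseteq> Field (Restr (Restr r (aboveS r g)) (underS (Restr r (aboveS r g)) a))"
    proof
      fix x assume x: "x \<in> underS (Restr r (aboveS r g)) a"
      then have "x \<in> aboveS r g" unfolding underS_def by auto
      then have "(x, x) \<in> Restr (Restr r (aboveS r g)) (underS (Restr r (aboveS r g)) a)"
        using x le_refl sub by auto
      then show "x \<in> Field (Restr (Restr r (aboveS r g)) (underS (Restr r (aboveS r g)) a))"
        unfolding Field_def by blast
    qed
    ultimately have "Field (Restr (Restr r (aboveS r g)) (underS (Restr r (aboveS r g)) a)) = underS (Restr r (aboveS r g)) a"
      by blast
    then show ?thesis using card_of_cong[OF a(2)] by (simp add: Field_card_of)
  qed
  then have le: "|T g| \<le>o |aboveS r g \<inter> underS r a|"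
    by (rule ordIso_ordLeq_trans[OF _ card_of_mono1[OF sub2]])
  have "a \<in> K" using a(1) sub by blast
  then obtain e where e: "e \<in> E" "a \<preceq> e" using E_cofinal by blast
  have "g \<prec> a" using a(1) aboveS_iff by blast
  then have "g \<prec> e" using e(2) lt_le_trans by blast
  moreover have "aboveS r g \<inter> underS r a \<subseteq> aboveS r g \<inter> underS r e" using e(2) lt_le_trans by blast
  then have "|T g| \<le>o |aboveS r g \<inter> underS r e|" using le by (rule card_ge_superset)
  ultimately show ?thesis using e(1) unfolding candidates_def by blast
qed

lemma h_candidate: "g \<in> K \<Longrightarrow> h g \<in> candidates g"
  unfolding h_def using wo_rel.minim_in[OF wo candidates_sub candidates_ne] .

lemma h_E: "g \<in> K \<Longrightarrow> h g \<in> E" and h_gt: "g \<in> K \<Longrightarrow> g \<prec> h g"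
  and h_room: "g \<in> K \<Longrightarrow> |T g| \<le>o |aboveS r g \<inter> underS r (h g)|"
  using h_candidate unfolding candidates_def by blast+

lemma h_K: "g \<in> K \<Longrightarrow> h g \<in> K" using h_E E_sub by blast

lemma h_mono:
  assumes "g \<preceq> g'" shows "h g \<preceq> h g'"
proof -
  have K: "g \<in> K" "g' \<in> K" using le_K[OF assms] .
  have "aboveS r g' \<inter> underS r (h g') \<subseteq> aboveS r g \<inter> underS r (h g')"
    using le_lt_trans[OF assms] by (auto simp: aboveS_iff)
  then have "|T g| \<le>o |aboveS r g \<inter> underS r (h g')|"
    using card_ge_superset[OF _ h_room[OF K(2)]] ordLeq_transitive[OF card_of_mono1[OF T_mono[OF assms]]] by blast
  moreover have "g \<prec> h g'" using le_lt_trans[OF assms h_gt[OF K(2)]] .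
  ultimately have "h g' \<in> candidates g" using h_E[OF K(2)] unfolding candidates_def by blast
  then show ?thesis unfolding h_def[of g] by (rule wo_rel.minim_least[OF wo candidates_sub])
qed

text \<open>
  The limits of stages.  Only these levels serve as levels of nodes of members of the family.
\<close>

definition M :: "'k set" where "M = {m\<in>K. \<forall>k. k \<prec> m \<longrightarrow> h k \<prec> m}"

definition G :: "'k set" where "G = {(h ^^ n) m |n m. m \<in> M}"

lemma M_K: "M \<subseteq> K" unfolding M_def by blast

lemma M_closed: "m \<in> M \<Longrightarrow> k \<prec> m \<Longrightarrow> h k \<prec> m" unfolding M_def by blast

lemma M_closed_iter: "m \<in> M \<Longrightarrow> k \<prec> m \<Longrightarrow> (h ^^ n) k \<prec> m"
  by (induction n) (auto intro: M_closed)

lemma iter_K: "g \<in> K \<Longrightarrow> (h ^^ n) g \<in> K"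
  by (induction n) (auto intro: h_K)

lemma iter_mono:
  assumes g: "g \<in> K" and n: "n \<le> n'" shows "(h ^^ n) g \<preceq> (h ^^ n') g"
  using n
proof (induction n' rule: dec_induct)
  case base then show ?case using iter_K[OF g] le_refl by blast
next
  case (step n')
  have "(h ^^ n') g \<preceq> h ((h ^^ n') g)" using h_gt[OF iter_K[OF g]] lt_imp_le by blast
  then show ?case using step le_trans[of "(h ^^ n) g" "(h ^^ n') g"] by simp
qed

lemma G_K: "G \<subseteq> K" unfolding G_def using iter_K M_K by blast

lemma M_G: "M \<subseteq> G"
proof
  fix m assume "m \<in> M"
  then show "m \<in> G" unfolding G_def by (auto intro: exI[of _ "0::nat"])
qed

lemma h_G: "g \<in> G \<Longrightarrow> h g \<in> G"
proof -
  assume "g \<in> G"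
  then obtain n m where "m \<in> M" "g = (h ^^ n) m" unfolding G_def by blast
  then have "h g = (h ^^ Suc n) m" by simp
  then show ?thesis unfolding G_def using \<open>m \<in> M\<close> by blast
qed

lemma G_cases: "g \<in> G \<Longrightarrow> g \<in> M \<or> (\<exists>g'\<in>G. g = h g')"
proof -
  assume "g \<in> G"
  then obtain n m where nm: "m \<in> M" "g = (h ^^ n) m" unfolding G_def by blast
  show ?thesis
  proof (cases n)
    case 0 then show ?thesis using nm by simp
  next
    case (Suc n')
    then have "g = h ((h ^^ n') m)" using nm by simp
    then show ?thesis using nm(1) unfolding G_def by blast
  qed
qed

text \<open>
  Distinct stages do not overlap: within one block of iterates this is monotonicity, and elements of \<open>M\<close> separate the blocks.
\<close>

lemma G_gap:
  assumes "g \<in> G" "g' \<in> G" "g \<prec> g'" shows "h g \<preceq> g'"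
proof -
  obtain n m where g: "m \<in> M" "g = (h ^^ n) m" using assms(1) unfolding G_def by blast
  obtain n' m' where g': "m' \<in> M" "g' = (h ^^ n') m'" using assms(2) unfolding G_def by blast
  have mK: "m \<in> K" "m' \<in> K" using g g' M_K by auto
  have base: "m \<preceq> g" "m' \<preceq> g'" using iter_mono[OF mK(1), of 0 n] iter_mono[OF mK(2), of 0 n'] g g' by auto
  consider "m \<prec> m'" | "m' \<prec> m" | "m = m'"
    using lt_or_le[OF mK] le_iff_lt_or_eq by blast
  then show ?thesis
  proof cases
    case 1
    then have "h g \<prec> m'" using M_closed_iter[OF g'(1), of m "Suc n"] g(2) by simp
    then show ?thesis using base(2) lt_le_trans lt_imp_le by blast
  next
    case 2
    then have "g' \<prec> m" using M_closed_iter[OF g(1), of m' n'] g'(2) by simp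
    then have "g' \<prec> g" using base(1) lt_le_trans by blast
    then show ?thesis using assms(3) lt_trans lt_irrefl by blast
  next
    case 3
    have "n < n'"
    proof (rule ccontr)
      assume "\<not> n < n'"
      then have "g' \<preceq> g" using iter_mono[OF mK(1), of n' n] g g' 3 by simp
      then show False using assms(3) le_not_lt by blast
    qed
    then show ?thesis using iter_mono[OF mK(1), of "Suc n" n'] g g' 3 by simp
  qed
qed

lemma M_stage: "g \<in> G \<Longrightarrow> g \<preceq> k \<Longrightarrow> k \<prec> h g \<Longrightarrow> k \<in> M \<Longrightarrow> k = g"
  using G_gap[of g k] M_G le_iff_lt_or_eq le_not_lt by blast

lemma stage_unique:
  assumes "g \<in> G" "g \<preceq> k" "k \<prec> h g" "g' \<in> G" "g' \<preceq> k" "k \<prec> h g'" shows "g = g'"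
proof (rule ccontr)
  assume "g \<noteq> g'"
  then consider "g \<prec> g'" | "g' \<prec> g"
    using lt_or_le[of g g'] assms(1,4) G_K le_iff_lt_or_eq by blast
  then show False
  proof cases
    case 1 then show False using G_gap[OF assms(1,4)] assms le_trans le_not_lt by blast
  next
    case 2 then show False using G_gap[OF assms(4,1)] assms le_trans le_not_lt by blast
  qed
qed

text \<open>
  The iterates of \<open>h\<close> are bounded because the cofinality is uncountable, and their supremum is closed
  under \<open>h\<close> because \<open>h\<close> is monotone.
\<close>

lemma next_limit:
  assumes "g \<in> K"
  shows "\<exists>m\<in>M. (\<forall>n. (h ^^ n) g \<prec> m) \<and> (\<forall>k. k \<prec> m \<longrightarrow> (\<exists>n. k \<prec> (h ^^ n) g))"
proof -
  define A where "A = {x\<in>K. \<forall>n. (h ^^ n) g \<prec> x}"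
  have "countable (range (\<lambda>n. (h ^^ n) g))" by simp
  moreover have "range (\<lambda>n. (h ^^ n) g) \<subseteq> K" using iter_K[OF assms] by blast
  ultimately have "\<exists>x\<in>K. range (\<lambda>n. (h ^^ n) g) \<subseteq> underS r x" by (rule countable_bounded)
  then have "A \<noteq> {}" unfolding A_def by blast
  then obtain m where m: "m \<in> A" "\<And>y. y \<in> A \<Longrightarrow> m \<preceq> y"
    using least_exists[of A] unfolding A_def by blast
  have below: "\<exists>n. k \<preceq> (h ^^ n) g" if "k \<prec> m" for k
  proof (rule ccontr)
    assume "\<nexists>n. k \<preceq> (h ^^ n) g"
    then have "(h ^^ n) g \<prec> k" for n using lt_or_le[of "(h ^^ n) g" k] iter_K[OF assms] lt_K(1)[OF that] by blast
    then have "k \<in> A" unfolding A_def using lt_K(1)[OF that] by blast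
    then show False using m(2) that le_not_lt by blast
  qed
  have "h k \<prec> m" if k: "k \<prec> m" for k
  proof -
    obtain n where "k \<preceq> (h ^^ n) g" using below[OF k] by blast
    then have "h k \<preceq> (h ^^ Suc n) g" using h_mono by simp
    moreover have "(h ^^ Suc n) g \<prec> m" using m(1) unfolding A_def by blast
    ultimately show ?thesis by (rule le_lt_trans)
  qed
  then have "m \<in> M" using m(1) unfolding M_def A_def by blast
  moreover have "\<exists>n. k \<prec> (h ^^ n) g" if k: "k \<prec> m" for k
  proof -
    obtain n where n: "k \<preceq> (h ^^ n) g" using below[OF k] by blast
    have "(h ^^ n) g \<prec> (h ^^ Suc n) g" using h_gt[OF iter_K[OF assms]] by simp
    then show ?thesis using n le_lt_trans by blast
  qed
  ultimately show ?thesis using m(1) unfolding A_def by blast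
qed

text \<open>
  Take the first stage point \<open>z\<close> above \<open>x\<close>.  If it is a successor, its predecessor starts the stage of \<open>x\<close>.  It cannot be a limit, as
  then the supremum of the earlier stage points would be closed under \<open>h\<close> and so be a stage point below \<open>z\<close> that bounds itself.
\<close>

lemma stage_exists:
  assumes x: "x \<in> K" shows "\<exists>g\<in>G. g \<preceq> x \<and> x \<prec> h g"
proof -
  obtain m where "m \<in> M" "(h ^^ 0) x \<prec> m" using next_limit[OF x] by blast
  then have "m \<in> {z\<in>G. x \<prec> z}" using M_G by auto
  then obtain z where z: "z \<in> G" "x \<prec> z" "\<And>y. y \<in> G \<Longrightarrow> x \<prec> y \<Longrightarrow> z \<preceq> y"
    using least_exists[of "{z\<in>G. x \<prec> z}"] G_K by blast
  have below: "g \<preceq> x" if "g \<in> G" "g \<prec> z" for g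
    using lt_or_le[OF x, of g] that G_K z(3)[of g] le_not_lt by blast
  show ?thesis
  proof (cases "z \<in> M")
    case False
    then obtain g where g: "g \<in> G" "z = h g" using G_cases[OF z(1)] by blast
    then have "g \<prec> z" using h_gt G_K by blast
    then show ?thesis using below g z(2) by blast
  next
    case True
    define A where "A = {y\<in>K. \<forall>g\<in>G. g \<prec> z \<longrightarrow> g \<prec> y}"
    have hx: "h g \<preceq> x" if "g \<in> G" "g \<prec> z" for g
      using below[OF h_G[OF that(1)]] M_closed[OF True that(2)] by blast
    have "x \<in> A" unfolding A_def using x hx h_gt G_K lt_le_trans by blast
    then obtain s where s: "s \<in> A" "\<And>y. y \<in> A \<Longrightarrow> s \<preceq> y" using least_exists[of A] unfolding A_def by blast
    have sK: "s \<in> K" using s(1) unfolding A_def by blast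
    have "h k \<prec> s" if k: "k \<prec> s" for k
    proof -
      have "k \<notin> A" using s(2) k le_not_lt by blast
      then obtain g where g: "g \<in> G" "g \<prec> z" "\<not> g \<prec> k" using lt_K(1)[OF k] unfolding A_def by blast
      then have "k \<preceq> g" using lt_or_le[of g k] G_K lt_K(1)[OF k] by blast
      then have "h k \<preceq> h g" by (rule h_mono)
      moreover have "h g \<prec> s"
        using s(1) h_G[OF g(1)] M_closed[OF True g(2)] unfolding A_def by blast
      ultimately show ?thesis by (rule le_lt_trans)
    qed
    then have "s \<in> G" using sK M_G unfolding M_def by blast
    moreover have "s \<prec> z" using s(2)[OF \<open>x \<in> A\<close>] z(2) le_lt_trans by blast
    ultimately have "s \<prec> s" using s(1) unfolding A_def by blast
    then show ?thesis using lt_irrefl by blast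
  qed
qed

lemma tasks_exist:
  "\<exists>task :: 'k \<Rightarrow> 't. \<forall>g\<in>G. (\<forall>k. g \<preceq> k \<and> k \<prec> h g \<longrightarrow> task k \<in> T g) \<and>
     (\<forall>t\<in>T g. \<exists>k. g \<prec> k \<and> k \<prec> h g \<and> task k = t)"
proof -
  have "\<exists>\<phi>. \<phi> ` (aboveS r g \<inter> underS r (h g)) = T g" if "g \<in> K" for g
    using card_of_ordLeq2[OF T_nonempty[OF that]] h_room[OF that] by blast
  then obtain \<phi> where \<phi>: "\<And>g. g \<in> K \<Longrightarrow> \<phi> g ` (aboveS r g \<inter> underS r (h g)) = T g" by metis
  define st where "st = (\<lambda>k. THE g. g \<in> G \<and> g \<preceq> k \<and> k \<prec> h g)"
  have st: "st k = g" if "g \<in> G" "g \<preceq> k" "k \<prec> h g" for g k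
    unfolding st_def using that stage_unique by (intro the_equality) blast+
  define task where "task = (\<lambda>k. if k = st k then (SOME t. t \<in> T k) else \<phi> (st k) k)"
  have in_iv: "k \<in> aboveS r g \<inter> underS r (h g) \<longleftrightarrow> g \<prec> k \<and> k \<prec> h g" for k g
    by (simp add: aboveS_iff)
  show ?thesis
  proof (intro exI[of _ task] ballI conjI allI impI)
    fix g k assume g: "g \<in> G" and k: "g \<preceq> k \<and> k \<prec> h g"
    have gK: "g \<in> K" using g G_K by blast
    show "task k \<in> T g"
    proof (cases "k = g")
      case True
      then show ?thesis using st[OF g] k T_nonempty[OF gK] unfolding task_def by (simp add: some_in_eq)
    next
      case False
      then have "k \<in> aboveS r g \<inter> underS r (h g)" using in_iv k le_iff_lt_or_eq by blast
      then have "\<phi> g k \<in> T g" using \<phi>[OF gK] by blast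
      then show ?thesis using st[OF g] k False unfolding task_def by simp
    qed
  next
    fix g t assume g: "g \<in> G" and t: "t \<in> T g"
    have gK: "g \<in> K" using g G_K by blast
    have "t \<in> \<phi> g ` (aboveS r g \<inter> underS r (h g))" using \<phi>[OF gK] t by simp
    then obtain k where k: "k \<in> aboveS r g \<inter> underS r (h g)" "\<phi> g k = t" by (elim imageE) simp
    then have gk: "g \<prec> k" "k \<prec> h g" using in_iv by blast+
    then have "st k = g" "k \<noteq> g" using st[OF g lt_imp_le[OF gk(1)] gk(2)] lt_irrefl by blast+
    then have "task k = t" using k(2) unfolding task_def by simp
    then show "\<exists>k. g \<prec> k \<and> k \<prec> h g \<and> task k = t" using gk by blast
  qed
qed

end

section \<open>Graphs of a scale over countably many columns\<close>

text \<open>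
  \<open>Base X\<close> puts the set \<open>X\<close> on a level; \<open>Graph u f\<close> puts there the part below \<open>f\<close> of the columns that are given by the
  levels in \<open>u\<close>.
\<close>

datatype 'k task = Base "nat set" | Graph "'k set" "nat \<Rightarrow> nat"

definition part :: "(nat \<Rightarrow> nat set) \<Rightarrow> nat \<Rightarrow> nat set" where
  "part D n = D n - (\<Union>m<n. D m)"

definition below_graph :: "(nat \<Rightarrow> nat) \<Rightarrow> (nat \<Rightarrow> nat set) \<Rightarrow> nat set" where
  "below_graph f D = (\<Union>n. part D n \<inter> {..<f n})"

lemma part_unique: "x \<in> part D n \<Longrightarrow> x \<in> part D m \<Longrightarrow> n = m"
  unfolding part_def by (metis Diff_iff UN_iff lessThan_iff linorder_neqE_nat)

lemma finite_below_graph_part: "finite (below_graph f D \<inter> part D n)"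
proof (rule finite_subset)
  show "below_graph f D \<inter> part D n \<subseteq> {..<f n}"
    using part_unique unfolding below_graph_def by blast
qed simp

text \<open>
  Only finitely many columns are affected, and each of them in a finite set.
\<close>

lemma below_graph_mono:
  assumes "dominated f g" shows "below_graph f D \<subseteq>* below_graph g D"
  unfolding almost_subset_def
proof (rule finite_subset)
  show "below_graph f D - below_graph g D \<subseteq> (\<Union>n\<in>{n. g n < f n}. {..<f n})"
  proof
    fix x assume "x \<in> below_graph f D - below_graph g D"
    then obtain n where n: "x \<in> part D n" "x < f n" "\<not> x < g n" unfolding below_graph_def by blast
    then have "g n < f n" by auto
    then show "x \<in> (\<Union>n\<in>{n. g n < f n}. {..<f n})" using n(2) by blast
  qed
  show "finite (\<Union>n\<in>{n. g n < f n}. {..<f n})" using assms unfolding dominated_def by blast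
qed

text \<open>
  This is why graph sets keep branches thin.  Suppose no graph set splits \<open>B\<close>.  Since infinitely many columns are met by members, the points of \<open>B\<close> above a
  graph are positive, so the points below every graph are covered.  By countable directedness of the scale, one finite set
  \<open>W\<close> of members covers all those sets: infinitely many members would already be met below a single graph.  Infinitely many columns meet a member
  outside \<open>W\<close>, so one may choose in each of these columns a point of \<open>B\<close> outside \<open>\<Union>W\<close>.  Some function of the scale is above
  infinitely many of the chosen points, and these contradict the choice of \<open>W\<close>.
\<close>

lemma scale_graph_splits:
  fixes D :: "nat \<Rightarrow> nat set"
  assumes F: "scale F" and ad: "pairwise almost_disjoint \<A>"
    and col: "\<And>n. covered \<A> (B \<inter> (\<Union>m\<le>n. D m))"
    and many: "infinite {A\<in>\<A>. \<exists>n. infinite (A \<inter> B \<inter> D n)}"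
  shows "\<exists>f\<in>F. \<not> covered \<A> (B \<inter> below_graph f D) \<and> \<not> covered \<A> (B - below_graph f D)"
proof (rule ccontr)
  assume no: "\<not> ?thesis"
  define V where "V = {A\<in>\<A>. \<exists>n. infinite (A \<inter> B \<inter> D n)}"
  \<comment> \<open>In the first column where it matters, disjointification removes only a finite part of a member.\<close>
  define lv where "lv = (\<lambda>A. LEAST n. infinite (A \<inter> B \<inter> D n))"
  have lv: "infinite (A \<inter> B \<inter> part D (lv A))" if "A \<in> V" for A
  proof
    assume fin: "finite (A \<inter> B \<inter> part D (lv A))"
    have inf: "infinite (A \<inter> B \<inter> D (lv A))"
      using that unfolding V_def lv_def by (intro LeastI_ex[where P = "\<lambda>n. infinite (A \<inter> B \<inter> D n)"]) simp
    have "finite (A \<inter> B \<inter> D m)" if "m < lv A" for m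
      using not_less_Least[of m "\<lambda>n. infinite (A \<inter> B \<inter> D n)"] that unfolding lv_def by simp
    then have "finite ((A \<inter> B \<inter> part D (lv A)) \<union> (\<Union>m<lv A. A \<inter> B \<inter> D m))" using fin by blast
    moreover have "A \<inter> B \<inter> D (lv A) \<subseteq> (A \<inter> B \<inter> part D (lv A)) \<union> (\<Union>m<lv A. A \<inter> B \<inter> D m)"
      unfolding part_def by blast
    ultimately show False using inf finite_subset by blast
  qed
  have fin_lv: "finite {A\<in>V. lv A = n}" for n
  proof (rule finite_subset)
    show "finite {A\<in>\<A>. infinite (A \<inter> (B \<inter> (\<Union>m\<le>n. D m)))}"
      by (rule covered_meets_finitely[OF ad col])
    show "{A\<in>V. lv A = n} \<subseteq> {A\<in>\<A>. infinite (A \<inter> (B \<inter> (\<Union>m\<le>n. D m)))}"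
    proof clarify
      fix A assume A: "A \<in> V" "n = lv A"
      have "A \<inter> B \<inter> part D (lv A) \<subseteq> A \<inter> (B \<inter> (\<Union>m\<le>lv A. D m))" unfolding part_def by blast
      then have "infinite (A \<inter> (B \<inter> (\<Union>m\<le>lv A. D m)))" using lv[OF A(1)] finite_subset by blast
      then show "A \<in> \<A> \<and> infinite (A \<inter> (B \<inter> (\<Union>m\<le>lv A. D m)))" using A unfolding V_def by blast
    qed
  qed
  have cov: "covered \<A> (B \<inter> below_graph f D)" if f: "f \<in> F" for f
  proof -
    have "infinite (A \<inter> (B - below_graph f D))" if "A \<in> V" for A
    proof
      assume "finite (A \<inter> (B - below_graph f D))"
      then have "finite ((A \<inter> (B - below_graph f D)) \<union> (below_graph f D \<inter> part D (lv A)))"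
        using finite_below_graph_part by blast
      moreover have "A \<inter> B \<inter> part D (lv A) \<subseteq> (A \<inter> (B - below_graph f D)) \<union> (below_graph f D \<inter> part D (lv A))"
        by blast
      ultimately show False using lv[OF that] finite_subset by blast
    qed
    then have "V \<subseteq> {A\<in>\<A>. infinite (A \<inter> (B - below_graph f D))}" unfolding V_def by blast
    then have "infinite {A\<in>\<A>. infinite (A \<inter> (B - below_graph f D))}"
      using many finite_subset unfolding V_def by blast
    then have "\<not> covered \<A> (B - below_graph f D)" by (rule not_covered_if_meets_infinitely[OF ad])
    then show ?thesis using no f by blast
  qed
  define W where "W = {A\<in>\<A>. \<exists>f\<in>F. infinite (A \<inter> (B \<inter> below_graph f D))}"
  have "finite W"
  proof (rule ccontr)
    assume "infinite W"
    then obtain c :: "nat \<Rightarrow> nat set" where c: "inj c" "range c \<subseteq> W"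
      using infinite_countable_subset by blast
    then have "\<forall>n. \<exists>f\<in>F. infinite (c n \<inter> (B \<inter> below_graph f D))" unfolding W_def by blast
    then obtain q where q: "\<And>n. q n \<in> F" "\<And>n. infinite (c n \<inter> (B \<inter> below_graph (q n) D))" by metis
    have "range q \<subseteq> F" "countable (range q)" using q(1) by auto
    then obtain g where g: "g \<in> F" "\<And>n. dominated (q n) g"
      using F unfolding scale_def by (metis rangeI)
    have "infinite (c n \<inter> (B \<inter> below_graph g D))" for n
    proof
      assume "finite (c n \<inter> (B \<inter> below_graph g D))"
      then have "finite ((c n \<inter> (B \<inter> below_graph g D)) \<union> (below_graph (q n) D - below_graph g D))"
        using below_graph_mono[OF g(2)] unfolding almost_subset_def by blast
      moreover have "c n \<inter> (B \<inter> below_graph (q n) D) \<subseteq>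
          (c n \<inter> (B \<inter> below_graph g D)) \<union> (below_graph (q n) D - below_graph g D)" by blast
      ultimately show False using q(2)[of n] finite_subset by blast
    qed
    then have "range c \<subseteq> {A\<in>\<A>. infinite (A \<inter> (B \<inter> below_graph g D))}" using c(2) unfolding W_def by blast
    moreover have "infinite (range c)" using c(1) finite_imageD infinite_UNIV_nat by blast
    moreover have "finite {A\<in>\<A>. infinite (A \<inter> (B \<inter> below_graph g D))}"
      using covered_meets_finitely[OF ad cov[OF g(1)]] .
    ultimately show False using finite_subset by blast
  qed
  define Q where "Q = lv ` (V - W)"
  have "infinite Q"
  proof
    assume "finite Q"
    have "infinite (V - W)" using many \<open>finite W\<close> unfolding V_def by simp
    moreover have "V - W \<subseteq> (\<Union>n\<in>Q. {A\<in>V. lv A = n})" unfolding Q_def by blast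
    moreover have "finite (\<Union>n\<in>Q. {A\<in>V. lv A = n})" using \<open>finite Q\<close> fin_lv by blast
    ultimately show False using finite_subset by blast
  qed
  have "\<forall>n\<in>Q. \<exists>x. x \<in> B \<inter> part D n - \<Union>W"
  proof
    fix n assume "n \<in> Q"
    then obtain A where A: "A \<in> V" "A \<notin> W" "n = lv A" unfolding Q_def by blast
    have "finite (A \<inter> \<Union>W)"
    proof (rule finite_Int_Union_of_finite[OF \<open>finite W\<close>])
      fix A' assume A': "A' \<in> W"
      then have "A' \<in> \<A>" "A \<noteq> A'" "A \<in> \<A>" using A unfolding W_def V_def by auto
      then show "finite (A \<inter> A')" using ad unfolding pairwise_def almost_disjoint_def by simp
    qed
    then have "infinite (A \<inter> B \<inter> part D n - A \<inter> \<Union>W)" using lv[OF A(1)] A(3) by simp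
    then obtain x where "x \<in> A \<inter> B \<inter> part D n - A \<inter> \<Union>W" by (metis ex_in_conv finite.emptyI)
    then show "\<exists>x. x \<in> B \<inter> part D n - \<Union>W" by blast
  qed
  then obtain x where x: "\<And>n. n \<in> Q \<Longrightarrow> x n \<in> B \<inter> part D n - \<Union>W" by metis
  obtain f where f: "f \<in> F" "infinite {n\<in>Q. x n < f n}"
    using scale_unbounded[OF F \<open>infinite Q\<close>, of x] by blast
  have "inj_on x {n\<in>Q. x n < f n}"
    using x part_unique by (intro inj_onI) (metis (no_types, lifting) Diff_iff Int_iff mem_Collect_eq)
  then have "infinite (x ` {n\<in>Q. x n < f n})" using f(2) finite_imageD by blast
  moreover have "x ` {n\<in>Q. x n < f n} \<subseteq> B \<inter> below_graph f D"
    using x unfolding below_graph_def by blast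
  ultimately obtain A where A: "A \<in> \<A>" "infinite (A \<inter> x ` {n\<in>Q. x n < f n})"
    using covered_meets[OF cov[OF f(1)]] by blast
  then have "infinite (A \<inter> (B \<inter> below_graph f D))"
    using \<open>x ` {n\<in>Q. x n < f n} \<subseteq> B \<inter> below_graph f D\<close>
    by (meson Int_mono finite_subset order_refl)
  then have "A \<in> W" using A(1) f(1) unfolding W_def by blast
  then have "A \<inter> x ` {n\<in>Q. x n < f n} = {}" using x by blast
  then show False using A(2) by simp
qed

section \<open>The tree of branches\<close>

locale tree = cardinal_order r for r :: "'k rel" +
  fixes M :: "'k set" and task :: "'k \<Rightarrow> 'k task"
  assumes countable_bounded: "countable A \<Longrightarrow> A \<subseteq> Field r \<Longrightarrow> \<exists>x\<in>Field r. A \<subseteq> underS r x"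
    and graph_task: "k \<in> Field r \<Longrightarrow> k \<notin> M \<Longrightarrow> task k = Graph u f \<Longrightarrow>
      u \<subseteq> underS r k \<and> infinite u \<and> countable u"
    and base_tasks: "(\<And>n :: nat. infinite (s n)) \<Longrightarrow> \<exists>k\<in>Field r - M. \<exists>Y. task k = Base Y \<and>
      (\<forall>n. infinite (s n \<inter> Y) \<and> infinite (s n - Y))"
begin

text \<open>
  The set on a level, given the sets \<open>c\<close> on earlier levels, the family \<open>a\<close> of members indexed by nodes and the branch \<open>N\<close>.  Absent members
  are represented by the empty set.  The set on a level in \<open>M\<close> is the member at the node that \<open>N\<close> has reached there, so that
  a branch passing such a node discards its member.
\<close>

definition level_step :: "('k \<times> 'k set \<Rightarrow> nat set) \<Rightarrow> 'k set \<Rightarrow> ('k \<Rightarrow> nat set) \<Rightarrow> 'k \<Rightarrow> nat set" where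
  "level_step a N c k = (if k \<in> M then a (k, N \<inter> underS r k) else
     case task k of Base X \<Rightarrow> X
     | Graph u f \<Rightarrow> below_graph f (\<lambda>n. let j = from_nat_into u n in if j \<in> N then - c j else c j))"

definition C :: "('k \<times> 'k set \<Rightarrow> nat set) \<Rightarrow> 'k set \<Rightarrow> 'k \<Rightarrow> nat set" where
  "C a N = wfrec (r - Id) (level_step a N)"

text \<open>
  The side of \<open>C a N k\<close> that the branch \<open>N\<close> keeps; its complement is what the branch discards at \<open>k\<close>.
\<close>

definition Z :: "('k \<times> 'k set \<Rightarrow> nat set) \<Rightarrow> 'k set \<Rightarrow> 'k \<Rightarrow> nat set" where
  "Z a N k = (if k \<in> N then C a N k else - C a N k)"

definition columns :: "('k \<times> 'k set \<Rightarrow> nat set) \<Rightarrow> 'k set \<Rightarrow> 'k set \<Rightarrow> nat \<Rightarrow> nat set" where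
  "columns a N u n = - Z a N (from_nat_into u n)"

lemma from_nat_into_graph_task:
  assumes "k \<in> K" "k \<notin> M" "task k = Graph u f"
  shows "from_nat_into u n \<in> u" "from_nat_into u n \<prec> k"
proof -
  have "u \<noteq> {}" using graph_task[OF assms] by auto
  then show "from_nat_into u n \<in> u" by (rule from_nat_into)
  then show "from_nat_into u n \<prec> k" using graph_task[OF assms] by blast
qed

lemma C_unfold:
  assumes k: "k \<in> K"
  shows "C a N k = (if k \<in> M then a (k, N \<inter> underS r k) else
     case task k of Base X \<Rightarrow> X | Graph u f \<Rightarrow> below_graph f (columns a N u))"
proof -
  have "C a N k = level_step a N (cut (C a N) (r - Id) k) k"
    unfolding C_def by (rule wfrec[OF wo_rel.WF[OF wo]])
  also have "\<dots> = (if k \<in> M then a (k, N \<inter> underS r k) else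
     case task k of Base X \<Rightarrow> X | Graph u f \<Rightarrow> below_graph f (columns a N u))"
  proof (cases "k \<in> M")
    case False
    show ?thesis
    proof (cases "task k")
      case (Graph u f)
      have "(let j = from_nat_into u n in
          if j \<in> N then - cut (C a N) (r - Id) k j else cut (C a N) (r - Id) k j) = columns a N u n" for n
        using from_nat_into_graph_task(2)[OF k False Graph, of n]
        by (simp add: Let_def columns_def Z_def cut_def lt_def)
      then show ?thesis using False Graph by (simp add: level_step_def)
    qed (simp add: level_step_def False)
  qed (simp add: level_step_def)
  finally show ?thesis .
qed

lemma C_M: "k \<in> K \<Longrightarrow> k \<in> M \<Longrightarrow> C a N k = a (k, N \<inter> underS r k)"
  by (simp add: C_unfold)

lemma C_Base: "k \<in> K \<Longrightarrow> k \<notin> M \<Longrightarrow> task k = Base X \<Longrightarrow> C a N k = X"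
  by (simp add: C_unfold)

lemma C_Graph: "k \<in> K \<Longrightarrow> k \<notin> M \<Longrightarrow> task k = Graph u f \<Longrightarrow> C a N k = below_graph f (columns a N u)"
  by (simp add: C_unfold)

lemma underS_inter_eq_mono:
  assumes "N \<inter> underS r k = N' \<inter> underS r k" "j \<preceq> k"
  shows "N \<inter> underS r j = N' \<inter> underS r j"
proof -
  have "underS r j \<subseteq> underS r k" using assms(2) lt_le_trans by blast
  then show ?thesis using assms(1) by blast
qed

text \<open>
  Besides members placed at initial segments of the branch, nothing enters the definition of the sets up to level \<open>k\<close>.  This locality
  makes it possible to add members later without disturbing the old ones.
\<close>

lemma C_cong:
  assumes "k \<in> K" "N \<inter> underS r k = N' \<inter> underS r k"
    and "\<And>l. l \<in> M \<Longrightarrow> l \<preceq> k \<Longrightarrow> a (l, N \<inter> underS r l) = a' (l, N \<inter> underS r l)"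
  shows "C a N k = C a' N' k"
  using assms
proof (induction k rule: lt_induct)
  case (1 k)
  show ?case
  proof (cases "k \<in> M")
    case True
    then show ?thesis
      using 1(4)[OF True le_refl[OF 1(2)]] by (simp add: C_M[OF 1(2)] flip: 1(3))
  next
    case False
    show ?thesis
    proof (cases "task k")
      case (Base X)
      then show ?thesis using 1(2) False by (simp add: C_Base)
    next
      case (Graph u f)
      have "columns a N u n = columns a' N' u n" for n
      proof -
        define j where "j = from_nat_into u n"
        have j: "j \<prec> k" unfolding j_def by (rule from_nat_into_graph_task(2)[OF 1(2) False Graph])
        then have jle: "j \<preceq> k" by (rule lt_imp_le)
        have "C a N j = C a' N' j"
        proof (rule 1(1)[OF j lt_K(1)[OF j]])
          show "N \<inter> underS r j = N' \<inter> underS r j" by (rule underS_inter_eq_mono[OF 1(3) jle])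
          show "a (l, N \<inter> underS r l) = a' (l, N \<inter> underS r l)" if "l \<in> M" "l \<preceq> j" for l
            using 1(4)[OF that(1) le_trans[OF that(2) jle]] .
        qed
        moreover have "j \<in> N \<longleftrightarrow> j \<in> N'" using 1(3) j by blast
        ultimately show ?thesis unfolding columns_def Z_def j_def by simp
      qed
      then have "columns a N u = columns a' N' u" by blast
      then show ?thesis using 1(2) False Graph by (simp add: C_Graph)
    qed
  qed
qed

lemma C_local: "k \<in> K \<Longrightarrow> N \<inter> underS r k = N' \<inter> underS r k \<Longrightarrow> C a N k = C a N' k"
  by (rule C_cong) simp_all

lemma Z_local:
  assumes "N \<inter> underS r k = N' \<inter> underS r k" "j \<prec> k"
  shows "Z a N j = Z a N' j"
proof -
  have "C a N j = C a N' j"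
    using C_local[OF lt_K(1)[OF assms(2)] underS_inter_eq_mono[OF assms(1) lt_imp_le[OF assms(2)]]] .
  moreover have "j \<in> N \<longleftrightarrow> j \<in> N'" using assms by blast
  ultimately show ?thesis unfolding Z_def by simp
qed

text \<open>
  \<open>B\<close> follows the branch below \<open>\<delta>\<close> modulo the ideal of \<open>\<A>\<close>.  The ideal of the empty family consists of
  the finite sets, and then \<open>B\<close> is almost contained in every kept side.
\<close>

definition through :: "nat set set \<Rightarrow> ('k \<times> 'k set \<Rightarrow> nat set) \<Rightarrow> 'k set \<Rightarrow> 'k \<Rightarrow> nat set \<Rightarrow> bool" where
  "through \<A> a N \<delta> B \<longleftrightarrow> (\<forall>k. k \<prec> \<delta> \<longrightarrow> covered \<A> (B - Z a N k))"

lemma through_mono: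
  "through \<A> a N \<delta> B \<Longrightarrow> B' \<subseteq>* B \<Longrightarrow> \<delta>' \<preceq> \<delta> \<Longrightarrow> through \<A> a N \<delta>' B'"
  unfolding through_def
proof (intro allI impI)
  fix k assume *: "\<forall>k. k \<prec> \<delta> \<longrightarrow> covered \<A> (B - Z a N k)" "B' \<subseteq>* B" "\<delta>' \<preceq> \<delta>" "k \<prec> \<delta>'"
  then have "covered \<A> (B - Z a N k)" using lt_le_trans by blast
  moreover have "B' - Z a N k \<subseteq>* B - Z a N k"
    using *(2) unfolding almost_subset_def by (rule rev_finite_subset) blast
  ultimately show "covered \<A> (B' - Z a N k)" by (rule covered_mono[rotated])
qed

lemma through_local:
  assumes "N \<inter> underS r \<delta> = N' \<inter> underS r \<delta>"
  shows "through \<A> a N \<delta> B \<longleftrightarrow> through \<A> a N' \<delta> B"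
  unfolding through_def using Z_local[OF assms] by simp

text \<open>
  At the first level where the two branches differ, the sets on the level agree, and both halves of \<open>B\<close> would be covered.
\<close>

lemma through_unique:
  assumes pos: "\<not> covered \<A> B" and "through \<A> a N \<delta> B" "through \<A> a N' \<delta>' B"
    and "k \<preceq> \<delta>" "k \<preceq> \<delta>'"
  shows "N \<inter> underS r k = N' \<inter> underS r k"
  using assms(4,5)
proof (induction k rule: lt_induct)
  case (1 k)
  have "j \<in> N \<longleftrightarrow> j \<in> N'" if j: "j \<prec> k" for j
  proof -
    have jd: "j \<prec> \<delta>" "j \<prec> \<delta>'" using j 1(2,3) lt_le_trans by blast+
    have "N \<inter> underS r j = N' \<inter> underS r j" using 1(1)[OF j] jd lt_imp_le by blast
    then have C: "C a N j = C a N' j" by (rule C_local[OF lt_K(1)[OF j]])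
    have c: "covered \<A> (B - Z a N j)" "covered \<A> (B - Z a N' j)"
      using assms(2,3) jd unfolding through_def by blast+
    show ?thesis
    proof (rule ccontr)
      assume "(j \<in> N) \<noteq> (j \<in> N')"
      then have "Z a N j = - Z a N' j" unfolding Z_def using C by auto
      then have "covered \<A> (B \<inter> Z a N' j)" using c(1) by (simp add: Diff_eq)
      then have "covered \<A> B" using c(2) covered_split by blast
      then show False using pos by blast
    qed
  qed
  then show ?case by blast
qed

definition splits :: "nat set set \<Rightarrow> nat set \<Rightarrow> nat set \<Rightarrow> bool" where
  "splits \<A> X B \<longleftrightarrow> \<not> covered \<A> (B \<inter> X) \<and> \<not> covered \<A> (B - X)"

text \<open>
  If no level split \<open>B\<close> into two positive pieces, then \<open>B\<close> would follow a branch through all levels.  But a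
  base set splits \<open>B\<close>: apply simultaneous splitting to infinitely many intersections of \<open>B\<close> with members, or, if \<open>B\<close> meets only
  finitely many members, to the part of \<open>B\<close> outside them.
\<close>

lemma first_split:
  assumes ad: "pairwise almost_disjoint \<A>" and pos: "\<not> covered \<A> B"
  shows "\<exists>k N. k \<in> K \<and> N \<subseteq> underS r k \<and> through \<A> a N k B \<and> splits \<A> (C a N k) B"
proof (rule ccontr)
  assume none: "\<not> ?thesis"
  have "\<exists>N\<subseteq>underS r \<delta>. through \<A> a N \<delta> B" for \<delta>
  proof (induction \<delta> rule: lt_induct)
    case (1 \<delta>)
    then have "\<forall>k. \<exists>N. k \<prec> \<delta> \<longrightarrow> N \<subseteq> underS r k \<and> through \<A> a N k B" by blast
    then obtain Nk where Nk: "\<And>k. k \<prec> \<delta> \<Longrightarrow> Nk k \<subseteq> underS r k" "\<And>k. k \<prec> \<delta> \<Longrightarrow> through \<A> a (Nk k) k B"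
      by metis
    define N where "N = {k. k \<prec> \<delta> \<and> covered \<A> (B - C a (Nk k) k)}"
    have other: "covered \<A> (B \<inter> C a (Nk k) k)" if "k \<prec> \<delta>" "k \<notin> N" for k
      using none Nk[OF that(1)] lt_K(1)[OF that(1)] that unfolding N_def splits_def by blast
    have agree: "N \<inter> underS r k = Nk k \<inter> underS r k" if k: "k \<prec> \<delta>" for k
    proof -
      have "j \<in> N \<longleftrightarrow> j \<in> Nk k" if j: "j \<prec> k" for j
      proof -
        have jd: "j \<prec> \<delta>" using j k lt_trans by blast
        have "Nk j \<inter> underS r j = Nk k \<inter> underS r j"
          by (rule through_unique[OF pos Nk(2)[OF jd] Nk(2)[OF k] le_refl[OF lt_K(1)[OF j]] lt_imp_le[OF j]])
        then have C: "C a (Nk j) j = C a (Nk k) j" by (rule C_local[OF lt_K(1)[OF j]])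
        have t: "covered \<A> (B - Z a (Nk k) j)" using Nk(2)[OF k] j unfolding through_def by blast
        show ?thesis
        proof
          assume "j \<in> N"
          then have c: "covered \<A> (B - C a (Nk k) j)" using C unfolding N_def by simp
          show "j \<in> Nk k"
          proof (rule ccontr)
            assume "j \<notin> Nk k"
            then have "covered \<A> (B \<inter> C a (Nk k) j)" using t unfolding Z_def by simp
            then show False using c pos covered_split by blast
          qed
        next
          assume "j \<in> Nk k"
          then show "j \<in> N" using t jd C unfolding N_def Z_def by simp
        qed
      qed
      then show ?thesis by blast
    qed
    have "covered \<A> (B - Z a N k)" if k: "k \<prec> \<delta>" for k
    proof -
      have C: "C a N k = C a (Nk k) k" by (rule C_local[OF lt_K(1)[OF k] agree[OF k]])
      show ?thesis
      proof (cases "k \<in> N")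
        case True
        then show ?thesis unfolding Z_def C using N_def by simp
      next
        case False
        then show ?thesis using other[OF k] unfolding Z_def C by simp
      qed
    qed
    then have "through \<A> a N \<delta> B" unfolding through_def by blast
    moreover have "N \<subseteq> underS r \<delta>" unfolding N_def by blast
    ultimately show ?case by blast
  qed
  note branches = this
  have "\<exists>s :: nat \<Rightarrow> nat set. (\<forall>n. infinite (s n)) \<and>
      (\<forall>Y. (\<forall>n. infinite (s n \<inter> Y) \<and> infinite (s n - Y)) \<longrightarrow> splits \<A> Y B)"
  proof (cases "finite {A\<in>\<A>. infinite (A \<inter> B)}")
    case True
    define X where "X = B - \<Union>{A\<in>\<A>. infinite (A \<inter> B)}"
    have X: "infinite X"
    proof
      assume "finite X"
      then have "B \<subseteq>* \<Union>{A\<in>\<A>. infinite (A \<inter> B)}" unfolding almost_subset_def X_def .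
      moreover have "covered \<A> (\<Union>{A\<in>\<A>. infinite (A \<inter> B)})" using True by (rule covered_Union[rotated]) simp
      ultimately show False using pos covered_mono by blast
    qed
    have X_ad: "finite (A \<inter> X)" if "A \<in> \<A>" for A
    proof (cases "infinite (A \<inter> B)")
      case True
      then have "A \<inter> X = {}" using that unfolding X_def by blast
      then show ?thesis by simp
    next
      case False
      then have "finite (A \<inter> B)" by simp
      then show ?thesis unfolding X_def by (rule rev_finite_subset) blast
    qed
    have "splits \<A> Y B" if "infinite (X \<inter> Y)" "infinite (X - Y)" for Y
      unfolding splits_def
    proof
      show "\<not> covered \<A> (B \<inter> Y)"
      proof (rule not_covered_if_almost_disjoint[OF that(1)])
        show "X \<inter> Y \<subseteq> B \<inter> Y" unfolding X_def by blast
        show "finite (A \<inter> (X \<inter> Y))" if "A \<in> \<A>" for A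
          using X_ad[OF that] by (rule rev_finite_subset) blast
      qed
      show "\<not> covered \<A> (B - Y)"
      proof (rule not_covered_if_almost_disjoint[OF that(2)])
        show "X - Y \<subseteq> B - Y" unfolding X_def by blast
        show "finite (A \<inter> (X - Y))" if "A \<in> \<A>" for A
          using X_ad[OF that] by (rule rev_finite_subset) blast
      qed
    qed
    then show ?thesis using X by (intro exI[of _ "\<lambda>_. X"]) simp
  next
    case False
    then obtain c :: "nat \<Rightarrow> nat set" where c: "inj c" "range c \<subseteq> {A\<in>\<A>. infinite (A \<inter> B)}"
      using infinite_countable_subset by blast
    have rc: "infinite (range c)" using c(1) finite_imageD infinite_UNIV_nat by blast
    have "splits \<A> Y B" if Y: "\<And>n. infinite ((c n \<inter> B) \<inter> Y) \<and> infinite ((c n \<inter> B) - Y)" for Y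
    proof -
      have "range c \<subseteq> {A\<in>\<A>. infinite (A \<inter> (B \<inter> Y))}" "range c \<subseteq> {A\<in>\<A>. infinite (A \<inter> (B - Y))}"
        using c(2) Y by (auto simp: Int_assoc Int_Diff)
      then show ?thesis unfolding splits_def
        using not_covered_if_meets_infinitely[OF ad] rc finite_subset by blast
    qed
    moreover have "infinite (c n \<inter> B)" for n using c(2) by blast
    ultimately show ?thesis by (intro exI[of _ "\<lambda>n. c n \<inter> B"]) blast
  qed
  then obtain s :: "nat \<Rightarrow> nat set" where s: "\<And>n. infinite (s n)"
     "\<And>Y. (\<forall>n. infinite (s n \<inter> Y) \<and> infinite (s n - Y)) \<Longrightarrow> splits \<A> Y B" by metis
  obtain k Y where k: "k \<in> K" "k \<notin> M" "task k = Base Y" "\<forall>n. infinite (s n \<inter> Y) \<and> infinite (s n - Y)"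
    using base_tasks[of s, OF s(1)] by blast
  have "splits \<A> Y B" by (rule s(2)[OF k(4)])
  then have "splits \<A> (C a N k) B" for N using C_Base[OF k(1-3)] by simp
  then show False using branches[of k] none k(1) by blast
qed

section \<open>Cantor schemes\<close>

lemma least_strict_upper_bound:
  assumes "countable A" "A \<subseteq> K"
  shows "\<exists>\<delta>\<in>K. A \<subseteq> underS r \<delta> \<and> (\<forall>k. k \<prec> \<delta> \<longrightarrow> (\<exists>x\<in>A. k \<preceq> x))"
proof -
  have "{x\<in>K. A \<subseteq> underS r x} \<noteq> {}" using countable_bounded[OF assms] by blast
  then obtain \<delta> where \<delta>: "\<delta> \<in> {x\<in>K. A \<subseteq> underS r x}" "\<forall>y\<in>{x\<in>K. A \<subseteq> underS r x}. \<delta> \<preceq> y"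
    using least_exists[of "{x\<in>K. A \<subseteq> underS r x}"] by blast
  have "\<exists>x\<in>A. k \<preceq> x" if k: "k \<prec> \<delta>" for k
  proof (rule ccontr)
    assume none: "\<not> ?thesis"
    have "A \<subseteq> underS r k"
    proof
      fix x assume "x \<in> A"
      then show "x \<in> underS r k" using none lt_or_le[of x k] assms(2) lt_K(1)[OF k] by blast
    qed
    then have "\<delta> \<preceq> k" using \<delta>(2) lt_K(1)[OF k] by blast
    then show False using k le_not_lt by blast
  qed
  then show ?thesis using \<delta>(1) by blast
qed

text \<open>
  Splitting repeatedly at the first possible level, and taking for \<open>n \<in> f\<close> the piece inside and for \<open>n \<notin> f\<close> the piece outside the set on
  this level, attaches a decreasing sequence of positive sets to each \<open>f\<close>.  The levels of the splits increase, because a piece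
  is not split again at or before the level that produced it.  So a positive pseudo-intersection follows a branch up to the supremum \<open>\<delta> f\<close> of these levels.
  The sets for \<open>f \<noteq> g\<close> are separated, even modulo finite sets, by the set on the level where \<open>f\<close> and \<open>g\<close> part.
\<close>

lemma cantor_scheme:
  assumes ad: "pairwise almost_disjoint \<A>" and pos: "\<not> covered \<A> B"
  shows "\<exists>Y \<delta> N. (\<forall>f :: nat set. Y f \<subseteq> B \<and> \<not> covered \<A> (Y f) \<and> \<delta> f \<in> K \<and> through \<A> a (N f) (\<delta> f) (Y f)) \<and>
     (\<forall>f g. f \<noteq> g \<longrightarrow> (\<exists>k. k \<prec> \<delta> f \<and> k \<prec> \<delta> g \<and> N f \<inter> underS r k = N g \<inter> underS r k \<and>
        (Y f \<subseteq>* C a (N f) k \<and> Y g \<subseteq>* - C a (N f) k \<or> Y f \<subseteq>* - C a (N f) k \<and> Y g \<subseteq>* C a (N f) k)))"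
proof -
  have "\<forall>B. \<exists>k N. \<not> covered \<A> B \<longrightarrow>
      k \<in> K \<and> N \<subseteq> underS r k \<and> through \<A> a N k B \<and> splits \<A> (C a N k) B"
    using first_split[OF ad] by blast
  then obtain kk NN where kN: "\<forall>B. \<not> covered \<A> B \<longrightarrow>
      kk B \<in> K \<and> NN B \<subseteq> underS r (kk B) \<and> through \<A> a (NN B) (kk B) B \<and> splits \<A> (C a (NN B) (kk B)) B"
    by metis
  define pick where "pick b B = (if b then B \<inter> C a (NN B) (kk B) else B - C a (NN B) (kk B))" for b B
  have pick_pos: "\<not> covered \<A> (pick b B)" if "\<not> covered \<A> B" for b B
    using kN that unfolding splits_def pick_def by simp
  have pick_sub: "pick b B \<subseteq> B" for b B unfolding pick_def by auto
  have kk_inc: "kk B \<prec> kk (pick b B)" if B: "\<not> covered \<A> B" for b B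
  proof (rule ccontr)
    define B' where "B' = pick b B"
    have B': "\<not> covered \<A> B'" unfolding B'_def by (rule pick_pos[OF B])
    have kB: "kk B \<in> K" "through \<A> a (NN B) (kk B) B" using kN B by blast+
    have kB': "kk B' \<in> K" "through \<A> a (NN B') (kk B') B'" "splits \<A> (C a (NN B') (kk B')) B'"
      using kN B' by blast+
    assume "\<not> kk B \<prec> kk (pick b B)"
    then have le: "kk B' \<preceq> kk B" using lt_or_le[OF kB(1) kB'(1)] unfolding B'_def by blast
    have th: "through \<A> a (NN B) (kk B) B'"
      using kB(2) subset_almost_subset[OF pick_sub] le_refl[OF kB(1)] unfolding B'_def by (rule through_mono)
    have "NN B \<inter> underS r (kk B') = NN B' \<inter> underS r (kk B')"
      by (rule through_unique[OF B' th kB'(2) le le_refl[OF kB'(1)]])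
    then have CC: "C a (NN B) (kk B') = C a (NN B') (kk B')" by (rule C_local[OF kB'(1)])
    consider "kk B' \<prec> kk B" | "kk B' = kk B" using le_iff_lt_or_eq[OF le] by blast
    then show False
    proof cases
      case 1
      then have "covered \<A> (B' - Z a (NN B) (kk B'))" using th unfolding through_def by blast
      then show False using kB'(3) CC unfolding splits_def Z_def by (simp split: if_splits)
    next
      case 2
      then have "B' \<inter> C a (NN B') (kk B') = {} \<or> B' - C a (NN B') (kk B') = {}"
        using CC unfolding B'_def pick_def by auto
      then show False using kB'(3) unfolding splits_def by (metis covered_finite finite.emptyI)
    qed
  qed
  define S where "S f = rec_nat B (\<lambda>n X. pick (n \<in> f) X)" for f
  have S0: "S f 0 = B" and SS: "S f (Suc n) = pick (n \<in> f) (S f n)" for f n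
    by (simp_all add: S_def)
  have S_pos: "\<not> covered \<A> (S f n)" for f n
    by (induction n) (auto simp: S0 SS pos pick_pos)
  have S_dec: "S f (Suc n) \<subseteq> S f n" for f n unfolding SS by (rule pick_sub)
  have S_anti: "S f n \<subseteq> S f m" if "m \<le> n" for f m n
    using lift_Suc_antimono_le[of "S f", OF S_dec that] .
  have S_agree: "S f n = S g n" if "\<And>m. m < n \<Longrightarrow> m \<in> f \<longleftrightarrow> m \<in> g" for f g n
    using that by (induction n) (simp_all add: S0 SS)
  have kS: "kk (S f n) \<in> K" "through \<A> a (NN (S f n)) (kk (S f n)) (S f n)" for f n
    using kN S_pos by blast+
  have kS_inc: "kk (S f n) \<prec> kk (S f (Suc n))" for f n unfolding SS by (rule kk_inc[OF S_pos])
  have "\<forall>f. \<exists>Y. \<not> covered \<A> Y \<and> Y \<subseteq> S f 0 \<and> (\<forall>n. Y \<subseteq>* S f n)"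
  proof
    fix f show "\<exists>Y. \<not> covered \<A> Y \<and> Y \<subseteq> S f 0 \<and> (\<forall>n. Y \<subseteq>* S f n)"
      by (rule positive_pseudo_intersection[of \<A> "S f", OF ad S_pos S_dec])
  qed
  then obtain Y where Y: "\<And>f. \<not> covered \<A> (Y f)" "\<And>f. Y f \<subseteq> B" "\<And>f n. Y f \<subseteq>* S f n"
    unfolding S0 by metis
  have "\<forall>f. \<exists>\<delta>\<in>K. range (\<lambda>n. kk (S f n)) \<subseteq> underS r \<delta> \<and>
      (\<forall>k. k \<prec> \<delta> \<longrightarrow> (\<exists>x\<in>range (\<lambda>n. kk (S f n)). k \<preceq> x))"
    using kS(1) by (intro allI least_strict_upper_bound) auto
  then obtain \<delta> where \<delta>: "\<And>f. \<delta> f \<in> K" "\<And>f. range (\<lambda>n. kk (S f n)) \<subseteq> underS r (\<delta> f)"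
      "\<And>f k. k \<prec> \<delta> f \<Longrightarrow> \<exists>x\<in>range (\<lambda>n. kk (S f n)). k \<preceq> x" by metis
  have \<delta>_above: "kk (S f n) \<prec> \<delta> f" for f n using \<delta>(2) by blast
  have \<delta>_below: "\<exists>n. k \<prec> kk (S f n)" if k: "k \<prec> \<delta> f" for f k
  proof -
    obtain n where "k \<preceq> kk (S f n)" using \<delta>(3)[OF k] by blast
    then show ?thesis using kS_inc le_lt_trans by blast
  qed
  define N where "N f = {k. \<exists>n. k \<prec> kk (S f n) \<and> k \<in> NN (S f n)}" for f
  have coherent: "k \<in> NN (S f m) \<longleftrightarrow> k \<in> NN (S f n)"
    if "m \<le> n" and k: "k \<prec> kk (S f m)" "k \<prec> kk (S f n)" for f m n k
  proof -
    \<comment> \<open>Both branches are followed by the later set \<open>S f n\<close> up to the smaller of the two levels.\<close>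
    obtain k' where k': "k' \<preceq> kk (S f m)" "k' \<preceq> kk (S f n)" "k \<prec> k'"
      using lt_or_le[OF kS(1) kS(1), of f m f n] k le_refl[OF kS(1)] lt_imp_le by blast
    have "through \<A> a (NN (S f m)) (kk (S f m)) (S f n)"
      by (rule through_mono[OF kS(2) subset_almost_subset[OF S_anti[OF \<open>m \<le> n\<close>]] le_refl[OF kS(1)]])
    from through_unique[OF S_pos this kS(2) k'(1,2)] k'(3) show ?thesis by blast
  qed
  have N_agree: "N f \<inter> underS r (kk (S f n)) = NN (S f n) \<inter> underS r (kk (S f n))" for f n
  proof -
    have "k \<in> N f \<longleftrightarrow> k \<in> NN (S f n)" if k: "k \<prec> kk (S f n)" for k
    proof
      assume "k \<in> N f"
      then obtain m where m: "k \<prec> kk (S f m)" "k \<in> NN (S f m)" unfolding N_def by blast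
      show "k \<in> NN (S f n)"
        using coherent[of m n k f] coherent[of n m k f] m k nat_le_linear[of m n] by blast
    qed (use k in \<open>auto simp: N_def\<close>)
    then show ?thesis by blast
  qed
  have th: "through \<A> a (N f) (\<delta> f) (Y f)" for f
    unfolding through_def
  proof (intro allI impI)
    fix k assume "k \<prec> \<delta> f"
    then obtain n where n: "k \<prec> kk (S f n)" using \<delta>_below by blast
    have "through \<A> a (N f) (kk (S f n)) (Y f)"
      using through_local[OF N_agree] through_mono[OF kS(2) Y(3) le_refl[OF kS(1)]] by blast
    then show "covered \<A> (Y f - Z a (N f) k)" using n unfolding through_def by blast
  qed
  have "\<exists>k. k \<prec> \<delta> f \<and> k \<prec> \<delta> g \<and> N f \<inter> underS r k = N g \<inter> underS r k \<and>
      (Y f \<subseteq>* C a (N f) k \<and> Y g \<subseteq>* - C a (N f) k \<or> Y f \<subseteq>* - C a (N f) k \<and> Y g \<subseteq>* C a (N f) k)"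
    if "f \<noteq> g" for f g
  proof -
    have ex: "\<exists>n. (n \<in> f) \<noteq> (n \<in> g)" using that by blast
    define n where "n = (LEAST n. (n \<in> f) \<noteq> (n \<in> g))"
    have n: "(n \<in> f) \<noteq> (n \<in> g)" unfolding n_def by (rule LeastI_ex[OF ex])
    have "m \<in> f \<longleftrightarrow> m \<in> g" if "m < n" for m
      using not_less_Least[of m "\<lambda>n. (n \<in> f) \<noteq> (n \<in> g)"] that unfolding n_def by blast
    then have eq: "S f n = S g n" by (rule S_agree)
    define k where "k = kk (S f n)"
    have kd: "k \<prec> \<delta> f" "k \<prec> \<delta> g" unfolding k_def using \<delta>_above[of f n] \<delta>_above[of g n] eq by simp_all
    have NN: "N f \<inter> underS r k = NN (S f n) \<inter> underS r k" "N g \<inter> underS r k = NN (S f n) \<inter> underS r k"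
      using N_agree[of f n] N_agree[of g n] eq unfolding k_def by simp_all
    have CC: "C a (N f) k = C a (NN (S f n)) k" by (rule C_local[OF lt_K(1)[OF kd(1)] NN(1)])
    have side: "Y e \<subseteq>* C a (N f) k" if "n \<in> e" "S e n = S f n" for e
    proof -
      have "S e (Suc n) \<subseteq> C a (N f) k" using that CC unfolding SS pick_def k_def by simp
      then show ?thesis using Y(3)[of e "Suc n"] almost_subset_trans subset_almost_subset by blast
    qed
    have side': "Y e \<subseteq>* - C a (N f) k" if "n \<notin> e" "S e n = S f n" for e
    proof -
      have "S e (Suc n) \<subseteq> - C a (N f) k" using that CC unfolding SS pick_def k_def by auto
      then show ?thesis using Y(3)[of e "Suc n"] almost_subset_trans subset_almost_subset by blast
    qed
    have "Y f \<subseteq>* C a (N f) k \<and> Y g \<subseteq>* - C a (N f) k \<or> Y f \<subseteq>* - C a (N f) k \<and> Y g \<subseteq>* C a (N f) k"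
      using n side[of f] side[of g] side'[of f] side'[of g] eq by auto
    then show ?thesis using kd NN by (intro exI[of _ k]) simp
  qed
  then show ?thesis using Y(1,2) \<delta>(1) th
    by (intro exI[of _ Y] exI[of _ \<delta>] exI[of _ N] conjI allI impI) simp_all
qed

definition treated :: "(nat \<Rightarrow> nat) set \<Rightarrow> 'k \<Rightarrow> 'k set \<Rightarrow> bool" where
  "treated F \<delta> u \<longleftrightarrow> (\<forall>f\<in>F. \<exists>k\<in>underS r \<delta> - M. task k = Graph u f)"

text \<open>
  A level at which members that have left a branch can be separated from members that still follow it.  By the first
  clause only few members have left before \<open>e\<close>.  By the others, any node that agrees with the branch up to \<open>e\<close>
  and is longer than \<open>e\<close> extends at least to \<open>\<delta>\<close>, and up to \<open>\<delta>\<close> the sets on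
  the levels depend on the branch beyond \<open>e\<close> only through the choice of columns
  of a graph set; the columns themselves come from sets determined by the branch below \<open>e\<close>.
  This is what \<open>decided_elsewhere\<close> needs.
\<close>

definition checkpoint :: "'t rel \<Rightarrow> (nat \<Rightarrow> nat) set \<Rightarrow> 'k \<Rightarrow> 'k \<Rightarrow> bool" where
  "checkpoint \<theta> F \<delta> e \<longleftrightarrow> e \<preceq> \<delta> \<and>
     (\<forall>w. w \<subseteq> underS r e \<and> \<theta> \<le>o |w| \<longrightarrow> (\<exists>u. infinite (u \<inter> w) \<and> treated F \<delta> u)) \<and>
     (\<forall>l\<in>M. e \<prec> l \<longrightarrow> \<delta> \<preceq> l) \<and> (\<forall>k\<in>underS r \<delta>. k \<in> M \<longrightarrow> k \<preceq> e) \<and>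
     (\<forall>k\<in>underS r \<delta> - M. \<forall>u f. task k = Graph u f \<longrightarrow>
        (\<forall>j\<in>u - M. \<forall>u' f'. task j = Graph u' f' \<longrightarrow> u' \<subseteq> underS r e))"

text \<open>
  A sequence of stages leading from \<open>\<delta>\<close> to the next limit level, such that all sets of one stage are
  determined by the branch below the start of the stage.
\<close>

definition staircase :: "'k \<Rightarrow> (nat \<Rightarrow> 'k) \<Rightarrow> 'k \<Rightarrow> bool" where
  "staircase \<delta> g m \<longleftrightarrow> m \<in> M \<and> \<delta> \<preceq> m \<and> g 0 \<preceq> \<delta> \<and>
     (\<forall>n. g n \<prec> g (Suc n)) \<and> (\<forall>k\<in>underS r m. \<exists>n. k \<prec> g n) \<and>
     (\<forall>n k. g n \<preceq> k \<and> k \<prec> g (Suc n) \<longrightarrow>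
        (k \<in> M \<longrightarrow> k = g n) \<and> (\<forall>u f. k \<notin> M \<and> task k = Graph u f \<longrightarrow> u \<subseteq> underS r (g n)))"

end

section \<open>Members that have left a branch\<close>

locale node_tree = tree r M task for r :: "'k rel" and M :: "'k set" and task :: "'k \<Rightarrow> 'k task" +
  fixes \<theta> :: "'t rel" and F :: "(nat \<Rightarrow> nat) set"
  assumes astar: "is_a_star \<theta>" and theta_infinite: "natLeq \<le>o \<theta>" and scale: "scale F"
    and unsplit: "|\<F>| <o r \<Longrightarrow> infinite X \<Longrightarrow> \<exists>Y\<subseteq>X. infinite Y \<and> (\<forall>D\<in>\<F>. Y \<subseteq>* D \<or> Y \<subseteq>* - D)"
    and checkpoints: "\<delta> \<in> Field r \<Longrightarrow> \<exists>e. checkpoint \<theta> F \<delta> e"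
    and staircases: "\<delta> \<in> Field r \<Longrightarrow> \<exists>g m. staircase \<delta> g m"
    and M_sub: "M \<subseteq> Field r"
begin

lemma theta_card: "cardinal_order \<theta>"
  using astar theta_infinite unfolding is_a_star_def by unfold_locales blast+

text \<open>
  \<open>k\<close> is the first level at which the branch discards an infinite part of \<open>A \<inter> B\<close>.
\<close>

definition first_exit where
  "first_exit a N B A k \<longleftrightarrow> infinite (A \<inter> (B - Z a N k)) \<and> (\<forall>j. j \<prec> k \<longrightarrow> finite (A \<inter> (B - Z a N j)))"

lemma first_exit_unique:
  "k \<in> K \<Longrightarrow> k' \<in> K \<Longrightarrow> first_exit a N B A k \<Longrightarrow> first_exit a N B A k' \<Longrightarrow> k = k'"
  using lt_or_le le_iff_lt_or_eq unfolding first_exit_def by blast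

lemma first_exit_exists:
  assumes k: "k \<in> K" "infinite (A \<inter> (B - Z a N k))" shows "\<exists>j. j \<preceq> k \<and> first_exit a N B A j"
proof -
  have "{j\<in>K. infinite (A \<inter> (B - Z a N j))} \<noteq> {}" using k by blast
  then obtain j where j: "j \<in> K" "infinite (A \<inter> (B - Z a N j))"
      "\<forall>i\<in>{j\<in>K. infinite (A \<inter> (B - Z a N j))}. j \<preceq> i"
    using least_exists[of "{j\<in>K. infinite (A \<inter> (B - Z a N j))}"] by blast
  have "finite (A \<inter> (B - Z a N i))" if "i \<prec> j" for i
  proof (rule ccontr)
    assume "infinite (A \<inter> (B - Z a N i))"
    then have "j \<preceq> i" using j(3) lt_K(1)[OF that] by blast
    then show False using that le_not_lt by blast
  qed
  then show ?thesis using j k unfolding first_exit_def by blast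
qed

lemma covered_UN: "finite I \<Longrightarrow> (\<And>i. i \<in> I \<Longrightarrow> covered \<A> (X i)) \<Longrightarrow> covered \<A> (\<Union>i\<in>I. X i)"
  by (induction I rule: finite_induct) (auto intro: covered_Un covered_finite)

text \<open>
  The levels in \<open>u\<close> give columns.  Different first exits belong to different members, so infinitely many
  first exits in \<open>u\<close> mean that infinitely many members meet columns; by \<open>scale_graph_splits\<close>
  one of the graph sets below \<open>\<delta>\<close> splits \<open>B\<close> into two positive pieces, but \<open>B\<close> follows a branch there.
\<close>

lemma treated_exits:
  assumes ad: "pairwise almost_disjoint \<A>" and pos: "\<not> covered \<A> B"
    and th: "through \<A> a N \<delta> B" and tr: "treated F \<delta> u"
  shows "finite {k\<in>u. \<exists>A\<in>\<A>. first_exit a N B A k}"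
proof (rule ccontr)
  define X where "X = {k\<in>u. \<exists>A\<in>\<A>. first_exit a N B A k}"
  assume "infinite {k\<in>u. \<exists>A\<in>\<A>. first_exit a N B A k}"
  then have inf: "infinite X" unfolding X_def .
  obtain f0 where "f0 \<in> F" using scale_unbounded[OF scale infinite_UNIV_nat] by blast
  then obtain k0 where k0: "k0 \<prec> \<delta>" "k0 \<notin> M" "task k0 = Graph u f0" using tr unfolding treated_def by blast
  note k0K = lt_K(1)[OF k0(1)]
  have u: "u \<subseteq> underS r k0" "countable u" using graph_task[OF k0K k0(2,3)] by blast+
  have u_below: "j \<prec> \<delta>" if "j \<in> u" for j using that u(1) lt_trans k0(1) by blast
  define D where "D = columns a N u"
  have D_cov: "covered \<A> (B \<inter> D n)" for n
  proof -
    have "from_nat_into u n \<prec> \<delta>" using u_below from_nat_into_graph_task(1)[OF k0K k0(2,3)] by blast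
    then have "covered \<A> (B - Z a N (from_nat_into u n))" using th unfolding through_def by blast
    then show ?thesis unfolding D_def columns_def by (simp add: Diff_eq)
  qed
  have col: "covered \<A> (B \<inter> (\<Union>m\<le>n. D m))" for n
  proof -
    have "covered \<A> (\<Union>m\<le>n. B \<inter> D m)" using covered_UN[of "{..n}" \<A> "\<lambda>m. B \<inter> D m"] D_cov by blast
    moreover have "B \<inter> (\<Union>m\<le>n. D m) = (\<Union>m\<le>n. B \<inter> D m)" by blast
    ultimately show ?thesis by metis
  qed
  obtain A where A: "\<And>k. k \<in> X \<Longrightarrow> A k \<in> \<A> \<and> first_exit a N B (A k) k"
    using bchoice[of X "\<lambda>k A. A \<in> \<A> \<and> first_exit a N B A k"] unfolding X_def by blast
  have inj: "inj_on A X"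
  proof (rule inj_onI)
    fix k k' assume k: "k \<in> X" "k' \<in> X" "A k = A k'"
    then have "k \<in> K" "k' \<in> K" using u_below lt_K(1) unfolding X_def by blast+
    then show "k = k'" using A[OF k(1)] A[OF k(2)] k(3) first_exit_unique by metis
  qed
  have "A ` X \<subseteq> {A\<in>\<A>. \<exists>n. infinite (A \<inter> B \<inter> D n)}"
  proof clarify
    fix k assume "k \<in> X"
    then have k: "k \<in> u" and Ak: "A k \<in> \<A>" "first_exit a N B (A k) k" using A[of k] unfolding X_def by blast+
    obtain n where n: "from_nat_into u n = k" using from_nat_into_surj[OF u(2) k] by blast
    have "A k \<inter> (B - Z a N k) = A k \<inter> B \<inter> D n" unfolding D_def columns_def n by blast
    then have "infinite (A k \<inter> B \<inter> D n)" using Ak(2) unfolding first_exit_def by simp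
    then show "A k \<in> \<A> \<and> (\<exists>n. infinite (A k \<inter> B \<inter> D n))" using Ak(1) by blast
  qed
  then have many: "infinite {A\<in>\<A>. \<exists>n. infinite (A \<inter> B \<inter> D n)}"
    using inf finite_imageD[OF _ inj] finite_subset by blast
  obtain f where f: "f \<in> F" "\<not> covered \<A> (B \<inter> below_graph f D)" "\<not> covered \<A> (B - below_graph f D)"
    using scale_graph_splits[OF scale ad col many] by blast
  obtain k where k: "k \<prec> \<delta>" "k \<notin> M" "task k = Graph u f" using tr f(1) unfolding treated_def by blast
  have "C a N k = below_graph f D" unfolding D_def by (rule C_Graph[OF lt_K(1)[OF k(1)] k(2,3)])
  moreover have "covered \<A> (B - Z a N k)" using th k(1) unfolding through_def by blast
  ultimately show False using f(2,3) unfolding Z_def by (simp split: if_splits)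
qed

text \<open>
  The invariant of the recursion: members decide the sets on the levels below their node as the
  node says, and members at different nodes are almost disjoint.
\<close>

definition good :: "('k \<times> 'k set \<Rightarrow> nat set) \<Rightarrow> bool" where
  "good a \<longleftrightarrow> (\<forall>e N. a (e, N) \<noteq> {} \<longrightarrow> e \<in> M \<and> N \<subseteq> underS r e \<and> infinite (a (e, N)) \<and>
       (\<forall>k. k \<prec> e \<longrightarrow> a (e, N) \<subseteq>* Z a N k)) \<and>
     (\<forall>p q. a p \<noteq> {} \<longrightarrow> a q \<noteq> {} \<longrightarrow> p \<noteq> q \<longrightarrow> finite (a p \<inter> a q))"

definition fam :: "('k \<times> 'k set \<Rightarrow> nat set) \<Rightarrow> nat set set" where
  "fam a = range a - {{}}"

lemma good_node:
  assumes "good a" "a (e, N) \<noteq> {}"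
  shows "e \<in> M" "e \<in> K" "N \<subseteq> underS r e" "infinite (a (e, N))" "k \<prec> e \<Longrightarrow> a (e, N) \<subseteq>* Z a N k"
  using assms M_sub unfolding good_def by blast+

lemma good_ad: "good a \<Longrightarrow> pairwise almost_disjoint (fam a)"
  unfolding good_def fam_def pairwise_def almost_disjoint_def by blast

text \<open>
  Only finitely many members have a given level as first exit, since the part of \<open>B\<close> discarded there is
  covered.  If \<open>\<theta>\<close> many members were involved, there would be \<open>\<theta>\<close> many first exits, and
  some treated \<open>u\<close> would contain infinitely many of them.
\<close>

lemma checkpoint_exits:
  assumes ad: "pairwise almost_disjoint \<A>" and pos: "\<not> covered \<A> B"
    and th: "through \<A> a N \<delta> B" and e: "e \<preceq> \<delta>"
    and hit: "\<And>w. w \<subseteq> underS r e \<Longrightarrow> \<theta> \<le>o |w| \<Longrightarrow> \<exists>u. infinite (u \<inter> w) \<and> treated F \<delta> u"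
  shows "|{A\<in>\<A>. \<exists>k. k \<prec> e \<and> infinite (A \<inter> (B - Z a N k))}| <o \<theta>"
proof -
  interpret th: cardinal_order \<theta> by (rule theta_card)
  define w where "w = {k. k \<prec> e \<and> (\<exists>A\<in>\<A>. first_exit a N B A k)}"
  define V where "V k = {A\<in>\<A>. infinite (A \<inter> (B - Z a N k))}" for k
  have "|w| <o \<theta>"
  proof (rule ccontr)
    assume "\<not> |w| <o \<theta>"
    then have "\<theta> \<le>o |w|" using not_ordLess_iff_ordLeq[OF th.well_order card_of_Well_order] by blast
    then obtain u where u: "infinite (u \<inter> w)" "treated F \<delta> u" using hit[of w] unfolding w_def by blast
    have "u \<inter> w \<subseteq> {k\<in>u. \<exists>A\<in>\<A>. first_exit a N B A k}" unfolding w_def by blast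
    then show False using u(1) treated_exits[OF ad pos th u(2)] finite_subset by blast
  qed
  have finV: "finite (V k)" if "k \<in> w" for k
  proof -
    have "k \<prec> \<delta>" using that e lt_le_trans unfolding w_def by blast
    then have "covered \<A> (B - Z a N k)" using th unfolding through_def by blast
    then show ?thesis unfolding V_def by (rule covered_meets_finitely[OF ad])
  qed
  have "|\<Union>k\<in>w. V k| <o \<theta>"
  proof (cases "finite w")
    case True
    then show ?thesis using finV by (intro th.finite_less) blast
  next
    case False
    have "\<forall>k\<in>w. |V k| \<le>o |w|"
    proof
      fix k assume "k \<in> w"
      then show "|V k| \<le>o |w|"
        using finite_ordLess_infinite[OF card_of_Well_order card_of_Well_order, of "V k" w] finV False
        by (simp add: Field_card_of ordLess_imp_ordLeq)
    qed
    then have "|\<Union>k\<in>w. V k| \<le>o |w|"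
      by (rule card_of_UNION_ordLeq_infinite[OF False ordLeq_reflexive[OF card_of_Well_order]])
    then show ?thesis using \<open>|w| <o \<theta>\<close> by (rule ordLeq_ordLess_trans)
  qed
  moreover have "{A\<in>\<A>. \<exists>k. k \<prec> e \<and> infinite (A \<inter> (B - Z a N k))} \<subseteq> (\<Union>k\<in>w. V k)"
  proof clarify
    fix A k assume A: "A \<in> \<A>" "k \<prec> e" "infinite (A \<inter> (B - Z a N k))"
    obtain j where j: "j \<preceq> k" "first_exit a N B A j" using first_exit_exists[OF lt_K(1)[OF A(2)] A(3)] by blast
    then have "j \<in> w" "A \<in> V j" using A le_lt_trans unfolding w_def V_def first_exit_def by blast+
    then show "A \<in> (\<Union>k\<in>w. V k)" by blast
  qed
  ultimately show ?thesis by (rule card_less_subset[rotated])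
qed

lemma columns_local:
  assumes "N \<inter> underS r e = N' \<inter> underS r e" "u \<subseteq> underS r e" "u \<noteq> {}"
  shows "columns a N u = columns a N' u"
proof
  fix n
  have "from_nat_into u n \<in> underS r e" using assms(2) from_nat_into[OF assms(3)] by blast
  then show "columns a N u n = columns a N' u n" unfolding columns_def using Z_local[OF assms(1)] by simp
qed

text \<open>
  A member that leaves the branch \<open>N\<close> only after \<open>e\<close> decides also the versions of the sets that belong to \<open>N\<close> instead of its own node.  The
  only sets for which the versions differ are graph sets whose columns come from levels where \<open>H\<close> and \<open>N\<close> disagree.  At the first such column,
  in the enumeration of \<open>u\<close>, the member is almost contained in the column, and a graph set
  is finite there; so the member is almost disjoint from the graph set.
\<close>

lemma decided_elsewhere:
  assumes g: "good a" and node: "a (l, H) \<noteq> {}" and el: "\<delta> \<preceq> l" and agree: "H \<inter> underS r e = N \<inter> underS r e"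
    and M_low: "\<And>k. k \<prec> \<delta> \<Longrightarrow> k \<in> M \<Longrightarrow> k \<preceq> e"
    and shallow: "\<And>k u f j u' f'. k \<prec> \<delta> \<Longrightarrow> k \<notin> M \<Longrightarrow> task k = Graph u f \<Longrightarrow> j \<in> u \<Longrightarrow> j \<notin> M \<Longrightarrow>
       task j = Graph u' f' \<Longrightarrow> u' \<subseteq> underS r e"
    and k: "k \<prec> \<delta>"
  shows "a (l, H) \<subseteq>* C a N k \<or> a (l, H) \<subseteq>* - C a N k"
proof -
  define A where "A = a (l, H)"
  have A_Z: "A \<subseteq>* Z a H j" if "j \<prec> \<delta>" for j
    unfolding A_def using good_node(5)[OF g node] that el lt_le_trans by blast
  have same: ?thesis if "C a N k = C a H k"
    using A_Z[OF k] that unfolding Z_def A_def by (simp split: if_splits)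
  have C_M_eq: "C a N j = C a H j" if "j \<prec> \<delta>" "j \<in> M" for j
    using C_local[OF lt_K(1)[OF that(1)] underS_inter_eq_mono[OF agree M_low[OF that]]] by simp
  note kK = lt_K(1)[OF k]
  show ?thesis
  proof (cases "k \<in> M")
    case True
    then show ?thesis using same C_M_eq k by blast
  next
    case kM: False
    show ?thesis
    proof (cases "task k")
      case (Base X)
      then show ?thesis using same C_Base[OF kK kM Base] by simp
    next
      case (Graph u f)
      have below: "j \<prec> \<delta>" if "j \<in> u" for j
        using graph_task[OF kK kM Graph] that k lt_trans by blast
      have C_eq: "C a N j = C a H j" if j: "j \<in> u" for j
      proof (cases "j \<in> M")
        case True
        then show ?thesis using C_M_eq below[OF j] by blast
      next
        case jM: False
        note jK = lt_K(1)[OF below[OF j]]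
        show ?thesis
        proof (cases "task j")
          case (Base X)
          then show ?thesis using C_Base[OF jK jM Base] by simp
        next
          case G2: (Graph u' f')
          have "columns a H u' = columns a N u'"
            using columns_local[OF agree shallow[OF k kM Graph j jM G2]] graph_task[OF jK jM G2] by auto
          then show ?thesis using C_Graph[OF jK jM G2] by simp
        qed
      qed
      define d where "d = from_nat_into u"
      have d: "d n \<in> u" for n unfolding d_def by (rule from_nat_into_graph_task(1)[OF kK kM Graph])
      show ?thesis
      proof (cases "\<forall>n. d n \<in> N \<longleftrightarrow> d n \<in> H")
        case True
        then have "columns a N u n = columns a H u n" for n
          using C_eq[OF d[of n]] unfolding columns_def Z_def d_def by simp
        then have "columns a N u = columns a H u" by blast
        then show ?thesis using same C_Graph[OF kK kM Graph] by simp
      next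
        case False
        then have ex: "\<exists>n. (d n \<in> N) \<noteq> (d n \<in> H)" by blast
        define n where "n = (LEAST n. (d n \<in> N) \<noteq> (d n \<in> H))"
        have n: "(d n \<in> N) \<noteq> (d n \<in> H)" unfolding n_def by (rule LeastI_ex[OF ex])
        have before: "Z a N (d m) = Z a H (d m)" if "m < n" for m
          using not_less_Least[of m "\<lambda>n. (d n \<in> N) \<noteq> (d n \<in> H)"] that C_eq[OF d]
          unfolding n_def Z_def by auto
        have "Z a H (d n) = columns a N u n"
          using n C_eq[OF d] unfolding columns_def Z_def d_def by auto
        then have in_n: "A \<subseteq>* columns a N u n" using A_Z[OF below[OF d]] by metis
        have "finite (A \<inter> columns a N u m)" if "m < n" for m
        proof -
          have "A \<subseteq>* Z a N (d m)" using A_Z[OF below[OF d]] before[OF that] by metis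
          then show ?thesis unfolding almost_subset_def columns_def d_def by (simp add: Diff_eq)
        qed
        then have "finite ((A - columns a N u n) \<union> (\<Union>m<n. A \<inter> columns a N u m))"
          using in_n unfolding almost_subset_def by blast
        moreover have "A - part (columns a N u) n \<subseteq> (A - columns a N u n) \<union> (\<Union>m<n. A \<inter> columns a N u m)"
          unfolding part_def by blast
        ultimately have "A \<subseteq>* part (columns a N u) n" unfolding almost_subset_def using finite_subset by blast
        moreover have "finite (part (columns a N u) n \<inter> below_graph f (columns a N u))"
          using finite_below_graph_part by (simp add: Int_commute)
        ultimately have "finite (A \<inter> below_graph f (columns a N u))" by (rule almost_subset_disjoint)
        then show ?thesis unfolding A_def[symmetric] C_Graph[OF kK kM Graph] almost_subset_def by simp
      qed
    qed
  qed
qed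

text \<open>
  The exceptional members are those leaving the branch before the checkpoint \<open>e\<close>, and the one member whose node ends exactly
  there.  A node which is a shorter initial segment of the branch counts as leaving, because the branch discards
  its member on the level of the node.  All other nodes agree with the branch up to \<open>e\<close> and are longer.
\<close>

lemma exceptional_nodes:
  assumes g: "good a" and pos: "\<not> covered (fam a) B" and th: "through (fam a) a N \<delta> B" and \<delta>: "\<delta> \<in> K"
  shows "\<exists>\<E>\<subseteq>fam a. |\<E>| <o \<theta> \<and> (\<forall>p. infinite (a p \<inter> B) \<and> a p \<notin> \<E> \<longrightarrow>
     (\<forall>k. k \<prec> \<delta> \<longrightarrow> a p \<subseteq>* C a N k \<or> a p \<subseteq>* - C a N k))"
proof -
  interpret th: cardinal_order \<theta> by (rule theta_card)
  obtain e where e: "e \<preceq> \<delta>"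
    and hit: "\<forall>w. w \<subseteq> underS r e \<and> \<theta> \<le>o |w| \<longrightarrow> (\<exists>u. infinite (u \<inter> w) \<and> treated F \<delta> u)"
    and M_high: "\<forall>l\<in>M. e \<prec> l \<longrightarrow> \<delta> \<preceq> l"
    and M_low: "\<forall>k\<in>underS r \<delta>. k \<in> M \<longrightarrow> k \<preceq> e"
    and shallow: "\<forall>k\<in>underS r \<delta> - M. \<forall>u f. task k = Graph u f \<longrightarrow>
          (\<forall>j\<in>u - M. \<forall>u' f'. task j = Graph u' f' \<longrightarrow> u' \<subseteq> underS r e)"
    using checkpoints[OF \<delta>] unfolding checkpoint_def by (elim exE conjE) (rule that)
  define \<E>1 where "\<E>1 = {A\<in>fam a. \<exists>k. k \<prec> e \<and> infinite (A \<inter> (B - Z a N k))}"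
  define \<E> where "\<E> = \<E>1 \<union> ({a (e, N \<inter> underS r e)} \<inter> fam a)"
  have "|\<E>1| <o \<theta>" unfolding \<E>1_def
    by (rule checkpoint_exits[OF good_ad[OF g] pos th e]) (use hit in blast)
  then have "|\<E>| <o \<theta>" unfolding \<E>_def by (rule th.Un_less[OF _ th.finite_less]) simp
  moreover have "\<E> \<subseteq> fam a" unfolding \<E>_def \<E>1_def by blast
  moreover have "a p \<subseteq>* C a N k \<or> a p \<subseteq>* - C a N k" if p: "infinite (a p \<inter> B)" "a p \<notin> \<E>" and k: "k \<prec> \<delta>" for p k
  proof -
    obtain l H where lH: "p = (l, H)" by (cases p)
    have ne: "a (l, H) \<noteq> {}" using p(1) lH by auto
    have fam: "a (l, H) \<in> fam a" using ne unfolding fam_def by blast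
    note node = good_node[OF g ne]
    have eK: "e \<in> K" using le_K(1)[OF e] .
    have same: "j \<in> H \<longleftrightarrow> j \<in> N" if j: "j \<prec> e" "j \<prec> l" for j
      using j
    proof (induction j rule: lt_induct)
      case (1 j)
      then have "\<And>i. i \<prec> j \<Longrightarrow> i \<in> H \<longleftrightarrow> i \<in> N" using lt_trans by blast
      then have "H \<inter> underS r j = N \<inter> underS r j" by blast
      then have C: "C a H j = C a N j" by (rule C_local[OF lt_K(1)[OF 1(2)]])
      show ?case
      proof (rule ccontr)
        assume "(j \<in> H) \<noteq> (j \<in> N)"
        then have "Z a H j = - Z a N j" unfolding Z_def using C by auto
        then have "finite (a (l, H) \<inter> Z a N j)" using node(5)[OF 1(3)] unfolding almost_subset_def by (simp add: Diff_eq)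
        then have "infinite (a (l, H) \<inter> B - a (l, H) \<inter> Z a N j)" using p(1) lH by simp
        moreover have "a (l, H) \<inter> B - a (l, H) \<inter> Z a N j = a (l, H) \<inter> (B - Z a N j)" by blast
        ultimately have "a (l, H) \<in> \<E>1" using fam 1(2) unfolding \<E>1_def by auto
        then show False using p(2) lH unfolding \<E>_def by blast
      qed
    qed
    have "e \<prec> l"
    proof (rule ccontr)
      assume "\<not> e \<prec> l"
      then have le: "l \<preceq> e" using lt_or_le[OF eK node(2)] by blast
      then have "H = N \<inter> underS r l" using same node(3) lt_le_trans by blast
      consider "l = e" | "l \<prec> e" using le_iff_lt_or_eq[OF le] by blast
      then show False
      proof cases
        case 1
        then show False using p(2) lH fam \<open>H = N \<inter> underS r l\<close> unfolding \<E>_def by simp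
      next
        case 2
        then have "covered (fam a) (B - Z a N l)" using th lt_le_trans[OF 2 e] unfolding through_def by blast
        moreover have C: "C a N l = a (l, H)" using C_M[OF node(2,1)] \<open>H = N \<inter> underS r l\<close> by simp
        moreover have "covered (fam a) (B \<inter> a (l, H))"
          using covered_Union[of "{a (l, H)}" "fam a"] fam covered_subset[of "B \<inter> a (l, H)" "a (l, H)"] by simp
        ultimately have "l \<notin> N" using pos covered_split unfolding Z_def by metis
        then have "a (l, H) \<inter> (B - Z a N l) = a (l, H) \<inter> B" unfolding Z_def C by auto
        then have "a (l, H) \<in> \<E>1" using fam 2 p(1) lH unfolding \<E>1_def by auto
        then show False using p(2) lH unfolding \<E>_def by blast
      qed
    qed
    then have el: "\<delta> \<preceq> l" using M_high node(1) by blast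
    have agree: "H \<inter> underS r e = N \<inter> underS r e" using same \<open>e \<prec> l\<close> lt_trans by blast
    show ?thesis unfolding lH
    proof (rule decided_elsewhere[OF g ne el agree _ _ k])
      show "j \<preceq> e" if "j \<prec> \<delta>" "j \<in> M" for j using M_low that by simp
      show "u' \<subseteq> underS r e" if "i \<prec> \<delta>" "i \<notin> M" "task i = Graph u f" "j \<in> u" "j \<notin> M" "task j = Graph u' f'"
        for i u f j u' f' using shallow that by simp
    qed
  qed
  ultimately show ?thesis by (intro exI[of _ \<E>] conjI allI impI) simp_all
qed

section \<open>Escaping the whole family\<close>

text \<open>
  For each branch \<open>f\<close> of a Cantor scheme below \<open>B\<close>, a member that meets the set of \<open>f\<close> and is not exceptional decides all sets on
  the levels below \<open>\<delta> f\<close>, in particular those which separate \<open>f\<close> from other branches.  So it cannot have this role for two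
  branches, and by counting there is a branch all of whose members are exceptional.  These are few, and \<open>a_star_escape\<close> applies.
\<close>

lemma escape:
  assumes g: "good a" and few: "\<not> |UNIV :: nat set set| \<le>o |{p. a p \<noteq> {}}|" and pos: "\<not> covered (fam a) B"
  shows "\<exists>X\<subseteq>B. infinite X \<and> (\<forall>p. finite (a p \<inter> X))"
proof -
  obtain Y \<delta> N where YN: "\<forall>f :: nat set. Y f \<subseteq> B \<and> \<not> covered (fam a) (Y f) \<and> \<delta> f \<in> K \<and>
      through (fam a) a (N f) (\<delta> f) (Y f)"
    and sep: "\<forall>f g. f \<noteq> g \<longrightarrow> (\<exists>k. k \<prec> \<delta> f \<and> k \<prec> \<delta> g \<and> N f \<inter> underS r k = N g \<inter> underS r k \<and>
        (Y f \<subseteq>* C a (N f) k \<and> Y g \<subseteq>* - C a (N f) k \<or> Y f \<subseteq>* - C a (N f) k \<and> Y g \<subseteq>* C a (N f) k))"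
    using cantor_scheme[OF good_ad[OF g] pos, of a] by (elim exE conjE) (rule that)
  have Y: "Y f \<subseteq> B" "\<not> covered (fam a) (Y f)" "\<delta> f \<in> K" "through (fam a) a (N f) (\<delta> f) (Y f)" for f
    using YN by simp_all
  have "\<forall>f. \<exists>\<E>\<subseteq>fam a. |\<E>| <o \<theta> \<and> (\<forall>p. infinite (a p \<inter> Y f) \<and> a p \<notin> \<E> \<longrightarrow>
     (\<forall>k. k \<prec> \<delta> f \<longrightarrow> a p \<subseteq>* C a (N f) k \<or> a p \<subseteq>* - C a (N f) k))"
    using exceptional_nodes[OF g Y(2,4,3)] by (intro allI)
  then obtain \<E> where \<E>: "\<And>f. \<E> f \<subseteq> fam a" "\<And>f. |\<E> f| <o \<theta>"
      "\<And>f p k. infinite (a p \<inter> Y f) \<Longrightarrow> a p \<notin> \<E> f \<Longrightarrow> k \<prec> \<delta> f \<Longrightarrow> a p \<subseteq>* C a (N f) k \<or> a p \<subseteq>* - C a (N f) k"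
    by metis
  have "\<exists>f. \<forall>p. infinite (a p \<inter> Y f) \<longrightarrow> a p \<in> \<E> f"
  proof (rule ccontr)
    assume "\<not> ?thesis"
    then have "\<forall>f. \<exists>p. infinite (a p \<inter> Y f) \<and> a p \<notin> \<E> f" by blast
    then obtain p where p: "\<And>f. infinite (a (p f) \<inter> Y f)" "\<And>f. a (p f) \<notin> \<E> f" by metis
    have meets: "\<not> A \<subseteq>* - D" if "infinite (A \<inter> X)" "X \<subseteq>* D" for A D X :: "nat set"
    proof
      assume "A \<subseteq>* - D"
      then have "finite ((A - (- D)) \<union> (X - D))" using that(2) unfolding almost_subset_def by blast
      moreover have "A \<inter> X \<subseteq> (A - (- D)) \<union> (X - D)" by blast
      ultimately show False using that(1) finite_subset by blast
    qed
    have "inj p"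
    proof (rule injI, rule ccontr)
      fix f g assume eq: "p f = p g" and "f \<noteq> g"
      obtain k where k: "k \<prec> \<delta> f" "Y f \<subseteq>* C a (N f) k \<and> Y g \<subseteq>* - C a (N f) k \<or> Y f \<subseteq>* - C a (N f) k \<and> Y g \<subseteq>* C a (N f) k"
        using sep \<open>f \<noteq> g\<close> by metis
      have dec: "a (p f) \<subseteq>* C a (N f) k \<or> a (p f) \<subseteq>* - C a (N f) k" by (rule \<E>(3)[OF p(1,2) k(1)])
      have pg: "infinite (a (p f) \<inter> Y g)" using p(1)[of g] eq by simp
      from k(2) show False
        using dec meets[OF p(1)[of f]] meets[OF pg] by (metis double_complement)
    qed
    moreover have "range p \<subseteq> {p. a p \<noteq> {}}" using p(1) by (auto intro!: finite.emptyI) (metis finite.emptyI inf_bot_left)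
    ultimately have "|UNIV :: nat set set| \<le>o |{p. a p \<noteq> {}}|" using card_of_ordLeq by blast
    then show False using few by blast
  qed
  then obtain f where f: "\<And>p. infinite (a p \<inter> Y f) \<Longrightarrow> a p \<in> \<E> f" by blast
  have ad: "pairwise almost_disjoint (\<E> f)" using good_ad[OF g] \<E>(1) by (rule pairwise_subset)
  have "\<not> covered (\<E> f) (Y f)" using Y(2) covered_mono_family[OF \<E>(1)] by blast
  from a_star_escape[OF astar ad \<E>(2) this]
  obtain X where X: "X \<subseteq> Y f" "infinite X" "\<forall>A\<in>\<E> f. finite (A \<inter> X)"
    by (elim exE conjE) (rule that)
  have "finite (a p \<inter> X)" for p
  proof (cases "a p \<in> \<E> f")
    case False
    then have "finite (a p \<inter> Y f)" using f by blast
    then show ?thesis by (rule rev_finite_subset) (use X(1) in blast)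
  qed (use X(3) in blast)
  then show ?thesis using X(1,2) Y(1) by blast
qed

section \<open>Free nodes\<close>

text \<open>
  The sets of one stage do not depend on the branch within the stage, and they are fewer than the splitting
  number, so an unsplit refinement decides all of them at once.
\<close>

lemma resolve_stage:
  assumes X: "infinite X" "through {} a N g X"
    and dep: "\<And>k. g \<preceq> k \<Longrightarrow> k \<prec> g' \<Longrightarrow>
      (k \<in> M \<longrightarrow> k = g) \<and> (\<forall>u f. k \<notin> M \<and> task k = Graph u f \<longrightarrow> u \<subseteq> underS r g)"
    and g: "g \<prec> g'"
  shows "\<exists>Y\<subseteq>X. infinite Y \<and> (\<exists>N'. through {} a N' g' Y)"
proof -
  have "|C a N ` underS r g'| <o r" using less_underS[OF lt_K(2)[OF g]] by (rule card_less_image)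
  from unsplit[OF this X(1)]
  obtain Y where Y: "Y \<subseteq> X" "infinite Y" "\<forall>D\<in>C a N ` underS r g'. Y \<subseteq>* D \<or> Y \<subseteq>* - D"
    by (elim exE conjE) (rule that)
  define N' where "N' = (N \<inter> underS r g) \<union> {k. g \<preceq> k \<and> k \<prec> g' \<and> Y \<subseteq>* C a N k}"
  have agree: "N' \<inter> underS r g = N \<inter> underS r g"
    unfolding N'_def using le_not_lt by blast
  have thY: "through {} a N g Y"
    using X(2) subset_almost_subset[OF Y(1)] le_refl[OF lt_K(1)[OF g]] by (rule through_mono)
  have "covered {} (Y - Z a N' k)" if k: "k \<prec> g'" for k
  proof (cases "k \<prec> g")
    case True
    then have "Z a N' k = Z a N k" by (rule Z_local[OF agree])
    then show ?thesis using thY True unfolding through_def by simp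
  next
    case False
    then have gk: "g \<preceq> k" using lt_or_le[OF lt_K(1)[OF k] lt_K(1)[OF g]] by blast
    note kK = lt_K(1)[OF k]
    have "C a N' k = C a N k"
    proof (cases "k \<in> M")
      case True
      then have "k = g" using dep[OF gk k] True by simp
      then show ?thesis using C_local[OF kK, of N' N] agree by simp
    next
      case kM: False
      show ?thesis
      proof (cases "task k")
        case (Base D)
        then show ?thesis using C_Base[OF kK kM Base] by simp
      next
        case (Graph u f)
        have "u \<subseteq> underS r g" using dep[OF gk k] kM Graph by simp
        moreover have "u \<noteq> {}" using graph_task[OF kK kM Graph] by auto
        ultimately have "columns a N' u = columns a N u" by (rule columns_local[OF agree])
        then show ?thesis using C_Graph[OF kK kM Graph] by simp
      qed
    qed
    moreover have "k \<in> N' \<longleftrightarrow> Y \<subseteq>* C a N k" unfolding N'_def using gk k False by blast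
    moreover have "Y \<subseteq>* C a N k \<or> Y \<subseteq>* - C a N k" using Y(3) k by blast
    ultimately have "Y \<subseteq>* Z a N' k" unfolding Z_def by auto
    then show ?thesis unfolding covered_empty_iff almost_subset_def .
  qed
  then have "through {} a N' g' Y" unfolding through_def by blast
  then show ?thesis using Y(1,2) by blast
qed

text \<open>
  Repeat \<open>resolve_stage\<close> along a staircase and take a pseudo-intersection.
\<close>

lemma resolve:
  assumes X: "infinite X" "through {} a N \<delta> X" and \<delta>: "\<delta> \<in> K"
  shows "\<exists>Y\<subseteq>X. infinite Y \<and> (\<exists>m\<in>M. \<delta> \<preceq> m \<and> (\<exists>N'. through {} a N' m Y))"
proof -
  obtain g m where m: "m \<in> M" "\<delta> \<preceq> m" and g0: "g 0 \<preceq> \<delta>"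
    and g_inc: "\<forall>n. g n \<prec> g (Suc n)" and g_cof: "\<forall>k\<in>underS r m. \<exists>n. k \<prec> g n"
    and dep: "\<forall>n k. g n \<preceq> k \<and> k \<prec> g (Suc n) \<longrightarrow>
        (k \<in> M \<longrightarrow> k = g n) \<and> (\<forall>u f. k \<notin> M \<and> task k = Graph u f \<longrightarrow> u \<subseteq> underS r (g n))"
    using staircases[OF \<delta>] unfolding staircase_def by (elim exE conjE) (rule that)
  have gK: "g n \<in> K" for n using lt_K(1) g_inc by blast
  have "\<exists>S. \<forall>n. (infinite (S n) \<and> (\<exists>N. through {} a N (g n) (S n)) \<and> S n \<subseteq> X) \<and> S (Suc n) \<subseteq> S n"
  proof (rule dependent_nat_choice)
    have "through {} a N (g 0) X" using X(2) subset_almost_subset[OF subset_refl] g0 by (rule through_mono)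
    then show "\<exists>S. infinite S \<and> (\<exists>N. through {} a N (g 0) S) \<and> S \<subseteq> X" using X(1) by blast
  next
    fix S n assume S: "infinite S \<and> (\<exists>N. through {} a N (g n) S) \<and> S \<subseteq> X"
    then obtain N where N: "through {} a N (g n) S" by blast
    have "\<exists>Y\<subseteq>S. infinite Y \<and> (\<exists>N'. through {} a N' (g (Suc n)) Y)"
      by (rule resolve_stage[OF _ N]) (use S dep g_inc in simp_all)
    then show "\<exists>Y. (infinite Y \<and> (\<exists>N. through {} a N (g (Suc n)) Y) \<and> Y \<subseteq> X) \<and> Y \<subseteq> S"
      using S by blast
  qed
  then obtain S where S: "\<forall>n. (infinite (S n) \<and> (\<exists>N. through {} a N (g n) (S n)) \<and> S n \<subseteq> X) \<and> S (Suc n) \<subseteq> S n"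
    by (rule exE)
  then have S_inf: "infinite (S n)" and S_dec: "S (Suc n) \<subseteq> S n" and "\<exists>N. through {} a N (g n) (S n)" for n
    by simp_all
  then obtain N where N: "\<And>n. through {} a (N n) (g n) (S n)" by metis
  obtain Y where Y: "infinite Y" "Y \<subseteq> S 0" "\<And>n. Y \<subseteq>* S n"
    using pseudo_intersection[of S, OF S_inf S_dec] by blast
  have thY: "through {} a (N n) (g n) Y" for n
    using N Y(3) le_refl[OF gK] by (rule through_mono)
  have posY: "\<not> covered {} Y" using Y(1) by (simp add: covered_empty_iff)
  define N' where "N' = {k. \<exists>n. k \<prec> g n \<and> k \<in> N n}"
  have agree: "N' \<inter> underS r (g n) = N n \<inter> underS r (g n)" for n
  proof -
    have "k \<in> N' \<longleftrightarrow> k \<in> N n" if k: "k \<prec> g n" for k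
    proof
      assume "k \<in> N'"
      then obtain i where i: "k \<prec> g i" "k \<in> N i" unfolding N'_def by blast
      obtain k' where "k' \<preceq> g i" "k' \<preceq> g n" "k \<prec> k'"
        using lt_or_le[OF gK[of i] gK[of n]] k i(1) le_refl[OF gK] lt_imp_le by blast
      then show "k \<in> N n" using through_unique[OF posY thY[of i] thY[of n]] i(2) by blast
    qed (use k in \<open>auto simp: N'_def\<close>)
    then show ?thesis by blast
  qed
  have "covered {} (Y - Z a N' k)" if k: "k \<prec> m" for k
  proof -
    obtain n where n: "k \<prec> g n" using g_cof k by blast
    have "through {} a N' (g n) Y" using through_local[OF agree[of n], of "{}" a Y] thY[of n] by simp
    then show ?thesis using n unfolding through_def by blast
  qed
  then have "through {} a N' m Y" unfolding through_def by blast
  moreover have "Y \<subseteq> X" using Y(2) S by (meson subset_trans)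
  ultimately show ?thesis using Y(1) m by blast
qed

text \<open>
  Apply the Cantor
  scheme with the empty family, where positive means infinite, and continue each branch to a limit level.  The resulting continuum
  many nodes are pairwise incomparable, so an old node extends at most one of them.
\<close>

lemma free_node:
  assumes g: "good a" and few: "\<not> |UNIV :: nat set set| \<le>o |{p. a p \<noteq> {}}|" and X: "infinite X"
  shows "\<exists>m\<in>M. \<exists>N\<subseteq>underS r m. \<exists>Y\<subseteq>X. infinite Y \<and> (\<forall>k. k \<prec> m \<longrightarrow> Y \<subseteq>* Z a N k) \<and>
     (\<forall>l H. a (l, H) \<noteq> {} \<longrightarrow> \<not> (m \<preceq> l \<and> H \<inter> underS r m = N))"
proof -
  have pos: "\<not> covered {} X" using X by (simp add: covered_empty_iff)
  have ad: "pairwise almost_disjoint {}" by simp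
  obtain Y \<delta> N where YN: "\<forall>f :: nat set. Y f \<subseteq> X \<and> \<not> covered {} (Y f) \<and> \<delta> f \<in> K \<and>
      through {} a (N f) (\<delta> f) (Y f)"
    and sep: "\<forall>f g. f \<noteq> g \<longrightarrow> (\<exists>k. k \<prec> \<delta> f \<and> k \<prec> \<delta> g \<and> N f \<inter> underS r k = N g \<inter> underS r k \<and>
        (Y f \<subseteq>* C a (N f) k \<and> Y g \<subseteq>* - C a (N f) k \<or> Y f \<subseteq>* - C a (N f) k \<and> Y g \<subseteq>* C a (N f) k))"
    using cantor_scheme[OF ad pos, of a] by (elim exE conjE) (rule that)
  have Y: "Y f \<subseteq> X" "infinite (Y f)" "\<delta> f \<in> K" "through {} a (N f) (\<delta> f) (Y f)" for f
    using YN by (simp_all add: covered_empty_iff)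
  have "\<forall>f. \<exists>Y' m N'. Y' \<subseteq> Y f \<and> infinite Y' \<and> m \<in> M \<and> \<delta> f \<preceq> m \<and> through {} a N' m Y'"
  proof
    fix f
    obtain Y' m N' where "Y' \<subseteq> Y f" "infinite Y'" "m \<in> M" "\<delta> f \<preceq> m" "through {} a N' m Y'"
      using resolve[OF Y(2,4,3)[of f]] by (elim exE bexE conjE) (rule that)
    then show "\<exists>Y' m N'. Y' \<subseteq> Y f \<and> infinite Y' \<and> m \<in> M \<and> \<delta> f \<preceq> m \<and> through {} a N' m Y'"
      by (intro exI conjI)
  qed
  then obtain Y' m N' where R: "\<forall>f. Y' f \<subseteq> Y f \<and> infinite (Y' f) \<and> m f \<in> M \<and> \<delta> f \<preceq> m f \<and> through {} a (N' f) (m f) (Y' f)"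
    unfolding choice_iff by (elim exE) (rule that)
  have agree: "N' f \<inter> underS r (\<delta> f) = N f \<inter> underS r (\<delta> f)" for f
  proof (rule through_unique[of "{}" "Y' f"])
    show "\<not> covered {} (Y' f)" using R by (simp add: covered_empty_iff)
    show "through {} a (N' f) (m f) (Y' f)" "\<delta> f \<preceq> m f" using R by simp_all
    show "through {} a (N f) (\<delta> f) (Y' f)"
      using Y(4) subset_almost_subset[of "Y' f" "Y f"] le_refl[OF Y(3)] R by (blast intro: through_mono)
    show "\<delta> f \<preceq> \<delta> f" by (rule le_refl[OF Y(3)])
  qed
  have "\<exists>f. \<forall>l H. a (l, H) \<noteq> {} \<longrightarrow> \<not> (m f \<preceq> l \<and> H \<inter> underS r (m f) = N' f \<inter> underS r (m f))"
  proof (rule ccontr)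
    assume "\<not> ?thesis"
    then have "\<forall>f. \<exists>p. a p \<noteq> {} \<and> m f \<preceq> fst p \<and> snd p \<inter> underS r (m f) = N' f \<inter> underS r (m f)" by force
    then obtain p where p: "\<forall>f. a (p f) \<noteq> {} \<and> m f \<preceq> fst (p f) \<and> snd (p f) \<inter> underS r (m f) = N' f \<inter> underS r (m f)"
      by metis
    have mem: "k \<in> N f \<longleftrightarrow> k \<in> snd (p f)" if k: "k \<prec> \<delta> f" for k f
    proof -
      have "k \<prec> m f" using k R lt_le_trans by blast
      then have "k \<in> snd (p f) \<longleftrightarrow> k \<in> N' f" using p by blast
      then show ?thesis using agree[of f] k by blast
    qed
    have fin: "finite (Y f - Z a (N f) k)" if "k \<prec> \<delta> f" for f k
      using Y(4)[of f] that unfolding through_def covered_empty_iff by blast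
    have side: "k \<in> N f" if "k \<prec> \<delta> f" "Y f \<subseteq>* C a (N f) k" for f k
    proof (rule ccontr)
      assume "k \<notin> N f"
      then have "finite (Y f \<inter> C a (N f) k)"
        using fin[OF that(1)] unfolding Z_def by simp
      then show False using that(2) Y(2)[of f] unfolding almost_subset_def by (metis Un_Diff_Int finite_UnI)
    qed
    have side': "k \<notin> N f" if "k \<prec> \<delta> f" "Y f \<subseteq>* - C a (N f) k" for f k
    proof
      assume "k \<in> N f"
      then have "finite (Y f - C a (N f) k)"
        using fin[OF that(1)] unfolding Z_def by simp
      then show False using that(2) Y(2)[of f] unfolding almost_subset_def
        by (metis Diff_Compl Un_Diff_Int finite_UnI)
    qed
    have "inj p"
    proof (rule injI, rule ccontr)
      fix f g assume eq: "p f = p g" and "f \<noteq> g"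
      then obtain k where k: "k \<prec> \<delta> f" "k \<prec> \<delta> g" "N f \<inter> underS r k = N g \<inter> underS r k"
         "Y f \<subseteq>* C a (N f) k \<and> Y g \<subseteq>* - C a (N f) k \<or> Y f \<subseteq>* - C a (N f) k \<and> Y g \<subseteq>* C a (N f) k"
        using sep by metis
      have C: "C a (N f) k = C a (N g) k" by (rule C_local[OF lt_K(1)[OF k(1)] k(3)])
      have "k \<in> N f \<longleftrightarrow> k \<in> N g" using mem[OF k(1)] mem[OF k(2)] eq by simp
      then show False using k(4) side[OF k(1)] side'[OF k(1)] side[OF k(2)] side'[OF k(2)] C by auto
    qed
    moreover have "range p \<subseteq> {p. a p \<noteq> {}}" using p by blast
    ultimately have "|UNIV :: nat set set| \<le>o |{p. a p \<noteq> {}}|" using card_of_ordLeq by blast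
    then show False using few by blast
  qed
  then obtain f where f: "\<forall>l H. a (l, H) \<noteq> {} \<longrightarrow> \<not> (m f \<preceq> l \<and> H \<inter> underS r (m f) = N' f \<inter> underS r (m f))" by blast
  have R': "Y' f \<subseteq> Y f" "infinite (Y' f)" "m f \<in> M" "through {} a (N' f) (m f) (Y' f)" using R by simp_all
  have "Y' f \<subseteq>* Z a (N' f \<inter> underS r (m f)) k" if "k \<prec> m f" for k
  proof -
    have "Z a (N' f \<inter> underS r (m f)) k = Z a (N' f) k" by (rule Z_local[OF _ that]) blast
    then show ?thesis using R'(4) that unfolding through_def covered_empty_iff almost_subset_def by simp
  qed
  then show ?thesis using R'(1-3) Y(1) f
    by (intro bexI[of _ "m f"] exI[of _ "N' f \<inter> underS r (m f)"] exI[of _ "Y' f"] conjI) auto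
qed

text \<open>
  \<open>p\<close> is an initial segment of a node that carries a member.
\<close>

definition extends :: "('k \<times> 'k set \<Rightarrow> nat set) \<Rightarrow> 'k \<times> 'k set \<Rightarrow> bool" where
  "extends a p \<longleftrightarrow> (\<exists>l H. a (l, H) \<noteq> {} \<and> fst p \<preceq> l \<and> H \<inter> underS r (fst p) = snd p)"

lemma extends_self: "good a \<Longrightarrow> a p \<noteq> {} \<Longrightarrow> extends a p"
proof -
  assume g: "good a" and ne: "a p \<noteq> {}"
  obtain l H where p: "p = (l, H)" by (cases p)
  then have "a (l, H) \<noteq> {}" using ne by simp
  note node = good_node[OF g this]
  have "H \<inter> underS r l = H" using node(3) by blast
  then show ?thesis using ne le_refl[OF node(2)] unfolding extends_def p fst_conv snd_conv by blast
qed

text \<open>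
  Sides on a branch depend only on the members at initial segments of the branch.
\<close>

lemma Z_stable:
  assumes "k \<in> K" and "\<And>l. l \<in> M \<Longrightarrow> l \<preceq> k \<Longrightarrow> a (l, N \<inter> underS r l) = a' (l, N \<inter> underS r l)"
  shows "Z a N k = Z a' N k"
  using C_cong[of k N N a a'] assms unfolding Z_def by simp

lemma good_disjoint: "good a \<Longrightarrow> a p \<noteq> {} \<Longrightarrow> a q \<noteq> {} \<Longrightarrow> p \<noteq> q \<Longrightarrow> finite (a p \<inter> a q)"
  unfolding good_def by blast

text \<open>
  Since the new node is not an initial segment of an old one, the sets below old nodes do not change; and the sets below
  the new node do not involve the new member, which sits on top of them.
\<close>

lemma extend_family:
  assumes J: "dense_family J" and g: "good a" and few: "\<not> |UNIV :: nat set set| \<le>o |{p. a p \<noteq> {}}|"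
    and pos: "\<not> covered (fam a) B"
  shows "\<exists>p A. A \<in> J \<and> A \<subseteq> B \<and> A \<noteq> {} \<and> good (a(p := A)) \<and> \<not> extends a p"
proof -
  obtain X where X: "X \<subseteq> B" "infinite X" "\<forall>p. finite (a p \<inter> X)"
    using escape[OF g few pos] by (elim exE conjE) (rule that)
  obtain m N Y where mN: "m \<in> M" "N \<subseteq> underS r m" and Y: "Y \<subseteq> X" "infinite Y" "\<forall>k. k \<prec> m \<longrightarrow> Y \<subseteq>* Z a N k"
    and free: "\<forall>l H. a (l, H) \<noteq> {} \<longrightarrow> \<not> (m \<preceq> l \<and> H \<inter> underS r m = N)"
    using free_node[OF g few X(2)] by (elim bexE exE conjE) (rule that)
  obtain A where A: "A \<in> J" "A \<subseteq> Y" "infinite A"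
    using J Y(2) unfolding dense_family_def infsets_def by blast
  have mK: "m \<in> K" using mN(1) M_sub by blast
  define a' where "a' = a((m, N) := A)"
  have a'_new: "a' (m, N) = A" and a'_old: "q \<noteq> (m, N) \<Longrightarrow> a' q = a q" for q
    unfolding a'_def by simp_all
  have "a (m, N) = {}" using free le_refl[OF mK] mN(2) by blast
  have Z_new: "Z a' N k = Z a N k" if k: "k \<prec> m" for k
  proof (rule Z_stable[OF lt_K(1)[OF k]])
    fix l assume "l \<preceq> k"
    then have "l \<noteq> m" using k le_not_lt by blast
    then show "a' (l, N \<inter> underS r l) = a (l, N \<inter> underS r l)" by (simp add: a'_old)
  qed
  have Z_old: "Z a' H k = Z a H k" if H: "a (l, H) \<noteq> {}" and k: "k \<prec> l" for l H k
  proof (rule Z_stable[OF lt_K(1)[OF k]])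
    fix j assume "j \<preceq> k"
    then have "j \<preceq> l" using k lt_imp_le le_lt_trans by blast
    then have "(j, H \<inter> underS r j) \<noteq> (m, N)" using free H by blast
    then show "a' (j, H \<inter> underS r j) = a (j, H \<inter> underS r j)" by (rule a'_old)
  qed
  have new_ad: "finite (A \<inter> a q)" for q
    using X(3)[rule_format, of q] by (rule rev_finite_subset) (use A(2) Y(1) in blast)
  have "good a'"
    unfolding good_def
  proof (intro conjI allI impI)
    fix e H assume ne: "a' (e, H) \<noteq> {}"
    have "e \<in> M \<and> H \<subseteq> underS r e \<and> infinite (a' (e, H)) \<and> (\<forall>k. k \<prec> e \<longrightarrow> a' (e, H) \<subseteq>* Z a' H k)"
    proof (cases "(e, H) = (m, N)")
      case True
      have "A \<subseteq>* Z a' N k" if "k \<prec> m" for k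
        using subset_almost_subset_trans[OF A(2)] Y(3) that Z_new[OF that] by metis
      then show ?thesis using True mN A(3) a'_new by auto
    next
      case False
      then have e: "a' (e, H) = a (e, H)" by (rule a'_old)
      then have "a (e, H) \<noteq> {}" using ne by simp
      note node = good_node[OF g this] and Zo = Z_old[OF this]
      show ?thesis using node Zo e by simp
    qed
    then show "e \<in> M" "H \<subseteq> underS r e" "infinite (a' (e, H))" "\<And>k. k \<prec> e \<Longrightarrow> a' (e, H) \<subseteq>* Z a' H k" by blast+
  next
    fix p q assume pq: "a' p \<noteq> {}" "a' q \<noteq> {}" "p \<noteq> q"
    consider "p = (m, N)" "q \<noteq> (m, N)" | "q = (m, N)" "p \<noteq> (m, N)" | "p \<noteq> (m, N)" "q \<noteq> (m, N)" using pq(3) by blast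
    then show "finite (a' p \<inter> a' q)"
    proof cases
      case 1 then show ?thesis using new_ad[of q] a'_new a'_old by simp
    next
      case 2 then show ?thesis using new_ad[of p] a'_new a'_old by (simp add: Int_commute)
    next
      case 3
      have "a p \<noteq> {}" "a q \<noteq> {}" using pq(1,2) a'_old[OF 3(1)] a'_old[OF 3(2)] by simp_all
      then have "finite (a p \<inter> a q)" using pq(3) by (rule good_disjoint[OF g])
      then show ?thesis using a'_old[OF 3(1)] a'_old[OF 3(2)] by simp
    qed
  qed
  moreover have "\<not> extends a (m, N)" using free unfolding extends_def fst_conv snd_conv by blast
  moreover have "A \<subseteq> B" using A(2) Y(1) X(1) by blast
  moreover have "A \<noteq> {}" using A(3) by auto
  ultimately show ?thesis using A(1) unfolding a'_def by blast
qed

section \<open>The recursion\<close>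

text \<open>
  The family given by a partial sequence of choices \<open>t\<close>, restricted to the stages in \<open>S\<close>.  Distinct stages choose distinct nodes,
  so each union is over at most one set.
\<close>

definition assemble :: "('b \<Rightarrow> (('k \<times> 'k set) \<times> nat set) option) \<Rightarrow> 'b set \<Rightarrow> 'k \<times> 'k set \<Rightarrow> nat set" where
  "assemble t S p = \<Union>{A. \<exists>b\<in>S. t b = Some (p, A)}"

lemma assemble_insert:
  assumes "assemble t S p = {}" "t b = Some (p, A)"
  shows "assemble t (insert b S) = (assemble t S)(p := A)"
proof
  fix q
  show "assemble t (insert b S) q = ((assemble t S)(p := A)) q"
  proof (cases "q = p")
    case True
    have "{A'. \<exists>b'\<in>insert b S. t b' = Some (p, A')} = insert A {A'. \<exists>b'\<in>S. t b' = Some (p, A')}"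
      using assms(2) by auto
    then have "assemble t (insert b S) p = A \<union> assemble t S p" unfolding assemble_def by simp
    then show ?thesis using True assms(1) by simp
  next
    case False
    have "{A'. \<exists>b'\<in>insert b S. t b' = Some (q, A')} = {A'. \<exists>b'\<in>S. t b' = Some (q, A')}"
      using assms(2) False by auto
    then show ?thesis using False unfolding assemble_def by simp
  qed
qed

lemma assemble_mono: "S \<subseteq> S' \<Longrightarrow> assemble t S p \<subseteq> assemble t S' p"
  unfolding assemble_def by blast

lemma assemble_nonempty: "assemble t S p \<noteq> {} \<Longrightarrow> \<exists>b\<in>S. \<exists>A. t b = Some (p, A) \<and> A \<noteq> {}"
  unfolding assemble_def by blast

text \<open>
  The specification of one step of the recursion, with a default value when the step has nothing to do.
\<close>

definition stage_ok :: "nat set set \<Rightarrow> ('k \<times> 'k set \<Rightarrow> nat set) \<Rightarrow> nat set \<Rightarrow> (('k \<times> 'k set) \<times> nat set) option \<Rightarrow> bool" where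
  "stage_ok J a B x \<longleftrightarrow> (if good a \<and> \<not> covered (fam a) B
     then \<exists>p A. x = Some (p, A) \<and> A \<in> J \<and> A \<subseteq> B \<and> A \<noteq> {} \<and> good (a(p := A)) \<and> \<not> extends a p
     else x = None)"

text \<open>
  The stages are indexed by the subsets of \<open>\<omega>\<close> in a well-ordering of type continuum, so fewer than
  continuum many nodes are occupied before any stage.
\<close>

lemma recursion:
  assumes J: "dense_family J"
  shows "\<exists>t. \<forall>B. stage_ok J (assemble t (underS |UNIV :: nat set set| B)) B (t B)"
proof -
  define W where "W = |UNIV :: nat set set|"
  have wW: "wo_rel W" unfolding W_def wo_rel_def by (rule card_of_Well_order)
  have "\<exists>t. \<forall>B. stage_ok J (assemble t (underS W B)) B (t B)"
  proof (rule dependent_wf_choice[where P = "\<lambda>t B x. stage_ok J (assemble t (underS W B)) B x"])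
    show "wf (W - Id)" by (rule wo_rel.WF[OF wW])
  next
    fix t t' :: "nat set \<Rightarrow> (('k \<times> 'k set) \<times> nat set) option" and B x
    assume "\<And>b. (b, B) \<in> W - Id \<Longrightarrow> t b = t' b"
    then have "t b = t' b" if "b \<in> underS W B" for b using that unfolding underS_def by blast
    then have "assemble t (underS W B) = assemble t' (underS W B)"
      unfolding assemble_def by (intro ext arg_cong[where f = Union]) auto
    then show "stage_ok J (assemble t (underS W B)) B x = stage_ok J (assemble t' (underS W B)) B x" by simp
  next
    fix t :: "nat set \<Rightarrow> (('k \<times> 'k set) \<times> nat set) option" and B
    define a where "a = assemble t (underS W B)"
    show "\<exists>x. stage_ok J (assemble t (underS W B)) B x"
    proof (cases "good a \<and> \<not> covered (fam a) B")
      case True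
      have "{p. a p \<noteq> {}} \<subseteq> (\<lambda>b. fst (the (t b))) ` underS W B"
        using assemble_nonempty unfolding a_def by force
      then have le: "|{p. a p \<noteq> {}}| \<le>o |underS W B|"
        by (rule ordLeq_transitive[OF card_of_mono1 card_of_image])
      have "|underS W B| <o |UNIV :: nat set set|"
        unfolding W_def by (rule card_of_underS[OF card_of_Card_order]) (simp add: Field_card_of)
      then have "\<not> |UNIV :: nat set set| \<le>o |{p. a p \<noteq> {}}|"
        by (rule not_ordLess_ordLeq[OF ordLeq_ordLess_trans[OF le]])
      from extend_family[OF J _ this] True
      obtain p A where "A \<in> J \<and> A \<subseteq> B \<and> A \<noteq> {} \<and> good (a(p := A)) \<and> \<not> extends a p" by blast
      then have "stage_ok J a B (Some (p, A))" using True unfolding stage_ok_def by auto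
      then show ?thesis unfolding a_def by blast
    next
      case False
      then have "stage_ok J a B None" unfolding stage_ok_def by auto
      then show ?thesis unfolding a_def by blast
    qed
  qed
  then show ?thesis unfolding W_def .
qed

text \<open>
  The invariant passes to unions along the well-ordering.  A member placed at \<open>b\<close> satisfies it for the family available just
  after \<open>b\<close>; a member placed later is never at an initial segment of its node,
  so the sets on the levels below its node remain the same.
\<close>

lemma good_chain:
  fixes t :: "nat set \<Rightarrow> (('k \<times> 'k set) \<times> nat set) option"
  assumes W: "wo_rel W" and FW: "Field W = UNIV"
    and down: "\<And>b c. b \<in> S \<Longrightarrow> (c, b) \<in> W \<Longrightarrow> c \<in> S"
    and ok: "\<And>b. b \<in> S \<Longrightarrow> stage_ok J (assemble t (underS W b)) b (t b)"
    and prev: "\<And>b. b \<in> S \<Longrightarrow> good (assemble t (underS W b))"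
  shows "good (assemble t S)" and "b \<in> S \<Longrightarrow> t b = Some (p, A) \<Longrightarrow> assemble t S p = A \<and> A \<noteq> {}"
proof -
  have under_eq: "under W b = insert b (underS W b)" for b
    using wo_rel.REFL[OF W] FW unfolding under_def underS_def refl_on_def by auto
  have placed: "A \<noteq> {} \<and> assemble t (under W b) = (assemble t (underS W b))(p := A) \<and>
      good (assemble t (under W b)) \<and> \<not> extends (assemble t (underS W b)) p"
    if b: "b \<in> S" and t: "t b = Some (p, A)" for b p A
  proof -
    have s: "A \<noteq> {}" "good ((assemble t (underS W b))(p := A))" "\<not> extends (assemble t (underS W b)) p"
      using ok[OF b] prev[OF b] t unfolding stage_ok_def by (auto split: if_splits)
    have "assemble t (underS W b) p = {}"
    proof (rule ccontr)
      assume "assemble t (underS W b) p \<noteq> {}"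
      then show False using s(3) extends_self[OF prev[OF b]] by blast
    qed
    then have "assemble t (under W b) = (assemble t (underS W b))(p := A)"
      unfolding under_eq using t by (rule assemble_insert)
    then show ?thesis using s by simp
  qed
  have sub: "under W b \<subseteq> S" if "b \<in> S" for b using down[OF that] unfolding under_def by blast
  have unique: "b = b'" if b: "b \<in> S" "t b = Some (p, A)" and b': "b' \<in> S" "t b' = Some (p, A')" for b b' p A A'
  proof -
    have no: False if c: "c \<in> S" "t c = Some (p, X)" and d: "d \<in> S" "t d = Some (p, Y)" and "c \<in> underS W d" for c d X Y
    proof -
      have "X \<subseteq> assemble t (underS W d) p" using c(2) \<open>c \<in> underS W d\<close> unfolding assemble_def by blast
      then have ne: "assemble t (underS W d) p \<noteq> {}" using placed[OF c] by blast
      then show False using extends_self[OF prev[OF d(1)]] placed[OF d] by blast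
    qed
    have "b = b' \<or> b \<in> underS W b' \<or> b' \<in> underS W b"
      using wo_rel.TOTALS[OF W] FW unfolding underS_def by blast
    then show ?thesis using no[OF b b'] no[OF b' b] by blast
  qed
  have at_node: "assemble t S p = A" if b: "b \<in> S" "t b = Some (p, A)" for b p A
  proof -
    have "{A'. \<exists>b'\<in>S. t b' = Some (p, A')} = {A}"
      using b unique[OF b] by fastforce
    then show ?thesis unfolding assemble_def by simp
  qed
  have before: "assemble t (under W b) q = assemble t S q"
    if b: "b \<in> S" and q: "assemble t (under W b) q \<noteq> {} \<or> assemble t S q = {}" for b q
  proof (cases "assemble t S q = {}")
    case True
    then show ?thesis using assemble_mono[OF sub[OF b]] by blast
  next
    case False
    then obtain c A where c: "c \<in> under W b" "t c = Some (q, A)" using q assemble_nonempty by metis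
    then have "assemble t S q = A" using at_node sub[OF b] by blast
    moreover have "A \<subseteq> assemble t (under W b) q" using c unfolding assemble_def by blast
    ultimately show ?thesis using assemble_mono[OF sub[OF b]] by blast
  qed
  show "b \<in> S \<Longrightarrow> t b = Some (p, A) \<Longrightarrow> assemble t S p = A \<and> A \<noteq> {}"
    using at_node placed by blast
  show "good (assemble t S)"
    unfolding good_def
  proof (intro conjI allI impI)
    fix e N assume ne: "assemble t S (e, N) \<noteq> {}"
    obtain b A where b: "b \<in> S" "t b = Some ((e, N), A)" using assemble_nonempty[OF ne] by blast
    define a where "a = assemble t (under W b)"
    note pl = placed[OF b]
    have a_e: "a (e, N) = A" unfolding a_def using pl by simp
    have S_e: "assemble t S (e, N) = A" using at_node[OF b] .
    have ga: "good a" unfolding a_def using pl by blast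
    have "a (e, N) \<noteq> {}" using a_e pl by blast
    note node = good_node[OF ga this]
    have "Z (assemble t S) N k = Z a N k" if k: "k \<prec> e" for k
    proof (rule Z_stable[OF lt_K(1)[OF k]])
      fix l assume l: "l \<in> M" "l \<preceq> k"
      define q where "q = (l, N \<inter> underS r l)"
      have "a q = assemble t S q"
      proof (rule ccontr)
        assume neq: "a q \<noteq> assemble t S q"
        then have aq: "a q = {}" and Sq: "assemble t S q \<noteq> {}" using before[OF b(1), of q] unfolding a_def by auto
        obtain c X where c: "c \<in> S" "t c = Some (q, X)" using assemble_nonempty[OF Sq] by blast
        have "c \<notin> under W b"
        proof
          assume "c \<in> under W b"
          then have "X \<subseteq> a q" unfolding a_def assemble_def using c(2) by blast
          then show False using aq placed[OF c] by blast
        qed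
        then have bc: "b \<in> underS W c"
          using wo_rel.TOTALS[OF W] wo_rel.REFL[OF W] FW unfolding underS_def under_def refl_on_def by blast
        then have "A \<subseteq> assemble t (underS W c) (e, N)" using b(2) unfolding assemble_def by blast
        then have "assemble t (underS W c) (e, N) \<noteq> {}" using pl by blast
        moreover have "l \<preceq> e" using l(2) k lt_imp_le le_lt_trans by blast
        ultimately have "extends (assemble t (underS W c)) q" unfolding extends_def q_def by auto
        then show False using placed[OF c] by blast
      qed
      then show "assemble t S (l, N \<inter> underS r l) = a (l, N \<inter> underS r l)" unfolding q_def by simp
    qed
    then have "\<forall>k. k \<prec> e \<longrightarrow> assemble t S (e, N) \<subseteq>* Z (assemble t S) N k"
      using node(5) a_e S_e by simp
    then show "e \<in> M" "N \<subseteq> underS r e" "infinite (assemble t S (e, N))"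
      "\<And>k. k \<prec> e \<Longrightarrow> assemble t S (e, N) \<subseteq>* Z (assemble t S) N k"
      using node(1,3,4) a_e S_e by simp_all
  next
    fix p q assume pq: "assemble t S p \<noteq> {}" "assemble t S q \<noteq> {}" "p \<noteq> q"
    have later: "finite (assemble t S p \<inter> assemble t S q)"
      if b: "b \<in> S" "t b = Some (p, A)" and c: "c \<in> S" "t c = Some (q, X)" and "(b, c) \<in> W" and "p \<noteq> q"
      for b c p q A X
    proof -
      define a where "a = assemble t (under W c)"
      have "good a" unfolding a_def using placed[OF c] by blast
      have "c \<in> under W c" using under_eq by blast
      then have "A \<subseteq> a p" "X \<subseteq> a q" using b(2) c(2) \<open>(b, c) \<in> W\<close> unfolding a_def assemble_def under_def by blast+
      then have "a p \<noteq> {}" "a q \<noteq> {}" using placed[OF b] placed[OF c] by blast+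
      moreover from this have "a p = assemble t S p" "a q = assemble t S q"
        using before[OF c(1)] unfolding a_def by blast+
      ultimately show ?thesis using good_disjoint[OF \<open>good a\<close> _ _ \<open>p \<noteq> q\<close>] by metis
    qed
    obtain b A where b: "b \<in> S" "t b = Some (p, A)" using assemble_nonempty[OF pq(1)] by blast
    obtain c X where c: "c \<in> S" "t c = Some (q, X)" using assemble_nonempty[OF pq(2)] by blast
    have "(b, c) \<in> W \<or> (c, b) \<in> W" using wo_rel.TOTALS[OF W] FW by blast
    then show "finite (assemble t S p \<inter> assemble t S q)"
      using later[OF b c _ pq(3)] later[OF c b _ pq(3)[symmetric]] by (auto simp: Int_commute)
  qed
qed

lemma saturated_family:
  assumes J: "dense_family J"
  shows "\<exists>\<A>\<subseteq>J. pairwise almost_disjoint \<A> \<and> (\<forall>B. \<not> covered \<A> B \<longrightarrow> (\<exists>A\<in>\<A>. A \<subseteq> B))"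
proof -
  define W where "W = |UNIV :: nat set set|"
  have wW: "wo_rel W" unfolding W_def wo_rel_def by (rule card_of_Well_order)
  have FW: "Field W = UNIV" unfolding W_def by (rule Field_card_of)
  obtain t where t: "\<And>B. stage_ok J (assemble t (underS W B)) B (t B)"
    using recursion[OF J] unfolding W_def by blast
  have down: "c \<in> underS W B" if "b \<in> underS W B" "(c, b) \<in> W" for b c B
    using that wo_rel.TRANS[OF wW] wo_rel.ANTISYM[OF wW] unfolding underS_def
    by (auto dest: transD antisymD)
  have g: "good (assemble t (underS W B))" for B
  proof (induction B rule: wo_rel.well_order_induct[OF wW])
    case (1 B)
    show ?case
    proof (rule good_chain(1)[OF wW FW down t])
      show "good (assemble t (underS W b))" if "b \<in> underS W B" for b
        using 1 that unfolding underS_def by blast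
    qed
  qed
  define a where "a = assemble t UNIV"
  have good_a: "good a" unfolding a_def by (rule good_chain(1)[OF wW FW _ t g]) simp
  have a_val: "a p = A" "A \<noteq> {}" if "t b = Some (p, A)" for b p A
    using good_chain(2)[OF wW FW _ t g, of UNIV b p A] that unfolding a_def by simp_all
  have below_val: "assemble t (underS W B) p = A" if "b \<in> underS W B" "t b = Some (p, A)" for b B p A
    by (rule good_chain(2)[OF wW FW _ t g that, THEN conjunct1]) (rule down)
  have "fam a \<subseteq> J"
  proof
    fix A assume "A \<in> fam a"
    then obtain p where p: "A = a p" "a p \<noteq> {}" unfolding fam_def by blast
    then obtain b A' where b: "t b = Some (p, A')" using assemble_nonempty unfolding a_def by blast
    then have "A' \<in> J" using t[of b] unfolding stage_ok_def by (auto split: if_splits)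
    then show "A \<in> J" using a_val(1)[OF b] p(1) by simp
  qed
  moreover have "\<exists>A\<in>fam a. A \<subseteq> B" if B: "\<not> covered (fam a) B" for B
  proof -
    have "fam (assemble t (underS W B)) \<subseteq> fam a"
    proof
      fix A assume "A \<in> fam (assemble t (underS W B))"
      then obtain p where p: "A = assemble t (underS W B) p" "assemble t (underS W B) p \<noteq> {}" unfolding fam_def by blast
      then obtain b A' where b: "b \<in> underS W B" "t b = Some (p, A')" using assemble_nonempty by blast
      then have "A = a p" using below_val[OF b] a_val(1)[OF b(2)] p(1) by simp
      then show "A \<in> fam a" using p unfolding fam_def by blast
    qed
    then have "\<not> covered (fam (assemble t (underS W B))) B" using B covered_mono_family by blast
    then obtain p A where "t B = Some (p, A)" "A \<subseteq> B"
      using t[of B] g[of B] unfolding stage_ok_def by (auto split: if_splits)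
    then show ?thesis using a_val[of B p A] unfolding fam_def by (intro bexI[of _ A]) auto
  qed
  ultimately show ?thesis using good_ad[OF good_a] by blast
qed

end

section \<open>Tasks from the guessing principle\<close>

text \<open>
  The data extracted from the hypotheses of the theorem; \<open>y\<close> enumerates a simultaneously splitting family.
\<close>

locale guessing = cardinal_order r for r :: "'k rel" +
  fixes \<theta> :: "'t rel" and F :: "(nat \<Rightarrow> nat) set" and E :: "'k set" and P :: "'k \<Rightarrow> 'k set set"
    and y :: "'k \<Rightarrow> nat set"
  assumes astar: "is_a_star \<theta>" and theta_infinite: "natLeq \<le>o \<theta>"
    and scale: "scale F" and F_less: "|F| <o r"
    and splitting_number: "is_splitting_number r"
    and Pr: "Pr_witness r \<theta> E P"
    and y_splits: "(\<And>n :: nat. infinite (s n)) \<Longrightarrow> \<exists>k\<in>Field r. \<forall>n. infinite (s n \<inter> y k) \<and> infinite (s n - y k)"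
begin

lemma E_club: "club r E" using Pr unfolding Pr_witness_def by (elim conjE)

lemma E_K: "E \<subseteq> K" using E_club unfolding club_def by (elim conjE)

lemma P_sets: "j \<in> E \<Longrightarrow> u \<in> P j \<Longrightarrow> countable u \<and> u \<subseteq> underS r j"
  using Pr unfolding Pr_witness_def by simp

lemma P_mono: "i \<in> E \<Longrightarrow> j \<in> E \<Longrightarrow> i \<preceq> j \<Longrightarrow> P i \<subseteq> P j"
  using Pr unfolding Pr_witness_def by simp

lemma P_less: "j \<in> E \<Longrightarrow> |P j| <o r"
  using Pr unfolding Pr_witness_def by simp

text \<open>
  Base sets with index up to \<open>g\<close>, and the graph sets for all guesses available at \<open>g\<close>.  Only an infinite guess gives
  infinitely many columns.
\<close>

definition T :: "'k \<Rightarrow> 'k task set" where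
  "T g = Base ` y ` under r g \<union>
     {Graph u f |u f. f \<in> F \<and> infinite u \<and> (\<exists>j\<in>E. j \<preceq> g \<and> u \<in> P j)}"

text \<open>
  The guesses increase along \<open>E\<close>, so those available at \<open>g\<close> all belong to the last element of \<open>E\<close> up to \<open>g\<close>.
\<close>

lemma guesses_less:
  assumes g: "g \<in> K" shows "|{u. \<exists>j\<in>E. j \<preceq> g \<and> u \<in> P j}| <o r"
proof (cases "{j\<in>E. j \<preceq> g} = {}")
  case True
  then have "finite {u. \<exists>j\<in>E. j \<preceq> g \<and> u \<in> P j}" by simp
  then show ?thesis by (rule finite_less)
next
  case False
  have "\<exists>s\<in>E. (\<forall>x\<in>{j\<in>E. j \<preceq> g}. x \<preceq> s) \<and> s \<preceq> g \<and> s = wo_rel.supr r {j\<in>E. j \<preceq> g}"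
    by (rule club_sup[OF E_club _ False g]) auto
  then obtain s where s: "s \<in> E" "\<And>j. j \<in> E \<Longrightarrow> j \<preceq> g \<Longrightarrow> j \<preceq> s" by blast
  have "{u. \<exists>j\<in>E. j \<preceq> g \<and> u \<in> P j} \<subseteq> P s"
  proof clarify
    fix u j assume "j \<in> E" "j \<preceq> g" "u \<in> P j"
    then show "u \<in> P s" using P_mono[OF _ s(1), of j] s(2)[of j] by blast
  qed
  then show ?thesis using P_less[OF s(1)] by (rule card_less_subset)
qed

lemma T_less: assumes g: "g \<in> K" shows "|T g| <o r"
proof -
  define G where "G = {u. \<exists>j\<in>E. j \<preceq> g \<and> u \<in> P j}"
  have "|(\<lambda>(u, f). Graph u f) ` (G \<times> F)| <o r"
    unfolding G_def by (rule card_less_image[OF Times_less[OF guesses_less[OF g] F_less]])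
  moreover have "|Base ` y ` under r g :: 'k task set| <o r"
    by (intro card_less_image less_under g)
  ultimately have "|(Base ` y ` under r g) \<union> ((\<lambda>(u, f). Graph u f) ` (G \<times> F))| <o r" by (rule Un_less[rotated])
  moreover have "T g \<subseteq> (Base ` y ` under r g) \<union> ((\<lambda>(u, f). Graph u f) ` (G \<times> F))"
    unfolding T_def G_def by force
  ultimately show ?thesis by (rule card_less_subset[rotated])
qed

sublocale stages r E T
proof
  show "\<exists>x\<in>K. A \<subseteq> underS r x" if "countable A" "A \<subseteq> K" for A
    using splitting_number_uncountable_cofinality[OF splitting_number infinite_card that] .
  show "E \<subseteq> K" by (rule E_K)
  show "\<exists>e\<in>E. x \<preceq> e" if "x \<in> K" for x
    using E_club that unfolding club_def by simp
  show "T x \<subseteq> T y'" if "x \<preceq> y'" for x y'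
    using le_trans[OF _ that] unfolding T_def under_def by blast
  show "|T x| <o r" if "x \<in> K" for x by (rule T_less[OF that])
  show "T x \<noteq> {}" if "x \<in> K" for x
    using le_refl[OF that] unfolding T_def under_def by blast
qed

definition task :: "'k \<Rightarrow> 'k task" where
  "task = (SOME t. \<forall>g\<in>G. (\<forall>k. g \<preceq> k \<and> k \<prec> h g \<longrightarrow> t k \<in> T g) \<and>
     (\<forall>x\<in>T g. \<exists>k. g \<prec> k \<and> k \<prec> h g \<and> t k = x))"

lemma task: "\<forall>g\<in>G. (\<forall>k. g \<preceq> k \<and> k \<prec> h g \<longrightarrow> task k \<in> T g) \<and>
     (\<forall>x\<in>T g. \<exists>k. g \<prec> k \<and> k \<prec> h g \<and> task k = x)"
  unfolding task_def by (rule someI_ex[OF tasks_exist])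

lemma task_in: "g \<in> G \<Longrightarrow> g \<preceq> k \<Longrightarrow> k \<prec> h g \<Longrightarrow> task k \<in> T g"
  using task by simp

lemma task_performed:
  assumes g: "g \<in> G" and x: "x \<in> T g" shows "\<exists>k. g \<prec> k \<and> k \<prec> h g \<and> k \<notin> M \<and> task k = x"
proof -
  obtain k where k: "g \<prec> k" "k \<prec> h g" "task k = x" using task g x by metis
  then have "k \<notin> M" using M_stage[OF g lt_imp_le[OF k(1)] k(2)] lt_irrefl by blast
  then show ?thesis using k by blast
qed

lemma T_Graph:
  assumes "Graph u f \<in> T g" shows "u \<subseteq> underS r g" "infinite u" "countable u"
proof -
  obtain j where j: "j \<in> E" "j \<preceq> g" "u \<in> P j" and "infinite u" using assms unfolding T_def by blast
  then show "infinite u" "countable u" using P_sets[OF j(1,3)] by blast+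
  have "underS r j \<subseteq> underS r g" using j(2) lt_le_trans by blast
  then show "u \<subseteq> underS r g" using P_sets[OF j(1,3)] by blast
qed

lemma task_Graph:
  assumes k: "k \<in> K" "task k = Graph u f" shows "u \<subseteq> underS r k \<and> infinite u \<and> countable u"
proof -
  obtain g where g: "g \<in> G" "g \<preceq> k" "k \<prec> h g" using stage_exists[OF k(1)] by blast
  have "Graph u f \<in> T g" using task_in[OF g] k(2) by simp
  note u = T_Graph[OF this]
  have "underS r g \<subseteq> underS r k" using g(2) lt_le_trans by blast
  then show ?thesis using u by blast
qed

lemma stage_Graph:
  assumes g: "g \<in> G" and k: "k \<prec> h g" "task k = Graph u f" shows "u \<subseteq> underS r g"
proof -
  note kK = lt_K(1)[OF k(1)]
  have gK: "g \<in> K" using g G_K by blast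
  consider "k \<prec> g" | "g \<preceq> k" using lt_or_le[OF kK gK] by blast
  then show ?thesis
  proof cases
    case 1
    then have "underS r k \<subseteq> underS r g" using lt_trans by blast
    then show ?thesis using task_Graph[OF kK k(2)] by blast
  next
    case 2
    then show ?thesis using task_in[OF g 2 k(1)] k(2) T_Graph(1) by simp
  qed
qed

lemma stage_M_le: "g \<in> G \<Longrightarrow> k \<in> M \<Longrightarrow> k \<prec> h g \<Longrightarrow> k \<preceq> g"
  using lt_or_le[of g k] M_stage[of g k] lt_imp_le lt_irrefl G_K M_K by blast

lemma M_limit_of_E: "m \<in> M \<Longrightarrow> x \<prec> m \<Longrightarrow> \<exists>e\<in>E. x \<prec> e \<and> e \<prec> m"
  using h_E[OF lt_K(1)] h_gt[OF lt_K(1)] M_closed by blast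

lemma M_E:
  assumes m: "m \<in> M" and ne: "underS r m \<noteq> {}" shows "m \<in> E"
proof -
  define A where "A = E \<inter> underS r m"
  have "A \<noteq> {}" using M_limit_of_E[OF m] ne unfolding A_def by blast
  moreover have "\<And>x. x \<in> A \<Longrightarrow> x \<preceq> m" "A \<subseteq> E" unfolding A_def using lt_imp_le by blast+
  moreover have "m \<in> K" using m M_K by blast
  ultimately obtain s where s: "s \<in> E" "\<forall>x\<in>A. x \<preceq> s" "s \<preceq> m" using club_sup[OF E_club, of A m] by blast
  have "\<not> s \<prec> m"
  proof
    assume "s \<prec> m"
    then obtain e where "e \<in> A" "s \<prec> e" using M_limit_of_E[OF m] unfolding A_def by blast
    then show False using s(2) le_not_lt by blast
  qed
  then have "s = m" using le_iff_lt_or_eq[OF s(3)] by blast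
  then show ?thesis using s(1) by simp
qed

text \<open>
  All stage points other than the least level belong to \<open>E\<close>, so \<open>Pr_hits\<close> applies to them.  At a limit level the guess is available strictly
  before it, which leaves room to treat it below the limit.
\<close>

lemma guess:
  assumes g: "g \<in> G" and w: "w \<subseteq> underS r g" "\<theta> \<le>o |w|"
  shows "\<exists>j\<in>E. \<exists>u\<in>P j. infinite (u \<inter> w) \<and> j \<preceq> g \<and> (g \<in> M \<longrightarrow> j \<prec> g)"
proof -
  have theta_card: "Card_order \<theta>" using astar unfolding is_a_star_def by blast
  have "natLeq \<le>o |w|" using theta_infinite w(2) by (rule ordLeq_transitive)
  then have "infinite w" using infinite_iff_natLeq_ordLeq by blast
  then have ne: "underS r g \<noteq> {}" using w(1) by (metis finite.emptyI subset_empty)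
  have "g \<in> E"
  proof (cases "g \<in> M")
    case True then show ?thesis using M_E ne by blast
  next
    case False
    then obtain g' where "g' \<in> G" "g = h g'" using G_cases[OF g] by blast
    then show ?thesis using h_E G_K by blast
  qed
  from Pr_hits[OF Pr theta_card theta_infinite this w]
  show ?thesis using M_limit_of_E by blast
qed

sublocale tree r M task
proof
  show "\<exists>x\<in>K. A \<subseteq> underS r x" if "countable A" "A \<subseteq> K" for A
    using countable_bounded[OF that] .
  show "u \<subseteq> underS r k \<and> infinite u \<and> countable u" if "k \<in> K" "task k = Graph u f" for k u f
    using task_Graph[OF that] .
  show "\<exists>k\<in>K - M. \<exists>Y. task k = Base Y \<and> (\<forall>n. infinite (s n \<inter> Y) \<and> infinite (s n - Y))"
    if s: "\<And>n. infinite (s n)" for s :: "nat \<Rightarrow> nat set"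
  proof -
    obtain x where x: "x \<in> K" "\<forall>n. infinite (s n \<inter> y x) \<and> infinite (s n - y x)" using y_splits[of s, OF s] by blast
    obtain g where g: "g \<in> G" "g \<preceq> x" "x \<prec> h g" using stage_exists[OF x(1)] by blast
    have "Base (y x) \<in> T (h g)" using lt_imp_le[OF g(3)] unfolding T_def under_def by blast
    then obtain k where k: "k \<prec> h (h g)" "k \<notin> M" "task k = Base (y x)"
      using task_performed[OF h_G[OF g(1)]] by blast
    then show ?thesis using x(2) lt_K(1)[OF k(1)] by blast
  qed
qed

lemma guess_treated:
  assumes g: "g \<in> G" "h g \<preceq> \<delta>" and u: "j \<in> E" "j \<preceq> g" "u \<in> P j" "infinite u"
  shows "treated F \<delta> u"
  unfolding treated_def
proof
  fix f assume "f \<in> F"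
  then have "Graph u f \<in> T g" using u unfolding T_def by blast
  then obtain k where k: "k \<prec> h g" "k \<notin> M" "task k = Graph u f" using task_performed[OF g(1)] by blast
  then have "k \<prec> \<delta>" using lt_le_trans[OF k(1) g(2)] by blast
  then show "\<exists>k\<in>underS r \<delta> - M. task k = Graph u f" using k by blast
qed

text \<open>
  A limit level is its own checkpoint.  Otherwise let \<open>g < \<delta> \<le> h g\<close>.  If \<open>g\<close> is a limit level, it is a checkpoint: guesses for sets
  below \<open>g\<close> are treated before \<open>g\<close>.  If \<open>g = h g'\<close>, the guesses for sets below \<open>g'\<close> are treated only between \<open>g'\<close> and \<open>g\<close>,
  and \<open>g'\<close> is a checkpoint.  The sets between \<open>g\<close> and \<open>\<delta>\<close> may then depend on the branch between \<open>g'\<close> and \<open>g\<close>,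
  which is why a checkpoint allows columns beyond \<open>e\<close>.
\<close>

lemma checkpoint_exists:
  assumes \<delta>: "\<delta> \<in> K" shows "\<exists>e. checkpoint \<theta> F \<delta> e"
proof -
  have inf_u: "infinite u" if "infinite (u \<inter> w)" for u w :: "'k set" using that by blast
  have hit_M: "\<exists>u. infinite (u \<inter> w) \<and> treated F \<delta>' u"
    if m: "m \<in> M" "m \<preceq> \<delta>'" and w: "w \<subseteq> underS r m" "\<theta> \<le>o |w|" for m \<delta>' w
  proof -
    have "m \<in> G" using m M_G by blast
    then obtain j u where ju: "j \<in> E" "u \<in> P j" "infinite (u \<inter> w)" "j \<prec> m"
      using guess[OF _ w] m(1) by blast
    obtain g where g: "g \<in> G" "g \<preceq> j" "j \<prec> h g" using stage_exists[OF lt_K(1)[OF ju(4)]] by blast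
    have "g \<prec> m" using g(2) ju(4) le_lt_trans by blast
    then have "h (h g) \<prec> m" using M_closed[OF m(1)] by blast
    then have "h (h g) \<preceq> \<delta>'" using m(2) lt_le_trans lt_imp_le by blast
    from guess_treated[OF h_G[OF g(1)] this ju(1) lt_imp_le[OF g(3)] ju(2) inf_u[OF ju(3)]]
    show ?thesis using ju(3) by blast
  qed
  show ?thesis
  proof (cases "\<delta> \<in> M")
    case True
    have sh: "u' \<subseteq> underS r \<delta>" if "k \<prec> \<delta>" "task k = Graph u f" "j \<in> u" "task j = Graph u' f'" for k u f j u' f'
    proof -
      have "j \<prec> k" using task_Graph[OF lt_K(1)[OF that(1)] that(2)] that(3) by blast
      then have "j \<prec> \<delta>" using that(1) lt_trans by blast
      then have "underS r j \<subseteq> underS r \<delta>" using lt_trans by blast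
      then show ?thesis using task_Graph[OF lt_K(1)[OF \<open>j \<prec> \<delta>\<close>] that(4)] by blast
    qed
    show ?thesis
      unfolding checkpoint_def
    proof (intro exI[of _ \<delta>] conjI allI impI ballI)
      show "\<delta> \<preceq> \<delta>" by (rule le_refl[OF \<delta>])
      show "\<exists>u. infinite (u \<inter> w) \<and> treated F \<delta> u"
        if "w \<subseteq> underS r \<delta> \<and> \<theta> \<le>o |w|" for w
        using hit_M[OF True le_refl[OF \<delta>]] that by blast
    qed (use lt_imp_le sh in blast)+
  next
    case nM: False
    obtain g0 where g0: "g0 \<in> G" "g0 \<preceq> \<delta>" "\<delta> \<prec> h g0" using stage_exists[OF \<delta>] by blast
    have "\<exists>g\<in>G. g \<prec> \<delta> \<and> \<delta> \<preceq> h g"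
    proof (cases "g0 = \<delta>")
      case True
      then obtain g where g: "g \<in> G" "\<delta> = h g" using G_cases[OF g0(1)] nM by blast
      then have "g \<prec> \<delta>" using h_gt G_K by blast
      then show ?thesis using g le_refl[OF \<delta>] by blast
    next
      case False
      then have "g0 \<prec> \<delta>" using le_iff_lt_or_eq[OF g0(2)] by blast
      then show ?thesis using g0 lt_imp_le by blast
    qed
    then obtain g where g: "g \<in> G" "g \<prec> \<delta>" "\<delta> \<preceq> h g" by blast
    have below: "k \<prec> h g" if "k \<prec> \<delta>" for k using that g(3) lt_le_trans by blast
    show ?thesis
    proof (cases "g \<in> M")
      case True
      have sh: "u' \<subseteq> underS r g" if "k \<prec> \<delta>" "task k = Graph u f" "j \<in> u" "task j = Graph u' f'" for k u f j u' f'
      proof -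
        have "j \<prec> g" using stage_Graph[OF g(1) below[OF that(1)] that(2)] that(3) by blast
        then have "j \<prec> h g" using g(2) lt_trans below by blast
        then show ?thesis using stage_Graph[OF g(1) _ that(4)] by blast
      qed
      show ?thesis
        unfolding checkpoint_def
      proof (intro exI[of _ g] conjI allI impI ballI)
        show "g \<preceq> \<delta>" by (rule lt_imp_le[OF g(2)])
        show "\<exists>u. infinite (u \<inter> w) \<and> treated F \<delta> u"
          if "w \<subseteq> underS r g \<and> \<theta> \<le>o |w|" for w
          using hit_M[OF True lt_imp_le[OF g(2)]] that by blast
        show "\<delta> \<preceq> l" if "l \<in> M" "g \<prec> l" for l
          using M_closed[OF that] g(3) le_lt_trans lt_imp_le by blast
        show "k \<preceq> g" if "k \<prec> \<delta>" "k \<in> M" for k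
          using stage_M_le[OF g(1) that(2) below[OF that(1)]] .
      qed (use sh in blast)
    next
      case False
      then obtain g' where g': "g' \<in> G" "g = h g'" using G_cases[OF g(1)] by blast
      have g'g: "g' \<prec> g" using g' h_gt G_K by blast
      have sh: "u' \<subseteq> underS r g'" if "k \<prec> \<delta>" "task k = Graph u f" "j \<in> u" "task j = Graph u' f'" for k u f j u' f'
      proof -
        have "j \<prec> h g'" using stage_Graph[OF g(1) below[OF that(1)] that(2)] that(3) g'(2) by blast
        then show ?thesis using stage_Graph[OF g'(1) _ that(4)] by blast
      qed
      show ?thesis
        unfolding checkpoint_def
      proof (intro exI[of _ g'] conjI allI impI ballI)
        show "g' \<preceq> \<delta>" by (rule lt_imp_le[OF lt_trans[OF g'g g(2)]])
        show "\<exists>u. infinite (u \<inter> w) \<and> treated F \<delta> u"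
          if w: "w \<subseteq> underS r g' \<and> \<theta> \<le>o |w|" for w
        proof -
          obtain j u where ju: "j \<in> E" "u \<in> P j" "infinite (u \<inter> w)" "j \<preceq> g'"
            using guess[OF g'(1), of w] w by blast
          have "h g' \<preceq> \<delta>" using g'(2) g(2) lt_imp_le by blast
          from guess_treated[OF g'(1) this ju(1,4,2) inf_u[OF ju(3)]] show ?thesis using ju(3) by blast
        qed
        show "\<delta> \<preceq> l" if "l \<in> M" "g' \<prec> l" for l
          using M_closed[OF that(1) M_closed[OF that]] g'(2) g(3) le_lt_trans lt_imp_le by blast
        show "k \<preceq> g'" if k: "k \<prec> \<delta>" "k \<in> M" for k
        proof -
          have "k \<preceq> g" using stage_M_le[OF g(1) k(2) below[OF k(1)]] .
          moreover have "k \<noteq> g" using k(2) False by blast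
          ultimately have "k \<prec> h g'" using le_iff_lt_or_eq g'(2) by blast
          then show ?thesis using stage_M_le[OF g'(1) k(2)] by blast
        qed
      qed (use sh in blast)
    qed
  qed
qed

text \<open>
  The stages \<open>g, h g, h (h g), \<dots>\<close> that start with the stage of \<open>\<delta>\<close>.
\<close>

lemma staircase_exists:
  assumes \<delta>: "\<delta> \<in> K" shows "\<exists>g m. staircase \<delta> g m"
proof -
  obtain g where g: "g \<in> G" "g \<preceq> \<delta>" "\<delta> \<prec> h g" using stage_exists[OF \<delta>] by blast
  have gK: "g \<in> K" using g(1) G_K by blast
  have nG: "(h ^^ n) g \<in> G" for n by (induction n) (use g(1) h_G in auto)
  obtain m where m: "m \<in> M" "\<forall>n. (h ^^ n) g \<prec> m" "\<forall>k. k \<prec> m \<longrightarrow> (\<exists>n. k \<prec> (h ^^ n) g)"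
    using next_limit[OF gK] by blast
  have "h g \<prec> m" using m(2)[rule_format, of 1] by simp
  show ?thesis
    unfolding staircase_def
  proof (intro exI[of _ "\<lambda>n. (h ^^ n) g"] exI[of _ m] conjI allI impI ballI)
    show "\<delta> \<preceq> m" using lt_imp_le[OF lt_trans[OF g(3) \<open>h g \<prec> m\<close>]] .
    show "(h ^^ 0) g \<preceq> \<delta>" using g(2) by simp
    show "(h ^^ n) g \<prec> (h ^^ Suc n) g" for n using h_gt[OF iter_K[OF gK]] by simp
    show "\<exists>n. k \<prec> (h ^^ n) g" if "k \<prec> m" for k using m(3) that by blast
    show "k = (h ^^ n) g" if "(h ^^ n) g \<preceq> k \<and> k \<prec> (h ^^ Suc n) g" "k \<in> M" for n k
      using M_stage[OF nG[of n]] that by simp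
    show "u \<subseteq> underS r ((h ^^ n) g)"
      if "(h ^^ n) g \<preceq> k \<and> k \<prec> (h ^^ Suc n) g" "k \<notin> M \<and> task k = Graph u f" for n k u f
      using stage_Graph[OF nG[of n], of k u f] that by simp
    show "m \<in> M" by (rule m(1))
  qed
qed

sublocale node_tree r M task \<theta> F
proof
  show "is_a_star \<theta>" "natLeq \<le>o \<theta>" "scale F" by (rule astar theta_infinite scale)+
  show "\<exists>Y\<subseteq>X. infinite Y \<and> (\<forall>D\<in>\<F>. Y \<subseteq>* D \<or> Y \<subseteq>* - D)" if "|\<F>| <o r" "infinite X" for \<F> X
    using unsplit_refinement[OF splitting_number that] .
  show "M \<subseteq> K" by (rule M_K)
  show "\<exists>e. checkpoint \<theta> F \<delta> e" if "\<delta> \<in> K" for \<delta> by (rule checkpoint_exists[OF that])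
  show "\<exists>g m. staircase \<delta> g m" if "\<delta> \<in> K" for \<delta> by (rule staircase_exists[OF that])
qed

end

section \<open>Saturated families\<close>

text \<open>
  The recursion by itself might stop after finitely many steps with a finite cover of \<open>\<omega>\<close>.  Members
  that are inside one piece of a fixed infinite partition, or almost disjoint from all its pieces, prevent this.
\<close>

lemma dense_family_refine:
  assumes "dense_family J"
  shows "dense_family {A\<in>J. (\<exists>n. A \<subseteq> Q n) \<or> (\<forall>n. finite (A \<inter> Q n))}"
  unfolding dense_family_def
proof (intro conjI ballI)
  show "{A\<in>J. (\<exists>n. A \<subseteq> Q n) \<or> (\<forall>n. finite (A \<inter> Q n))} \<subseteq> infsets"
    using assms unfolding dense_family_def by blast
  fix B assume "B \<in> infsets"
  show "\<exists>A\<in>{A\<in>J. (\<exists>n. A \<subseteq> Q n) \<or> (\<forall>n. finite (A \<inter> Q n))}. A \<subseteq> B"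
  proof (cases "\<exists>n. infinite (B \<inter> Q n)")
    case True
    then obtain n where "B \<inter> Q n \<in> infsets" unfolding infsets_def by blast
    then obtain A where "A \<in> J" "A \<subseteq> B \<inter> Q n" using assms unfolding dense_family_def by blast
    then show ?thesis by blast
  next
    case False
    obtain A where A: "A \<in> J" "A \<subseteq> B" using assms \<open>B \<in> infsets\<close> unfolding dense_family_def by blast
    have "finite (A \<inter> Q n)" for n
    proof (rule finite_subset)
      show "finite (B \<inter> Q n)" using False by blast
    qed (use A(2) in blast)
    then show ?thesis using A by blast
  qed
qed

text \<open>
  Each set of the family meets at most one piece of the partition in an infinite set, so a finite family leaves some piece untouched.
\<close>

lemma partition_not_covered:
  fixes Q :: "nat \<Rightarrow> nat set"
  assumes Q: "\<And>n. infinite (Q n)" "\<And>m n. m \<noteq> n \<Longrightarrow> Q m \<inter> Q n = {}"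
    and \<A>: "\<And>A. A \<in> \<A> \<Longrightarrow> (\<exists>n. A \<subseteq> Q n) \<or> (\<forall>n. finite (A \<inter> Q n))"
    and fin: "finite \<A>"
  shows "\<not> covered \<A> UNIV"
proof -
  have one: "finite {n. infinite (A \<inter> Q n)}" if A: "A \<in> \<A>" for A
  proof (cases "\<exists>n. A \<subseteq> Q n")
    case True
    then obtain n where n: "A \<subseteq> Q n" by blast
    have "{n. infinite (A \<inter> Q n)} \<subseteq> {n}"
    proof clarify
      fix m assume "infinite (A \<inter> Q m)"
      then have "A \<inter> Q m \<noteq> {}" by (metis finite.emptyI)
      then show "m = n" using Q(2)[of m n] n by blast
    qed
    then show ?thesis using finite_subset by blast
  next
    case False
    then have "{n. infinite (A \<inter> Q n)} = {}" using \<A>[OF A] by blast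
    then show ?thesis by simp
  qed
  have "finite (\<Union>A\<in>\<A>. {n. infinite (A \<inter> Q n)})" using fin one by blast
  then obtain n where n: "n \<notin> (\<Union>A\<in>\<A>. {n. infinite (A \<inter> Q n)})" using ex_new_if_finite infinite_UNIV_nat by metis
  show ?thesis
    by (rule not_covered_if_almost_disjoint[OF Q(1)[of n]]) (use n in auto)
qed

theorem theorem2p6:
  fixes \<kappa> :: "'k rel" and \<theta> :: "'t rel" and J :: "nat set set"
  assumes "is_a_star \<theta>" and "is_splitting_number \<kappa>" and "\<theta> <o \<kappa>"
    and "dense_family J"
    and "Pr \<kappa> \<theta>"
  shows "\<exists>\<A>. saturated_MAD \<A> \<and> \<A> \<subseteq> J"
proof -
  have card: "Card_order \<kappa>" "natLeq \<le>o \<theta>" using assms(5) unfolding Pr_def by blast+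
  have inf: "natLeq \<le>o \<kappa>" using card(2) assms(3) ordLeq_ordLess_trans ordLess_imp_ordLeq by blast
  obtain E P where Pr: "Pr_witness \<kappa> \<theta> E P" using assms(5) unfolding Pr_def by blast
  obtain F where F: "scale F" "|F| \<le>o \<theta>" using scale_exists[OF assms(1)] by blast
  have F_less: "|F| <o \<kappa>" using F(2) assms(3) by (rule ordLeq_ordLess_trans)
  obtain y :: "'k \<Rightarrow> nat set" where y: "\<forall>a :: nat \<Rightarrow> nat set. (\<forall>j. infinite (a j)) \<longrightarrow>
    (\<exists>k\<in>Field \<kappa>. \<forall>j. infinite (a j \<inter> y k) \<and> infinite (a j - y k))"
    using simultaneous_splitting_family[OF assms(2) inf F(1) ordLess_imp_ordLeq[OF F_less]] by (rule exE)
  interpret guessing \<kappa> \<theta> F E P y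
    by unfold_locales (use card inf assms(1,2) F(1) F_less Pr y in simp_all)
  define Q where "Q n = {x. fst (prod_decode x) = n}" for n
  have Q_inf: "infinite (Q n)" for n
  proof
    assume "finite (Q n)"
    moreover have "(\<lambda>i. prod_encode (n, i)) ` UNIV \<subseteq> Q n" unfolding Q_def by auto
    ultimately have "finite ((\<lambda>i. prod_encode (n, i)) ` UNIV)" using finite_subset by blast
    moreover have "inj (\<lambda>i. prod_encode (n, i))" by (rule injI) simp
    ultimately show False using finite_imageD infinite_UNIV_nat by blast
  qed
  have Q_disj: "Q m \<inter> Q n = {}" if "m \<noteq> n" for m n using that unfolding Q_def by blast
  \<comment> \<open>A partition of \<open>\<omega>\<close> into infinitely many infinite pieces keeps the family infinite.\<close>
  define J' where "J' = {A\<in>J. (\<exists>n. A \<subseteq> Q n) \<or> (\<forall>n. finite (A \<inter> Q n))}"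
  have "dense_family J'" unfolding J'_def by (rule dense_family_refine[OF assms(4)])
  from saturated_family[OF this]
  obtain \<A> where \<A>: "\<A> \<subseteq> J'" "pairwise almost_disjoint \<A>" "\<forall>B. \<not> covered \<A> B \<longrightarrow> (\<exists>A\<in>\<A>. A \<subseteq> B)"
    by (elim exE conjE) (rule that)
  have sub: "\<A> \<subseteq> J" "\<A> \<subseteq> infsets" using \<A>(1) assms(4) unfolding J'_def dense_family_def by blast+
  have "infinite \<A>"
  proof
    assume fin: "finite \<A>"
    have "infinite (UNIV - \<Union>\<A>)"
    proof -
      have "\<not> covered \<A> UNIV"
        by (rule partition_not_covered[of Q, OF Q_inf Q_disj _ fin]) (use \<A>(1) J'_def in auto)
      then show ?thesis using covered_Union[OF subset_refl fin] covered_finite[of "UNIV - \<Union>\<A>"]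
          covered_Un[of \<A> "\<Union>\<A>" "UNIV - \<Union>\<A>"] by auto
    qed
    moreover have "A \<inter> (UNIV - \<Union>\<A>) = {}" if "A \<in> \<A>" for A using that by blast
    ultimately have "\<not> covered \<A> (UNIV - \<Union>\<A>)"
      by (intro not_covered_if_almost_disjoint[OF _ subset_refl]) auto
    then obtain A where "A \<in> \<A>" "A \<subseteq> UNIV - \<Union>\<A>" using \<A>(3) by blast
    then have "A = {}" by blast
    then show False using \<open>A \<in> \<A>\<close> sub(2) unfolding infsets_def by auto
  qed
  then have AD: "AD \<A>" using sub(2) \<A>(2) unfolding AD_def by blast
  have "\<B> = \<A>" if \<B>: "AD \<B>" "\<A> \<subseteq> \<B>" for \<B>
  proof (rule ccontr)
    assume "\<B> \<noteq> \<A>"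
    then obtain B where B: "B \<in> \<B>" "B \<notin> \<A>" using \<B>(2) by blast
    have B_ad: "finite (A \<inter> B)" if "A \<in> \<A>" for A
    proof -
      have "A \<in> \<B>" "A \<noteq> B" using that B \<B>(2) by blast+
      then show ?thesis using \<B>(1) B(1) unfolding AD_def pairwise_def almost_disjoint_def by blast
    qed
    have "infinite B" using \<B>(1) B(1) unfolding AD_def infsets_def by blast
    then have "\<not> covered \<A> B" using not_covered_if_almost_disjoint[OF _ subset_refl] B_ad by blast
    then obtain A where A: "A \<in> \<A>" "A \<subseteq> B" using \<A>(3) by blast
    then have "finite A" using B_ad[OF A(1)] by (simp add: Int_absorb2)
    then show False using A(1) sub(2) unfolding infsets_def by blast
  qed
  then have "MAD \<A>" using AD unfolding MAD_def by blast
  moreover have "\<exists>A\<in>\<A>. A \<subseteq>* B" if "B \<in> id_pos \<A>" for B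
    using that \<A>(3) subset_almost_subset unfolding id_pos_def id_ideal_covered by blast
  ultimately show ?thesis using sub(1) unfolding saturated_MAD_def by blast
qed

end
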